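(* Let $p$ be a prime and let $G$ be a finite $p$-group such that $\mathrm{cod}(G)=\{1,p,p^b,p^a\}$, where $2\le b<a$. If $G$ has coclass at most $3$, then $G$ has nilpotence class at most $4$, and $|G|\le p^7$.
   Context: For an irreducible complex character $\chi$ of a finite group $G$, the codegree of $\chi$ is $\mathrm{cod}(\chi)=|G:\ker\chi|/\chi(1)$, and $\mathrm{cod}(G)$ denotes the set of codegrees of the irreducible characters of $G$. The coclass of a $p$-group $G$ of nilpotence class $c$ is $\log_p|G|-c$. *)

theory Defs
  imports "Jordan_Normal_Form.Matrix" "HOL-Algebra.Generated_Groups"
begin

definition mat_trace :: "complex mat \<Rightarrow> complex" where
  "mat_trace A = (\<Sum>i<dim_row A. A $$ (i, i))"

definition is_rep :: "('g, 'b) monoid_scheme \<Rightarrow> nat \<Rightarrow> ('g \<Rightarrow> complex mat) \<Rightarrow> bool" where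
  "is_rep G n \<rho> \<longleftrightarrow>
     (\<forall>g\<in>carrier G. \<rho> g \<in> carrier_mat n n) \<and>
     \<rho> \<one>\<^bsub>G\<^esub> = 1\<^sub>m n \<and>
     (\<forall>g\<in>carrier G. \<forall>h\<in>carrier G. \<rho> (g \<otimes>\<^bsub>G\<^esub> h) = \<rho> g * \<rho> h)"

definition is_subspace :: "nat \<Rightarrow> complex vec set \<Rightarrow> bool" where
  "is_subspace n W \<longleftrightarrow> W \<subseteq> carrier_vec n \<and> 0\<^sub>v n \<in> W \<and>
     (\<forall>v\<in>W. \<forall>w\<in>W. v + w \<in> W) \<and> (\<forall>c. \<forall>v\<in>W. c \<cdot>\<^sub>v v \<in> W)"

definition invariant_subspace ::
  "('g, 'b) monoid_scheme \<Rightarrow> nat \<Rightarrow> ('g \<Rightarrow> complex mat) \<Rightarrow> complex vec set \<Rightarrow> bool" where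
  "invariant_subspace G n \<rho> W \<longleftrightarrow> is_subspace n W \<and>
     (\<forall>g\<in>carrier G. \<forall>v\<in>W. \<rho> g *\<^sub>v v \<in> W)"

definition irreducible_rep :: "('g, 'b) monoid_scheme \<Rightarrow> nat \<Rightarrow> ('g \<Rightarrow> complex mat) \<Rightarrow> bool" where
  "irreducible_rep G n \<rho> \<longleftrightarrow> is_rep G n \<rho> \<and> n > 0 \<and>
     (\<forall>W. invariant_subspace G n \<rho> W \<longrightarrow> W = {0\<^sub>v n} \<or> W = carrier_vec n)"

definition irr_chars :: "('g, 'b) monoid_scheme \<Rightarrow> ('g \<Rightarrow> complex) set" where
  "irr_chars G = {\<chi>. \<exists>n \<rho>. irreducible_rep G n \<rho> \<and>
      \<chi> = (\<lambda>g. if g \<in> carrier G then mat_trace (\<rho> g) else 0)}"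

definition char_kernel :: "('g, 'b) monoid_scheme \<Rightarrow> ('g \<Rightarrow> complex) \<Rightarrow> 'g set" where
  "char_kernel G \<chi> = {g \<in> carrier G. \<chi> g = \<chi> \<one>\<^bsub>G\<^esub>}"

definition codegree :: "('g, 'b) monoid_scheme \<Rightarrow> ('g \<Rightarrow> complex) \<Rightarrow> complex" where
  "codegree G \<chi> = (of_nat (card (carrier G)) / of_nat (card (char_kernel G \<chi>))) / \<chi> \<one>\<^bsub>G\<^esub>"

definition codegrees :: "('g, 'b) monoid_scheme \<Rightarrow> complex set" where
  "codegrees G = codegree G ` irr_chars G"

text \<open>Lower central series: gamma_1 = G, gamma_{i+1} = [gamma_i, G]; here indexed from 0.\<close>
fun lower_central :: "('g, 'b) monoid_scheme \<Rightarrow> nat \<Rightarrow> 'g set" where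
  "lower_central G 0 = carrier G"
| "lower_central G (Suc i) = generate G
     (\<Union>x\<in>lower_central G i. \<Union>y\<in>carrier G.
        {x \<otimes>\<^bsub>G\<^esub> y \<otimes>\<^bsub>G\<^esub> inv\<^bsub>G\<^esub> x \<otimes>\<^bsub>G\<^esub> inv\<^bsub>G\<^esub> y})"

definition nil_class :: "('g, 'b) monoid_scheme \<Rightarrow> nat" where
  "nil_class G = (LEAST c. lower_central G c = {\<one>\<^bsub>G\<^esub>})"

end

theory Submission
  imports Defs "Jordan_Normal_Form.Spectral_Radius" "HOL-Algebra.Multiplicative_Group"
begin

text \<open>Suppose the class is at least \<open>5\<close>. A quotient by a normal subgroup that is maximal among those not
  containing the last nontrivial \<open>\<gamma>_i\<close> has a least nontrivial normal subgroup (it is monolithic), hence a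
  faithful irreducible character \<open>\<chi>\<close>, with \<open>\<chi>(1)\<^sup>2 |Z| \<le> |G|\<close>. Do this for the whole group, for \<open>\<gamma>_3\<close>
  inside the result, and for \<open>\<gamma>_2\<close> inside that quotient, to get groups \<open>G\<close>, \<open>\<Gamma>\<close> (class \<open>3\<close>) and \<open>Q\<close>
  (class \<open>2\<close>) with faithful characters whose codegrees all lie in \<open>{p^b, p^a}\<close>. The coclass bound makes
  the orders so small that the codegree of \<open>Q\<close> is at most \<open>p^3\<close>, while that of \<open>G\<close> is at least \<open>p^4\<close>;
  the codegree of \<open>\<Gamma>\<close> cannot equal the former, so it equals the latter, and this forces
  \<open>\<Gamma> = G/\<gamma>_4\<close> with a faithful character of degree \<open>p\<close>.

  A faithful character of degree \<open>p\<close> forces an abelian subgroup of index \<open>p\<close> and therefore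
  \<open>|\<Gamma>| \<le> p |\<Gamma>'| |Z(\<Gamma>)|\<close>, so the centre of \<open>\<Gamma>\<close> is large. But if the centre of \<open>G/\<gamma>_4\<close> is larger than
  its monolith \<open>\<gamma>_3/\<gamma>_4\<close>, the elements of \<open>\<gamma>_3\<close> have central \<open>p\<close>-th roots modulo \<open>\<gamma>_4\<close>, which makes
  \<open>\<gamma>_3\<close> central modulo \<open>\<gamma>_5\<close> as soon as \<open>|\<gamma>_4/\<gamma>_5| = p\<close>. This is a contradiction.\<close>

section \<open>Linear algebra\<close>

text \<open>Three groups are needed because there are only two codegrees to share. The codegrees
  \<open>1\<close> and \<open>p\<close> are out of reach: a faithful irreducible character of a
  nonabelian \<open>p\<close>-group satisfies \<chi>(1)^2 p \<le> |G|, so its codegree is at least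
  \<open>p^2\<close>.

  The numbers come from the following count. A quotient of the same class \<open>d + 1\<close> still
  has coclass at most 3, so its order \<open>p^m\<close> has \<open>m \<le> d + 4\<close>, while
  strict descent of the lower central series gives |\<gamma>_3| \<ge> \<open>p^(d-1)\<close>. The
  image of \<gamma>_3 in \<Gamma> is the monolith and has order \<open>p\<close>; hence |\<Gamma>|
  \<le> \<open>p^6\<close> and |Q| \<le> \<open>p^5\<close>.

  The centre argument is used twice: for \<Gamma> over \<open>Q\<close>, where it excludes the
  codegree \<open>p^4\<close> for \<open>Q\<close> and one borderline pair of orders, and for
  \<open>G\<close> over \<Gamma>, where it ends the proof. The second use needs |G : \<gamma>_2|
  \<ge> \<open>p^3\<close>, since otherwise the bound on the centre of \<Gamma> yields no more than
  the monolith. A smaller abelianization is excluded separately: it forces |G : \<gamma>_3| \<le>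
  \<open>p^3\<close>, too small for the codegrees.\<close>

lemma injective_square_mat_inverse:
  fixes A :: "'a :: field mat"
  assumes A: "A \<in> carrier_mat n n"
    and inj: "\<And>v. v \<in> carrier_vec n \<Longrightarrow> A *\<^sub>v v = 0\<^sub>v n \<Longrightarrow> v = 0\<^sub>v n"
  obtains B where "B \<in> carrier_mat n n" "A * B = 1\<^sub>m n" "B * A = 1\<^sub>m n"
proof -
  have "det A \<noteq> 0" using det_0_iff_vec_prod_zero[OF A] inj by auto
  from det_non_zero_imp_unit[OF A this, of undefined]
  obtain B where B: "B \<in> carrier_mat n n" "A * B = 1\<^sub>m n" "B * A = 1\<^sub>m n"
    unfolding Units_def ring_mat_def by auto
  from that[OF B] show thesis .
qed

text \<open>For \<open>n < k\<close>, padding with zero rows would give an injective square matrix,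
  hence an invertible one, although its row \<open>n\<close> vanishes.\<close>

lemma injective_mat_dims:
  fixes A :: "'a :: field mat"
  assumes A: "A \<in> carrier_mat n k"
    and inj: "\<And>v. v \<in> carrier_vec k \<Longrightarrow> A *\<^sub>v v = 0\<^sub>v n \<Longrightarrow> v = 0\<^sub>v k"
  shows "k \<le> n"
proof (rule ccontr)
  assume "\<not> k \<le> n"
  hence kn: "n < k" by simp
  define A' where "A' = mat k k (\<lambda>(i,j). if i < n then A $$ (i,j) else 0)"
  have A': "A' \<in> carrier_mat k k" by (simp add: A'_def)
  have row: "(A' *\<^sub>v v) $ i = (if i < n then (A *\<^sub>v v) $ i else 0)" if "v \<in> carrier_vec k" "i < k" for v i
    using that A by (auto simp: A'_def scalar_prod_def intro!: sum.cong)
  obtain B where B: "B \<in> carrier_mat k k" "A' * B = 1\<^sub>m k" "B * A' = 1\<^sub>m k"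
  proof (rule injective_square_mat_inverse[OF A'])
    fix v :: "'a vec" assume v: "v \<in> carrier_vec k" and 0: "A' *\<^sub>v v = 0\<^sub>v k"
    have "A *\<^sub>v v = 0\<^sub>v n"
    proof (rule eq_vecI)
      fix i assume "i < dim_vec (0\<^sub>v n :: 'a vec)"
      hence i: "i < n" by simp
      have "(A *\<^sub>v v) $ i = (A' *\<^sub>v v) $ i" using row[OF v, of i] i kn by simp
      also have "\<dots> = 0" using 0 i kn by simp
      finally show "(A *\<^sub>v v) $ i = 0\<^sub>v n $ i" using i by simp
    qed (use A in simp)
    from inj[OF v this] show "v = 0\<^sub>v k" .
  qed
  have "(A' * B) $$ (n, n) = (A' *\<^sub>v col B n) $ n" using A' B(1) kn by simp
  also have "\<dots> = 0" using row[of "col B n" n] B kn by simp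
  finally show False using B kn by simp
qed

text \<open>The columns of \<open>B\<close> are a basis of \<open>W\<close>. Take an injective
  matrix of greatest width that maps into \<open>W\<close>; \<open>injective_mat_dims\<close> bounds
  the width, and a vector of \<open>W\<close> outside the image could be appended as a further
  column.\<close>

lemma subspace_frame:
  assumes W: "is_subspace n W"
  obtains k B where "B \<in> carrier_mat n k" "k \<le> n"
    "\<And>v. v \<in> carrier_vec k \<Longrightarrow> B *\<^sub>v v = 0\<^sub>v n \<Longrightarrow> v = 0\<^sub>v k"
    "W = (\<lambda>v. B *\<^sub>v v) ` carrier_vec k"
proof -
  define P where "P k \<longleftrightarrow> (\<exists>B \<in> carrier_mat n k. (\<forall>v \<in> carrier_vec k. B *\<^sub>v v = 0\<^sub>v n \<longrightarrow> v = 0\<^sub>v k)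
     \<and> (\<forall>v \<in> carrier_vec k. B *\<^sub>v v \<in> W))" for k
  have bound: "k \<le> n" if "P k" for k
    using that injective_mat_dims[of _ n k] unfolding P_def by blast
  have "P 0"
    unfolding P_def
  proof (rule bexI[of _ "0\<^sub>m n 0"], intro conjI ballI impI)
    fix v :: "complex vec" assume "v \<in> carrier_vec 0"
    thus "v = 0\<^sub>v 0" by (intro eq_vecI) auto
    have "0\<^sub>m n 0 *\<^sub>v v = 0\<^sub>v n" by (intro eq_vecI) (use \<open>v \<in> carrier_vec 0\<close> in \<open>auto simp: scalar_prod_def\<close>)
    thus "0\<^sub>m n 0 *\<^sub>v v \<in> W" using W by (simp add: is_subspace_def)
  qed simp
  define k where "k = (GREATEST k. P k)"
  have Pk: "P k" unfolding k_def using GreatestI_nat[of P 0 n] \<open>P 0\<close> bound by blast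
  have max: "k' \<le> k" if "P k'" for k' unfolding k_def using Greatest_le_nat[of P k' n] that bound by blast
  from Pk obtain B where B: "B \<in> carrier_mat n k"
    and inj: "\<And>v. v \<in> carrier_vec k \<Longrightarrow> B *\<^sub>v v = 0\<^sub>v n \<Longrightarrow> v = 0\<^sub>v k"
    and sub: "\<And>v. v \<in> carrier_vec k \<Longrightarrow> B *\<^sub>v v \<in> W"
    unfolding P_def by blast
  have "w \<in> (\<lambda>v. B *\<^sub>v v) ` carrier_vec k" if w: "w \<in> W" for w
  proof (rule ccontr)
    assume notin: "w \<notin> (\<lambda>v. B *\<^sub>v v) ` carrier_vec k"
    have wc: "w \<in> carrier_vec n" using w W by (auto simp: is_subspace_def)
    define B' where "B' = mat n (Suc k) (\<lambda>(i,j). if j < k then B $$ (i,j) else w $ i)"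
    have B': "B' \<in> carrier_mat n (Suc k)" by (simp add: B'_def)
    have eq: "B' *\<^sub>v v = B *\<^sub>v vec_first v k + (v $ k) \<cdot>\<^sub>v w" if v: "v \<in> carrier_vec (Suc k)" for v
      by (rule eq_vecI) (use v B wc in \<open>auto simp: B'_def scalar_prod_def vec_first_def\<close>)
    have "P (Suc k)"
      unfolding P_def
    proof (rule bexI[OF _ B'], intro conjI ballI impI)
      fix v :: "complex vec" assume v: "v \<in> carrier_vec (Suc k)"
      have "B *\<^sub>v vec_first v k \<in> W" using sub[of "vec_first v k"] by simp
      thus "B' *\<^sub>v v \<in> W" unfolding eq[OF v] using W w by (auto simp: is_subspace_def)
      assume 0: "B' *\<^sub>v v = 0\<^sub>v n"
      have vk: "v $ k = 0"
      proof (rule ccontr)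
        assume nz: "v $ k \<noteq> 0"
        \<comment> \<open>A nonzero last coefficient would allow solving the relation for
          \<open>w\<close>: \<open>B\<close> maps this \<open>u\<close> to \<open>w\<close>.\<close>
        define u where "u = (- 1 / v $ k) \<cdot>\<^sub>v vec_first v k"
        have u: "u \<in> carrier_vec k" by (simp add: u_def)
        have *: "(B *\<^sub>v vec_first v k) $ i + v $ k * w $ i = 0" if "i < n" for i
          using arg_cong[OF 0[unfolded eq[OF v]], of "\<lambda>x. x $ i"] that wc B by simp
        have "B *\<^sub>v u = w"
        proof (rule eq_vecI)
          fix i assume i: "i < dim_vec w"
          hence i: "i < n" using wc by simp
          have "(B *\<^sub>v u) $ i = (- 1 / v $ k) * (B *\<^sub>v vec_first v k) $ i"
            unfolding u_def using B i by simp
          also have "\<dots> = w $ i" using *[OF i] nz by (simp add: field_simps add_eq_0_iff)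
          finally show "(B *\<^sub>v u) $ i = w $ i" .
        qed (use B wc in simp)
        thus False using notin u by blast
      qed
      have "B *\<^sub>v vec_first v k = 0\<^sub>v n"
      proof (rule eq_vecI)
        fix i assume "i < dim_vec (0\<^sub>v n :: complex vec)"
        thus "(B *\<^sub>v vec_first v k) $ i = 0\<^sub>v n $ i"
          using arg_cong[OF 0[unfolded eq[OF v]], of "\<lambda>x. x $ i"] wc B vk by simp
      qed (use B in simp)
      hence "vec_first v k = 0\<^sub>v k" by (intro inj) simp_all
      hence "v $ i = 0" if "i < k" for i
        using that by (metis index_vec index_zero_vec(1) vec_first_def)
      with vk show "v = 0\<^sub>v (Suc k)" using v by (intro eq_vecI) (auto simp: less_Suc_eq)
    qed
    from max[OF this] show False by simp
  qed
  hence "W = (\<lambda>v. B *\<^sub>v v) ` carrier_vec k" using sub by auto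
  from that[OF B bound[OF Pk] inj this] show thesis by blast
qed

section \<open>Traces, triangular matrices and matrices of finite order\<close>

lemma mat_mult_entry:
  assumes "A \<in> carrier_mat n m" "B \<in> carrier_mat m k" "i < n" "j < k"
  shows "(A * B) $$ (i, j) = (\<Sum>l<m. A $$ (i, l) * B $$ (l, j))"
  using assms by (simp add: scalar_prod_def lessThan_atLeast0)

lemma mat_trace_mult_comm:
  assumes "A \<in> carrier_mat n n" "B \<in> carrier_mat n n"
  shows "mat_trace (A * B) = mat_trace (B * A)"
proof -
  have "mat_trace (A * B) = (\<Sum>i<n. \<Sum>l<n. A $$ (i, l) * B $$ (l, i))"
    unfolding mat_trace_def using assms by (auto simp: mat_mult_entry[OF assms] simp del: index_mult_mat(1) intro!: sum.cong)
  also have "\<dots> = (\<Sum>l<n. \<Sum>i<n. B $$ (l, i) * A $$ (i, l))"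
    by (subst sum.swap) (simp add: mult.commute)
  also have "\<dots> = mat_trace (B * A)"
    unfolding mat_trace_def using assms by (auto simp: mat_mult_entry[OF assms(2,1)] simp del: index_mult_mat(1) intro!: sum.cong)
  finally show ?thesis .
qed

lemma upper_triangular_mult:
  fixes A B :: "'a :: comm_ring_1 mat"
  assumes A: "A \<in> carrier_mat n n" and B: "B \<in> carrier_mat n n"
    and "upper_triangular A" "upper_triangular B"
  shows "upper_triangular (A * B)" and "\<And>i. i < n \<Longrightarrow> (A * B) $$ (i, i) = A $$ (i, i) * B $$ (i, i)"
proof -
  have z: "A $$ (i, l) * B $$ (l, j) = 0" if "i < n" "l < n" "j < n" "l < i \<or> j < l" for i j l
    using that assms by (auto simp: upper_triangular_def)
  show "upper_triangular (A * B)"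
  proof (rule upper_triangularI)
    fix i j assume "j < i" "i < dim_row (A * B)"
    hence ij: "j < i" "i < n" using A by auto
    show "(A * B) $$ (i, j) = 0"
      by (subst mat_mult_entry[OF A B]) (use ij in \<open>auto intro!: sum.neutral z\<close>)
  qed
  fix i assume i: "i < n"
  have "(\<Sum>l<n. A $$ (i, l) * B $$ (l, i)) = (\<Sum>l\<in>{i}. A $$ (i, l) * B $$ (l, i))"
    by (rule sum.mono_neutral_right) (use i z[of i _ i] in \<open>auto simp: neq_iff\<close>)
  thus "(A * B) $$ (i, i) = A $$ (i, i) * B $$ (i, i)"
    by (simp add: mat_mult_entry[OF A B] i del: index_mult_mat(1))
qed

lemma upper_triangular_pow:
  fixes A :: "'a :: comm_ring_1 mat"
  assumes A: "A \<in> carrier_mat n n" and "upper_triangular A"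
  shows "upper_triangular (A ^\<^sub>m k) \<and> (\<forall>i<n. (A ^\<^sub>m k) $$ (i, i) = A $$ (i, i) ^ k)"
proof (induction k)
  case 0 show ?case using A by auto
next
  case (Suc k)
  have "A ^\<^sub>m k \<in> carrier_mat n n" using A by simp
  from upper_triangular_mult[OF this A] Suc assms show ?case by (simp add: mult.commute)
qed

text \<open>The sum \<open>1 + B + \<dots> + B^(k-1)\<close> is invertible and annihilates \<open>B - 1\<close>.\<close>

lemma unipotent_finite_order:
  fixes B :: "complex mat"
  assumes B: "B \<in> carrier_mat n n" and ut: "upper_triangular B"
    and diag: "\<And>i. i < n \<Longrightarrow> B $$ (i, i) = 1"
    and k: "k > 0" and pow: "B ^\<^sub>m k = 1\<^sub>m n"
  shows "B = 1\<^sub>m n"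
proof -
  define S where "S = mat n n (\<lambda>(i,j). \<Sum>l<k. (B ^\<^sub>m l) $$ (i, j))"
  have S: "S \<in> carrier_mat n n" by (simp add: S_def)
  have utp: "upper_triangular (B ^\<^sub>m l)" "\<And>i. i < n \<Longrightarrow> (B ^\<^sub>m l) $$ (i, i) = 1" for l
    using upper_triangular_pow[OF B ut, of l] diag by auto
  have "upper_triangular S"
  proof (rule upper_triangularI)
    fix i j assume "j < i" "i < dim_row S"
    thus "S $$ (i, j) = 0" using utp(1) B by (auto simp: S_def upper_triangular_def intro!: sum.neutral)
  qed
  hence "det S = prod_list (diag_mat S)" using S by (rule det_upper_triangular)
  \<comment> \<open>All powers of \<open>B\<close> have ones on the diagonal, so every diagonal
    entry of \<open>S\<close> is \<open>k\<close>.\<close>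
  also have "\<dots> \<noteq> 0"
    using S k by (auto simp: prod_list_zero_iff diag_mat_def S_def utp(2))
  finally have "det S \<noteq> 0" .
  \<comment> \<open>Multiplication by \<open>B\<close> shifts the range of summation by one, and the
    two end terms agree because the powers with exponents \<open>k\<close> and \<open>0\<close> are
    both the identity.\<close>
  have SB: "S * B = S"
  proof (rule eq_matI)
    fix i j assume "i < dim_row S" "j < dim_col S"
    hence ij: "i < n" "j < n" using S by auto
    have "(S * B) $$ (i, j) = (\<Sum>m<n. (\<Sum>l<k. (B ^\<^sub>m l) $$ (i, m)) * B $$ (m, j))"
      using mat_mult_entry[OF S B] ij by (simp add: S_def)
    also have "\<dots> = (\<Sum>l<k. \<Sum>m<n. (B ^\<^sub>m l) $$ (i, m) * B $$ (m, j))"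
      unfolding sum_distrib_right by (rule sum.swap)
    also have "\<dots> = (\<Sum>l<k. (B ^\<^sub>m Suc l) $$ (i, j))"
      using mat_mult_entry[OF pow_carrier_mat[OF B] B] ij by simp
    also have "\<dots> = (\<Sum>l<k. (B ^\<^sub>m l) $$ (i, j))"
    proof -
      have "(\<Sum>l<k. (B ^\<^sub>m Suc l) $$ (i, j)) + (B ^\<^sub>m 0) $$ (i, j) = (\<Sum>l<Suc k. (B ^\<^sub>m l) $$ (i, j))"
        by (subst sum.lessThan_Suc_shift) simp
      moreover have "(B ^\<^sub>m 0) $$ (i, j) = (B ^\<^sub>m k) $$ (i, j)" using pow B by simp
      ultimately show ?thesis by simp
    qed
    finally show "(S * B) $$ (i, j) = S $$ (i, j)" using ij by (simp add: S_def)
  qed (use S B in auto)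
  from det_non_zero_imp_unit[OF S \<open>det S \<noteq> 0\<close>, of undefined] obtain T
    where T: "T \<in> carrier_mat n n" "T * S = 1\<^sub>m n" unfolding Units_def ring_mat_def by auto
  have "B = (T * S) * B" using T B by simp
  also have "\<dots> = T * S" using SB assoc_mult_mat[OF T(1) S B] by simp
  finally show ?thesis using T by simp
qed

text \<open>The \<open>l i\<close> are the diagonal of a Schur form. Powers of a triangular matrix
  act entrywise on its diagonal, so the traces of all powers of \<open>A\<close> are power sums of
  the same numbers; \<open>unipotent_finite_order\<close> handles the case where all of them are
  1.\<close>

lemma finite_order_matrix:
  fixes A :: "complex mat"
  assumes A: "A \<in> carrier_mat n n" and k: "k > 0" and pow: "A ^\<^sub>m k = 1\<^sub>m n"
  obtains l where "\<And>i. i < n \<Longrightarrow> l i ^ k = 1"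
    "\<And>j. mat_trace (A ^\<^sub>m j) = (\<Sum>i<n. l i ^ j)"
    "(\<forall>i<n. l i = 1) \<Longrightarrow> A = 1\<^sub>m n"
proof -
  from char_poly_factorized[OF A] obtain es where es: "char_poly A = (\<Prod>a\<leftarrow>es. [:- a, 1:])" by auto
  obtain B P Q where "schur_decomposition A es = (B, P, Q)" by (metis prod_cases3)
  from schur_decomposition[OF A es this] have wit: "similar_mat_wit A B P Q" and ut: "upper_triangular B"
    by auto
  from similar_mat_witD2[OF A wit] have PQ: "P * Q = 1\<^sub>m n" "Q * P = 1\<^sub>m n"
    and carr: "B \<in> carrier_mat n n" "P \<in> carrier_mat n n" "Q \<in> carrier_mat n n" and AB: "A = P * B * Q"
    by auto
  note B = carr(1)
  have powB: "B ^\<^sub>m j \<in> carrier_mat n n" for j using B by simp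
  have conj: "Q * (A ^\<^sub>m j * P) = B ^\<^sub>m j" for j
  proof -
    have "A ^\<^sub>m j * P = P * B ^\<^sub>m j"
    proof -
      have "A ^\<^sub>m j * P = P * B ^\<^sub>m j * Q * P" using similar_mat_wit_pow_id[OF wit] by simp
      also have "\<dots> = P * B ^\<^sub>m j * (Q * P)"
        by (rule assoc_mult_mat[OF mult_carrier_mat[OF carr(2) powB] carr(3,2)])
      also have "\<dots> = P * B ^\<^sub>m j" using PQ right_mult_one_mat[OF mult_carrier_mat[OF carr(2) powB[of j]]] by simp
      finally show ?thesis .
    qed
    hence "Q * (A ^\<^sub>m j * P) = (Q * P) * B ^\<^sub>m j"
      using assoc_mult_mat[OF carr(3,2) powB] by simp
    thus ?thesis using PQ left_mult_one_mat[OF powB[of j]] by simp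
  qed
  have Bk: "B ^\<^sub>m k = 1\<^sub>m n" using conj[of k] pow carr PQ by simp
  define l where "l i = B $$ (i, i)" for i
  show thesis
  proof (rule that[of l])
    fix i assume i: "i < n"
    have "l i ^ k = (B ^\<^sub>m k) $$ (i, i)" using upper_triangular_pow[OF B ut] i by (simp add: l_def)
    thus "l i ^ k = 1" using Bk i by simp
  next
    fix j
    have "mat_trace (A ^\<^sub>m j) = mat_trace (P * (B ^\<^sub>m j * Q))"
      using similar_mat_wit_pow_id[OF wit, of j] assoc_mult_mat[OF carr(2) powB carr(3)] by simp
    also have "\<dots> = mat_trace (B ^\<^sub>m j * Q * P)"
      using carr powB by (intro mat_trace_mult_comm) auto
    also have "B ^\<^sub>m j * Q * P = B ^\<^sub>m j"
      using assoc_mult_mat[OF powB carr(3,2)] PQ right_mult_one_mat[OF powB[of j]] by simp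
    also have "mat_trace (B ^\<^sub>m j) = (\<Sum>i<n. l i ^ j)"
      unfolding mat_trace_def using B powB[of j] upper_triangular_pow[OF B ut, of j] by (simp add: l_def)
    finally show "mat_trace (A ^\<^sub>m j) = (\<Sum>i<n. l i ^ j)" .
  next
    assume "\<forall>i<n. l i = 1"
    hence "B = 1\<^sub>m n" using unipotent_finite_order[OF B ut _ k Bk] by (simp add: l_def)
    thus "A = 1\<^sub>m n" using AB carr PQ by simp
  qed
qed

text \<open>Equality case of the triangle inequality: every real part is at most 1 and they add up
  to \<open>n\<close>, so each is 1, and norm 1 leaves no imaginary part.\<close>

lemma root_of_unity_sum_eq_card:
  fixes l :: "nat \<Rightarrow> complex"
  assumes "\<And>i. i < n \<Longrightarrow> norm (l i) = 1" "(\<Sum>i<n. l i) = of_nat n" "i < n"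
  shows "l i = 1"
proof -
  have re: "Re (l j) \<le> 1" if "j < n" for j using assms(1)[OF that] complex_Re_le_cmod[of "l j"] by simp
  have "(\<Sum>j<n. 1 - Re (l j)) = 0"
    using arg_cong[OF assms(2), of Re] by (simp add: sum_subtractf)
  hence "1 - Re (l i) = 0"
    using sum_nonneg_eq_0_iff[of "{..<n}" "\<lambda>j. 1 - Re (l j)"] re assms(3) by simp
  moreover have "Re (l i) ^ 2 + Im (l i) ^ 2 = 1"
    using assms(1)[OF assms(3)] by (metis cmod_power2 power_one)
  ultimately show ?thesis by (simp add: complex_eq_iff)
qed

section \<open>Representations of finite groups\<close>

lemma mat_eq_by_action:
  assumes "A \<in> carrier_mat n m" "B \<in> carrier_mat n m"
    and "\<And>v. v \<in> carrier_vec m \<Longrightarrow> A *\<^sub>v v = B *\<^sub>v v"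
  shows "A = (B :: 'a :: comm_ring_1 mat)"
proof (rule mat_col_eqI)
  fix j assume "j < dim_col B"
  hence j: "j < m" using assms by simp
  have "C *\<^sub>v unit_vec m j = col C j" if "C \<in> carrier_mat n m" for C :: "'a mat"
    using that j by (intro eq_vecI) (auto simp: row_def)
  thus "col A j = col B j" using assms(1,2) assms(3)[of "unit_vec m j"] by simp
qed (use assms in auto)

lemma is_repD:
  assumes "is_rep G n \<rho>"
  shows "g \<in> carrier G \<Longrightarrow> \<rho> g \<in> carrier_mat n n" "\<rho> \<one>\<^bsub>G\<^esub> = 1\<^sub>m n"
    "g \<in> carrier G \<Longrightarrow> h \<in> carrier G \<Longrightarrow> \<rho> (g \<otimes>\<^bsub>G\<^esub> h) = \<rho> g * \<rho> h"
  using assms by (auto simp: is_rep_def)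

lemma (in group) rep_pow:
  assumes "is_rep G n \<rho>" "g \<in> carrier G"
  shows "\<rho> (g [^] (k :: nat)) = \<rho> g ^\<^sub>m k"
  using is_repD[OF assms(1)] assms(2) by (induction k) (auto simp: carrier_matD)

lemma (in group) rep_inverse:
  assumes "is_rep G n \<rho>" "g \<in> carrier G"
  shows "\<rho> g * \<rho> (inv g) = 1\<^sub>m n" "\<rho> (inv g) * \<rho> g = 1\<^sub>m n"
  using is_repD[OF assms(1)] assms(2) by (metis inv_closed r_inv, metis inv_closed l_inv)

text \<open>Schur's lemma: an eigenspace of \<open>T\<close> is nonzero and invariant, hence
  everything.\<close>

lemma schur_scalar:
  assumes irr: "irreducible_rep G n \<rho>" and T: "T \<in> carrier_mat n n"
    and comm: "\<And>g. g \<in> carrier G \<Longrightarrow> \<rho> g * T = T * \<rho> g"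
  obtains c where "T = c \<cdot>\<^sub>m 1\<^sub>m n"
proof -
  from irr have rep: "is_rep G n \<rho>" and n: "n > 0"
    and inv: "\<And>W. invariant_subspace G n \<rho> W \<Longrightarrow> W = {0\<^sub>v n} \<or> W = carrier_vec n"
    by (auto simp: irreducible_rep_def)
  from spectrum_non_empty[OF T n] obtain c v where v: "eigenvector T v c"
    by (auto simp: spectrum_def eigenvalue_def)
  define W where "W = {v \<in> carrier_vec n. T *\<^sub>v v = c \<cdot>\<^sub>v v}"
  have "invariant_subspace G n \<rho> W"
    unfolding invariant_subspace_def is_subspace_def
  proof (intro conjI ballI allI)
    show "W \<subseteq> carrier_vec n" by (auto simp: W_def)
    show "0\<^sub>v n \<in> W" using T by (auto simp: W_def)
  next
    fix v w assume "v \<in> W" "w \<in> W"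
    thus "v + w \<in> W" using T by (auto simp: W_def mult_add_distrib_mat_vec smult_add_distrib_vec)
  next
    fix a v assume "v \<in> W"
    thus "a \<cdot>\<^sub>v v \<in> W" using T
      by (auto simp: W_def mult_mat_vec smult_smult_assoc mult.commute)
  next
    fix g v assume g: "g \<in> carrier G" and v: "v \<in> W"
    note rg = is_repD(1)[OF rep g]
    have vc: "v \<in> carrier_vec n" and ev: "T *\<^sub>v v = c \<cdot>\<^sub>v v" using v by (auto simp: W_def)
    have "T *\<^sub>v (\<rho> g *\<^sub>v v) = (\<rho> g * T) *\<^sub>v v" using assoc_mult_mat_vec[OF T rg vc] comm[OF g] by simp
    also have "\<dots> = \<rho> g *\<^sub>v (c \<cdot>\<^sub>v v)" using assoc_mult_mat_vec[OF rg T vc] ev by simp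
    also have "\<dots> = c \<cdot>\<^sub>v (\<rho> g *\<^sub>v v)" using mult_mat_vec[OF rg vc] by simp
    finally show "\<rho> g *\<^sub>v v \<in> W" using rg vc by (simp add: W_def)
  qed
  from inv[OF this] v T have W: "W = carrier_vec n"
    by (auto simp: W_def eigenvector_def)
  have "T = c \<cdot>\<^sub>m 1\<^sub>m n"
  proof (rule mat_eq_by_action[OF T])
    fix v :: "complex vec" assume v: "v \<in> carrier_vec n"
    hence "T *\<^sub>v v = c \<cdot>\<^sub>v v" using W by (auto simp: W_def)
    also have "\<dots> = (c \<cdot>\<^sub>m 1\<^sub>m n) *\<^sub>v v" using v by (intro eq_vecI) auto
    finally show "T *\<^sub>v v = (c \<cdot>\<^sub>m 1\<^sub>m n) *\<^sub>v v" .
  qed simp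
  from that[OF this] show thesis .
qed

lemma (in group) sum_reindex_left:
  assumes h: "h \<in> carrier G"
  shows "(\<Sum>g\<in>carrier G. f (h \<otimes> g)) = (\<Sum>g\<in>carrier G. f g)"
  by (rule sum.reindex_bij_witness[of _ "\<lambda>g. inv h \<otimes> g" "\<lambda>g. h \<otimes> g"])
     (use h in \<open>auto simp: m_assoc[symmetric]\<close>)

text \<open>The matrix \<open>T\<close> is the sum over the group of the conjugates of the matrix
  unit at position \<open>(a, b)\<close>. It commutes with the representation, so it is scalar, and
  its \<open>(a, b)\<close> entry is the sum in question.\<close>

lemma (in group) rep_orthogonality:
  assumes irr: "irreducible_rep G n \<rho>" and fin: "finite (carrier G)" and ab: "a < n" "b < n"
  shows "(\<Sum>g\<in>carrier G. \<rho> g $$ (a, a) * \<rho> (inv g) $$ (b, b))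
    = (if a = b then of_nat (card (carrier G)) / of_nat n else 0)"
proof -
  from irr have rep: "is_rep G n \<rho>" and n: "n > 0" by (auto simp: irreducible_rep_def)
  note rc = is_repD(1)[OF rep]
  note rm = is_repD(3)[OF rep]
  define T where "T = mat n n (\<lambda>(i,j). \<Sum>g\<in>carrier G. \<rho> g $$ (i, a) * \<rho> (inv g) $$ (b, j))"
  have T: "T \<in> carrier_mat n n" by (simp add: T_def)
  have "\<rho> h * T = T * \<rho> h" if h: "h \<in> carrier G" for h
  proof (rule eq_matI)
    fix i j assume "i < dim_row (T * \<rho> h)" "j < dim_col (T * \<rho> h)"
    hence ij: "i < n" "j < n" using T rc[OF h] by auto
    have "(\<rho> h * T) $$ (i, j) = (\<Sum>k<n. \<rho> h $$ (i, k) * (\<Sum>g\<in>carrier G. \<rho> g $$ (k, a) * \<rho> (inv g) $$ (b, j)))"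
      using mat_mult_entry[OF rc[OF h] T ij] ij by (simp add: T_def)
    also have "\<dots> = (\<Sum>g\<in>carrier G. (\<Sum>k<n. \<rho> h $$ (i, k) * \<rho> g $$ (k, a)) * \<rho> (inv g) $$ (b, j))"
      unfolding sum_distrib_left sum_distrib_right by (subst sum.swap) (simp add: mult.assoc)
    also have "\<dots> = (\<Sum>g\<in>carrier G. \<rho> (h \<otimes> g) $$ (i, a) * \<rho> (inv g) $$ (b, j))"
      using h ab ij by (intro sum.cong refl) (simp add: rm mat_mult_entry[OF rc rc] del: index_mult_mat(1))
    also have "\<dots> = (\<Sum>g\<in>carrier G. \<rho> (h \<otimes> g) $$ (i, a) * \<rho> (inv (h \<otimes> g) \<otimes> h) $$ (b, j))"
      using h by (intro sum.cong refl) (simp add: inv_mult_group m_assoc)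
    also have "\<dots> = (\<Sum>g\<in>carrier G. \<rho> g $$ (i, a) * \<rho> (inv g \<otimes> h) $$ (b, j))"
      by (rule sum_reindex_left[OF h])
    also have "\<dots> = (\<Sum>g\<in>carrier G. \<rho> g $$ (i, a) * (\<Sum>k<n. \<rho> (inv g) $$ (b, k) * \<rho> h $$ (k, j)))"
      using h ab ij by (intro sum.cong refl) (simp add: rm mat_mult_entry[OF rc rc] del: index_mult_mat(1))
    also have "\<dots> = (\<Sum>k<n. (\<Sum>g\<in>carrier G. \<rho> g $$ (i, a) * \<rho> (inv g) $$ (b, k)) * \<rho> h $$ (k, j))"
      unfolding sum_distrib_left sum_distrib_right by (subst sum.swap) (simp add: mult.assoc)
    also have "\<dots> = (T * \<rho> h) $$ (i, j)"
      using mat_mult_entry[OF T rc[OF h] ij] ij by (simp add: T_def)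
    finally show "(\<rho> h * T) $$ (i, j) = (T * \<rho> h) $$ (i, j)" .
  qed (use T rc[OF h] in auto)
  from schur_scalar[OF irr T this] obtain c where c: "T = c \<cdot>\<^sub>m 1\<^sub>m n" by metis
  \<comment> \<open>The trace determines the scalar: each conjugate contributes the
    \<open>(b, a)\<close> entry of \<open>\<rho> (inv g) * \<rho> g\<close>, which is the
    identity.\<close>
  have "of_nat n * c = (\<Sum>i<n. T $$ (i, i))" by (simp add: c)
  also have "\<dots> = (\<Sum>i<n. \<Sum>g\<in>carrier G. \<rho> g $$ (i, a) * \<rho> (inv g) $$ (b, i))" by (simp add: T_def)
  also have "\<dots> = (\<Sum>g\<in>carrier G. \<Sum>i<n. \<rho> (inv g) $$ (b, i) * \<rho> g $$ (i, a))"
    by (subst sum.swap) (simp add: mult.commute)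
  also have "\<dots> = (\<Sum>g\<in>carrier G. (\<rho> (inv g) * \<rho> g) $$ (b, a))"
    using ab by (intro sum.cong refl) (simp add: mat_mult_entry[OF rc rc] del: index_mult_mat(1))
  also have "\<dots> = (\<Sum>g\<in>carrier G. if a = b then 1 else 0)"
    using ab by (intro sum.cong refl) (simp add: rep_inverse[OF rep] del: index_mult_mat(1))
  also have "\<dots> = (if a = b then of_nat (card (carrier G)) else 0)" by simp
  finally have nc: "of_nat n * c = (if a = b then of_nat (card (carrier G)) else 0)" .
  have "(\<Sum>g\<in>carrier G. \<rho> g $$ (a, a) * \<rho> (inv g) $$ (b, b)) = T $$ (a, b)" using ab by (simp add: T_def)
  also have "\<dots> = (if a = b then c else 0)" using ab by (simp add: c)
  finally show ?thesis using nc n by (auto simp: field_simps)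
qed

lemma (in group) trace_orthogonality:
  assumes irr: "irreducible_rep G n \<rho>" and fin: "finite (carrier G)"
  shows "(\<Sum>g\<in>carrier G. mat_trace (\<rho> g) * mat_trace (\<rho> (inv g))) = of_nat (card (carrier G))"
proof -
  from irr have rep: "is_rep G n \<rho>" and n: "n > 0" by (auto simp: irreducible_rep_def)
  have tr: "mat_trace (\<rho> g) = (\<Sum>a<n. \<rho> g $$ (a, a))" if "g \<in> carrier G" for g
    using is_repD(1)[OF rep that] by (simp add: mat_trace_def)
  have "(\<Sum>g\<in>carrier G. mat_trace (\<rho> g) * mat_trace (\<rho> (inv g)))
      = (\<Sum>g\<in>carrier G. \<Sum>a<n. \<Sum>b<n. \<rho> g $$ (a, a) * \<rho> (inv g) $$ (b, b))"
    by (intro sum.cong refl) (simp add: tr sum_product)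
  also have "\<dots> = (\<Sum>a<n. \<Sum>b<n. \<Sum>g\<in>carrier G. \<rho> g $$ (a, a) * \<rho> (inv g) $$ (b, b))"
    by (subst sum.swap, rule sum.cong[OF refl], rule sum.swap)
  also have "\<dots> = (\<Sum>a<n. \<Sum>b<n. if a = b then of_nat (card (carrier G)) / of_nat n else 0)"
    by (intro sum.cong refl rep_orthogonality[OF irr fin]) auto
  also have "\<dots> = of_nat (card (carrier G))" using n by simp
  finally show ?thesis .
qed

text \<open>What is known about the \<open>l i\<close> concerns powers of \<open>\<rho> g\<close>,
  so \<open>inv g\<close> is written as a power of \<open>g\<close> with exponent
  \<open>k - 1\<close>, where \<open>k\<close> is the group order. On \<open>k\<close>-th roots of
  unity this power is complex conjugation.\<close>

lemma (in group) rep_eigenvalues: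
  assumes rep: "is_rep G n \<rho>" and fin: "finite (carrier G)" and g: "g \<in> carrier G"
  shows "\<exists>l. (\<forall>i<n. norm (l i) = 1) \<and> mat_trace (\<rho> g) = (\<Sum>i<n. l i) \<and>
    mat_trace (\<rho> (inv g)) = (\<Sum>i<n. cnj (l i)) \<and> ((\<forall>i<n. l i = 1) \<longrightarrow> \<rho> g = 1\<^sub>m n)"
proof -
  define k where "k = card (carrier G)"
  have k: "k > 0" using fin one_closed card_gt_0_iff unfolding k_def by blast
  note rg = is_repD(1)[OF rep g]
  have "\<rho> g ^\<^sub>m k = 1\<^sub>m n"
    using rep_pow[OF rep g, of k] pow_order_eq_1[OF g] is_repD(2)[OF rep] by (simp add: k_def Coset.order_def)
  then obtain l where l: "\<And>i. i < n \<Longrightarrow> l i ^ k = 1"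
    "\<And>j. mat_trace (\<rho> g ^\<^sub>m j) = (\<Sum>i<n. l i ^ j)"
    "(\<forall>i<n. l i = 1) \<Longrightarrow> \<rho> g = 1\<^sub>m n" using finite_order_matrix[OF rg k] by blast
  have nl: "norm (l i) = 1" if "i < n" for i
  proof -
    have "norm (l i) ^ k = 1 ^ k" using l(1)[OF that] by (simp add: norm_power[symmetric])
    thus ?thesis by (rule power_eq_imp_eq_base) (use k in auto)
  qed
  have kk: "l i ^ (k - 1) = cnj (l i)" if "i < n" for i
  proof -
    have 1: "l i * l i ^ (k - 1) = 1" using l(1)[OF that] power_minus_mult[OF k, of "l i"] by (simp add: mult.commute)
    have 2: "l i * cnj (l i) = 1" using nl[OF that] complex_norm_square[of "l i"] by simp
    have "l i ^ (k - 1) = l i ^ (k - 1) * (l i * cnj (l i))" unfolding 2 by simp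
    also have "\<dots> = (l i * l i ^ (k - 1)) * cnj (l i)" by (simp only: ac_simps)
    also have "\<dots> = cnj (l i)" unfolding 1 by simp
    finally show ?thesis .
  qed
  have "inv g = g [^] (k - 1)"
  proof (rule inv_equality)
    have "g [^] (k - 1) \<otimes> g = g [^] k" using k g by (metis Suc_diff_1 nat_pow_Suc)
    thus "g [^] (k - 1) \<otimes> g = \<one>" using pow_order_eq_1[OF g] by (simp add: k_def Coset.order_def)
  qed (use g in auto)
  hence "\<rho> (inv g) = \<rho> g ^\<^sub>m (k - 1)" using rep_pow[OF rep g] by simp
  hence "mat_trace (\<rho> (inv g)) = (\<Sum>i<n. cnj (l i))" using l(2)[of "k - 1"] kk by simp
  moreover have "mat_trace (\<rho> g) = (\<Sum>i<n. l i)" using l(2)[of 1] rg by simp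
  ultimately show ?thesis using nl l(3) by (intro exI[of _ l]) simp
qed

lemma (in group) trace_inv:
  assumes "is_rep G n \<rho>" "finite (carrier G)" "g \<in> carrier G"
  shows "mat_trace (\<rho> (inv g)) = cnj (mat_trace (\<rho> g))"
  using rep_eigenvalues[OF assms] by auto

lemma (in group) trace_eq_degree_iff:
  assumes rep: "is_rep G n \<rho>" and fin: "finite (carrier G)" and g: "g \<in> carrier G"
  shows "mat_trace (\<rho> g) = of_nat n \<longleftrightarrow> \<rho> g = 1\<^sub>m n"
proof
  assume tr: "mat_trace (\<rho> g) = of_nat n"
  from rep_eigenvalues[OF assms] obtain l where l: "\<forall>i<n. norm (l i) = 1"
    "mat_trace (\<rho> g) = (\<Sum>i<n. l i)" "(\<forall>i<n. l i = 1) \<longrightarrow> \<rho> g = 1\<^sub>m n"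
    by (elim exE conjE)
  have "l i = 1" if "i < n" for i
    by (rule root_of_unity_sum_eq_card[of n l i]) (use l(1,2) tr that in auto)
  thus "\<rho> g = 1\<^sub>m n" using l(3) by blast
qed (simp add: mat_trace_def)

definition group_center :: "('g, 'b) monoid_scheme \<Rightarrow> 'g set" where
  "group_center G = {z \<in> carrier G. \<forall>g\<in>carrier G. g \<otimes>\<^bsub>G\<^esub> z = z \<otimes>\<^bsub>G\<^esub> g}"

text \<open>The squared absolute values of the character add up to the group order. Every central
  element acts by a scalar of modulus 1 and alone contributes the square of the degree.\<close>

lemma (in group) degree_square_le:
  assumes irr: "irreducible_rep G n \<rho>" and fin: "finite (carrier G)"
  shows "n\<^sup>2 * card (group_center G) \<le> card (carrier G)"
proof -
  from irr have rep: "is_rep G n \<rho>" and n: "n > 0" by (auto simp: irreducible_rep_def)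
  let ?t = "\<lambda>g. mat_trace (\<rho> g)"
  have "complex_of_real (\<Sum>g\<in>carrier G. (norm (?t g))\<^sup>2) = (\<Sum>g\<in>carrier G. ?t g * ?t (inv g))"
    unfolding of_real_sum
    by (intro sum.cong refl) (simp add: trace_inv[OF rep fin] complex_norm_square del: of_real_power)
  also have "\<dots> = complex_of_real (real (card (carrier G)))" using trace_orthogonality[OF irr fin] by simp
  finally have sum: "(\<Sum>g\<in>carrier G. (norm (?t g))\<^sup>2) = real (card (carrier G))"
    by (rule of_real_eq_iff[THEN iffD1])
  have Z: "group_center G \<subseteq> carrier G" by (auto simp: group_center_def)
  have "(norm (?t z))\<^sup>2 = real (n\<^sup>2)" if z: "z \<in> group_center G" for z
  proof -
    have zc: "z \<in> carrier G" using z Z by auto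
    have "\<rho> g * \<rho> z = \<rho> z * \<rho> g" if "g \<in> carrier G" for g
      using z that is_repD(3)[OF rep] by (metis (mono_tags, lifting) group_center_def mem_Collect_eq)
    from schur_scalar[OF irr is_repD(1)[OF rep zc] this] obtain c where c: "\<rho> z = c \<cdot>\<^sub>m 1\<^sub>m n" by metis
    have cj: "?t (inv z) = cnj (?t z)" by (rule trace_inv[OF rep fin zc])
    have t: "?t z = of_nat n * c" by (simp add: c mat_trace_def)
    \<comment> \<open>Computing this trace in two ways shows that
      \<open>c * cnj c = 1\<close>.\<close>
    have "mat_trace (\<rho> z * \<rho> (inv z)) = c * ?t (inv z)"
    proof -
      have "\<rho> z * \<rho> (inv z) = c \<cdot>\<^sub>m \<rho> (inv z)"
        unfolding c using mult_smult_assoc_mat[OF one_carrier_mat is_repD(1)[OF rep inv_closed[OF zc]], of c]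
          left_mult_one_mat[OF is_repD(1)[OF rep inv_closed[OF zc]]] by simp
      thus ?thesis using is_repD(1)[OF rep inv_closed[OF zc]] by (simp add: mat_trace_def sum_distrib_left)
    qed
    moreover have "mat_trace (\<rho> z * \<rho> (inv z)) = of_nat n"
      using rep_inverse[OF rep zc] by (simp add: mat_trace_def)
    ultimately have "c * (of_nat n * cnj c) = of_nat n" using cj t by simp
    hence "c * cnj c = 1" using n by simp
    hence "complex_of_real ((norm c)\<^sup>2) = 1" by (metis complex_norm_square)
    hence "(norm c)\<^sup>2 = 1" by (metis of_real_eq_1_iff)
    thus ?thesis using t by (simp add: norm_mult power_mult_distrib)
  qed
  hence "real (n\<^sup>2 * card (group_center G)) = (\<Sum>g\<in>group_center G. (norm (?t g))\<^sup>2)" by simp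
  also have "\<dots> \<le> (\<Sum>g\<in>carrier G. (norm (?t g))\<^sup>2)" by (rule sum_mono2[OF fin Z]) simp
  finally show ?thesis using sum by (metis of_nat_le_iff)
qed

section \<open>Matrices with distinct eigenvalues\<close>

lemma smult_mat_mult_vec:
  fixes A :: "'a :: comm_ring_1 mat"
  assumes "A \<in> carrier_mat n m" "v \<in> carrier_vec m"
  shows "(c \<cdot>\<^sub>m A) *\<^sub>v v = c \<cdot>\<^sub>v (A *\<^sub>v v)"
  using assms by (intro eq_vecI) auto

lemma eigenvectors_independent:
  fixes A :: "complex mat" and v :: "nat \<Rightarrow> complex vec"
  assumes A: "A \<in> carrier_mat n n"
    and v: "\<And>i. i < m \<Longrightarrow> v i \<in> carrier_vec n" "\<And>i. i < m \<Longrightarrow> v i \<noteq> 0\<^sub>v n"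
      "\<And>i. i < m \<Longrightarrow> A *\<^sub>v v i = \<mu> i \<cdot>\<^sub>v v i"
    and inj: "inj_on \<mu> {..<m}"
    and 0: "\<And>r. r < n \<Longrightarrow> (\<Sum>i<m. c i * v i $ r) = 0"
    and i: "i < m"
  shows "c i = 0"
proof -
  have ent: "(\<Sum>s<n. A $$ (r, s) * v i $ s) = \<mu> i * v i $ r" if "r < n" "i < m" for r i
  proof -
    have "(\<Sum>s<n. A $$ (r, s) * v i $ s) = (A *\<^sub>v v i) $ r"
      using A that v(1)[of i] by (simp add: scalar_prod_def lessThan_atLeast0)
    also have "\<dots> = \<mu> i * v i $ r" using v(1,3)[OF that(2)] that(1) by simp
    finally show ?thesis .
  qed
  have "\<forall>c. (\<forall>r<n. (\<Sum>i<k. c i * v i $ r) = 0) \<longrightarrow> (\<forall>i<k. c i = 0)" if "k \<le> m" for k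
    using that
  proof (induction k)
    case (Suc k)
    show ?case
    proof (intro allI impI)
      fix c i assume c: "\<forall>r<n. (\<Sum>i<Suc k. c i * v i $ r) = 0" and i: "i < Suc k"
      \<comment> \<open>Apply \<open>A\<close> to the relation and subtract \<open>\<mu> k\<close>
        times the relation; the last term cancels and the induction hypothesis applies.\<close>
      have "(\<Sum>i<k. c i * (\<mu> i - \<mu> k) * v i $ r) = 0" if r: "r < n" for r
      proof -
        have "0 = (\<Sum>s<n. A $$ (r, s) * (\<Sum>i<Suc k. c i * v i $ s))" using c by simp
        also have "\<dots> = (\<Sum>i<Suc k. c i * (\<Sum>s<n. A $$ (r, s) * v i $ s))"
          unfolding sum_distrib_left by (subst sum.swap) (simp only: ac_simps)
        also have "\<dots> = (\<Sum>i<Suc k. c i * (\<mu> i * v i $ r))"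
          using ent[OF r] Suc.prems by (intro sum.cong) auto
        finally have 1: "(\<Sum>i<Suc k. c i * (\<mu> i * v i $ r)) = 0" by simp
        have "(\<Sum>i<Suc k. c i * (\<mu> i - \<mu> k) * v i $ r)
           = (\<Sum>i<Suc k. c i * (\<mu> i * v i $ r)) - \<mu> k * (\<Sum>i<Suc k. c i * v i $ r)"
          unfolding sum_distrib_left sum_subtractf[symmetric]
          by (intro sum.cong refl) (simp add: algebra_simps)
        thus ?thesis using 1 c r by simp
      qed
      hence *: "\<forall>i<k. c i * (\<mu> i - \<mu> k) = 0"
        using Suc.IH[OF Suc_leD[OF Suc.prems], THEN spec, of "\<lambda>i. c i * (\<mu> i - \<mu> k)"] by blast
      have cz: "c i = 0" if "i < k" for i
      proof -
        have "\<mu> i \<noteq> \<mu> k" using inj_onD[OF inj, of i k] that Suc.prems by auto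
        thus ?thesis using * that by auto
      qed
      have km: "k < m" using Suc.prems by simp
      have "\<exists>r<n. v k $ r \<noteq> 0"
      proof (rule ccontr)
        assume "\<not> (\<exists>r<n. v k $ r \<noteq> 0)"
        hence "v k = 0\<^sub>v n" using carrier_vecD[OF v(1)[OF km]] by (intro eq_vecI) simp_all
        thus False using v(2)[OF km] by contradiction
      qed
      then obtain r where r: "r < n" "v k $ r \<noteq> 0" by blast
      have "(\<Sum>i<Suc k. c i * v i $ r) = c k * v k $ r" using cz by simp
      moreover have "(\<Sum>i<Suc k. c i * v i $ r) = 0" using c r(1) by blast
      ultimately have "c k = 0" using r(2) by simp
      with cz i show "c i = 0" by (auto simp: less_Suc_eq)
    qed
  qed simp
  from this[of m] 0 i show ?thesis by blast
qed

text \<open>A matrix commuting with \<open>A\<close> maps each of the \<open>n\<close> eigenlines of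
  \<open>A\<close> to itself. So \<open>C\<close> and \<open>D\<close> are simultaneously diagonal
  in the eigenbasis \<open>P\<close>, where they commute.\<close>

lemma commutant_of_distinct_eigenvalues:
  fixes A C D :: "complex mat"
  assumes A: "A \<in> carrier_mat n n" and C: "C \<in> carrier_mat n n" and D: "D \<in> carrier_mat n n"
    and v: "\<And>i. i < n \<Longrightarrow> v i \<in> carrier_vec n" "\<And>i. i < n \<Longrightarrow> v i \<noteq> 0\<^sub>v n"
      "\<And>i. i < n \<Longrightarrow> A *\<^sub>v v i = \<mu> i \<cdot>\<^sub>v v i"
    and inj: "inj_on \<mu> {..<n}"
    and comm: "C * A = A * C" "D * A = A * D"
  shows "C * D = D * C"
proof -
  note indep = eigenvectors_independent[OF A v inj]
  define P where "P = mat n n (\<lambda>(r,i). v i $ r)"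
  have P: "P \<in> carrier_mat n n" by (simp add: P_def)
  have Pc: "(P *\<^sub>v c) $ r = (\<Sum>i<n. c $ i * v i $ r)" if "r < n" "c \<in> carrier_vec n" for r c
    using that by (simp add: P_def scalar_prod_def lessThan_atLeast0 mult.commute)
  have colP: "col P i = v i" if "i < n" for i
    using that v(1)[OF that] by (intro eq_vecI) (auto simp: P_def)
  obtain Q where Q: "Q \<in> carrier_mat n n" "P * Q = 1\<^sub>m n" "Q * P = 1\<^sub>m n"
  proof (rule injective_square_mat_inverse[OF P])
    fix c assume c: "c \<in> carrier_vec n" and 0: "P *\<^sub>v c = 0\<^sub>v n"
    have "c $ i = 0" if "i < n" for i
      by (rule indep[of "\<lambda>i. c $ i", OF _ _ _ _ that]) (use Pc[OF _ c] 0 in \<open>simp_all\<close>)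
    thus "c = 0\<^sub>v n" using c by (intro eq_vecI) auto
  qed
  have diag: "\<exists>e. F *\<^sub>v v i = e \<cdot>\<^sub>v v i"
    if F: "F \<in> carrier_mat n n" and FA: "F * A = A * F" and i: "i < n" for F i
  proof -
    define w where "w = F *\<^sub>v v i"
    have w: "w \<in> carrier_vec n" unfolding w_def by (rule mult_mat_vec_carrier[OF F v(1)[OF i]])
    have "A *\<^sub>v w = (A * F) *\<^sub>v v i" unfolding w_def by (rule assoc_mult_mat_vec[OF A F v(1)[OF i], symmetric])
    also have "\<dots> = F *\<^sub>v (A *\<^sub>v v i)" unfolding FA[symmetric] by (rule assoc_mult_mat_vec[OF F A v(1)[OF i]])
    also have "\<dots> = \<mu> i \<cdot>\<^sub>v w" unfolding v(3)[OF i] w_def by (rule mult_mat_vec[OF F v(1)[OF i]])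
    finally have Aw: "A *\<^sub>v w = \<mu> i \<cdot>\<^sub>v w" .
    define c where "c = Q *\<^sub>v w"
    have c: "c \<in> carrier_vec n" using Q w by (simp add: c_def)
    have "P *\<^sub>v c = (P * Q) *\<^sub>v w" unfolding c_def by (rule assoc_mult_mat_vec[OF P Q(1) w, symmetric])
    hence wc: "w = P *\<^sub>v c" using Q(2) w by simp
    have went: "w $ r = (\<Sum>j<n. c $ j * v j $ r)" if "r < n" for r
      using Pc[OF that c] wc by simp
    \<comment> \<open>Both sides of \<open>A *\<^sub>v w = \<mu> i \<cdot>\<^sub>v w\<close> are
      expanded in the eigenbasis; independence then kills every coefficient of \<open>w\<close>
      except the one at \<open>i\<close>.\<close>
    have "(\<Sum>j<n. c $ j * (\<mu> j - \<mu> i) * v j $ r) = 0" if r: "r < n" for r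
    proof -
      have av: "(\<Sum>s<n. A $$ (r, s) * v j $ s) = \<mu> j * v j $ r" if "j < n" for j
      proof -
        have "(\<Sum>s<n. A $$ (r, s) * v j $ s) = (A *\<^sub>v v j) $ r"
          using A r v(1)[OF that] by (simp add: scalar_prod_def lessThan_atLeast0)
        also have "\<dots> = \<mu> j * v j $ r" using v(1,3)[OF that] r by simp
        finally show ?thesis .
      qed
      have "\<mu> i * w $ r = (A *\<^sub>v w) $ r" using Aw w r by simp
      also have "\<dots> = (\<Sum>s<n. A $$ (r, s) * w $ s)"
        using A r w by (simp add: scalar_prod_def lessThan_atLeast0)
      also have "\<dots> = (\<Sum>s<n. A $$ (r, s) * (\<Sum>j<n. c $ j * v j $ s))" using went by simp
      also have "\<dots> = (\<Sum>j<n. c $ j * (\<Sum>s<n. A $$ (r, s) * v j $ s))"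
        unfolding sum_distrib_left by (subst sum.swap) (simp only: ac_simps)
      also have "\<dots> = (\<Sum>j<n. c $ j * (\<mu> j * v j $ r))" using av by simp
      finally have "(\<Sum>j<n. c $ j * (\<mu> j * v j $ r)) - \<mu> i * (\<Sum>j<n. c $ j * v j $ r) = 0"
        using went[OF r] by simp
      thus ?thesis unfolding sum_distrib_left sum_subtractf[symmetric] by (simp add: algebra_simps)
    qed
    note sum0 = this
    have z: "c $ j * (\<mu> j - \<mu> i) = 0" if "j < n" for j
      by (rule indep[of "\<lambda>j. c $ j * (\<mu> j - \<mu> i)", OF _ _ _ _ that]) (simp_all add: sum0)
    have cz: "c $ j = 0" if "j < n" "j \<noteq> i" for j
      using z[OF that(1)] inj_onD[OF inj, of j i] that i by auto
    have "w $ r = c $ i * v i $ r" if "r < n" for r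
    proof -
      have "w $ r = (\<Sum>j\<in>{i}. c $ j * v j $ r)"
        unfolding went[OF that] using i cz by (intro sum.mono_neutral_right) auto
      thus ?thesis by simp
    qed
    hence "w = c $ i \<cdot>\<^sub>v v i" using w v(1)[OF i] by (intro eq_vecI) auto
    thus ?thesis unfolding w_def by blast
  qed
  have CDP: "(C * D) * P = (D * C) * P"
  proof (rule mat_col_eqI)
    fix i assume "i < dim_col (D * C * P)"
    hence i: "i < n" using P by simp
    obtain e f where e: "C *\<^sub>v v i = e \<cdot>\<^sub>v v i" and f: "D *\<^sub>v v i = f \<cdot>\<^sub>v v i"
      using diag[OF C comm(1) i] diag[OF D comm(2) i] by blast
    have colX: "col (X * P) i = X *\<^sub>v v i" if "X \<in> carrier_mat n n" for X
      using col_mult2[OF that P i] colP[OF i] by simp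
    have "col (C * D * P) i = C *\<^sub>v (D *\<^sub>v v i)"
      unfolding colX[OF mult_carrier_mat[OF C D]] by (rule assoc_mult_mat_vec[OF C D v(1)[OF i]])
    also have "\<dots> = D *\<^sub>v (C *\<^sub>v v i)"
      unfolding e f mult_mat_vec[OF C v(1)[OF i]] mult_mat_vec[OF D v(1)[OF i]]
      by (simp add: smult_smult_assoc mult.commute)
    also have "\<dots> = col (D * C * P) i"
      unfolding colX[OF mult_carrier_mat[OF D C]] by (rule assoc_mult_mat_vec[OF D C v(1)[OF i], symmetric])
    finally show "col (C * D * P) i = col (D * C * P) i" .
  qed (use C D P in auto)
  have CD: "C * D \<in> carrier_mat n n" "D * C \<in> carrier_mat n n" using C D by auto
  have "C * D = (C * D * P) * Q"
    using assoc_mult_mat[OF CD(1) P Q(1)] Q(2) right_mult_one_mat[OF CD(1)] by simp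
  also have "\<dots> = D * C"
    unfolding CDP using assoc_mult_mat[OF CD(2) P Q(1)] Q(2) right_mult_one_mat[OF CD(2)] by simp
  finally show ?thesis .
qed

text \<open>From one eigenvector \<open>u\<close> of \<open>\<rho> x\<close> the vectors
  \<open>\<rho> (t [^] i) *\<^sub>v u\<close> provide the eigenvalues
  \<open>l * \<zeta> ^ i\<close>. There are \<open>n\<close> of them, distinct because
  \<open>l\<close> is nonzero, so the images of elements centralizing \<open>x\<close>
  commute.\<close>

lemma (in group) rep_commute_of_root:
  assumes rep: "is_rep G n \<rho>" and n: "n > 0"
    and xt: "x \<in> carrier G" "t \<in> carrier G" "z \<in> carrier G" "x \<otimes> t = t \<otimes> x \<otimes> z"
    and z: "\<rho> z = \<zeta> \<cdot>\<^sub>m 1\<^sub>m n" and inj: "inj_on (\<lambda>i. \<zeta> ^ i) {..<n}"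
    and cd: "c \<in> carrier G" "d \<in> carrier G" "c \<otimes> x = x \<otimes> c" "d \<otimes> x = x \<otimes> d"
  shows "\<rho> c * \<rho> d = \<rho> d * \<rho> c"
proof -
  note rc = is_repD(1)[OF rep] and rm = is_repD(3)[OF rep]
  from spectrum_non_empty[OF rc[OF xt(1)] n] obtain l u where "eigenvector (\<rho> x) u l"
    by (auto simp: spectrum_def eigenvalue_def)
  hence u: "u \<in> carrier_vec n" "u \<noteq> 0\<^sub>v n" "\<rho> x *\<^sub>v u = l \<cdot>\<^sub>v u"
    using rc[OF xt(1)] by (auto simp: eigenvector_def)
  have unit: "w = 0\<^sub>v n" if "g \<in> carrier G" "w \<in> carrier_vec n" "\<rho> g *\<^sub>v w = 0\<^sub>v n" for g w
  proof -
    have "w = (\<rho> (inv g) * \<rho> g) *\<^sub>v w" using rep_inverse[OF rep that(1)] that by simp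
    also have "\<dots> = \<rho> (inv g) *\<^sub>v 0\<^sub>v n"
      using assoc_mult_mat_vec[OF rc rc that(2), of "inv g" g] that by simp
    also have "\<dots> = 0\<^sub>v n" using rc[of "inv g"] that by (intro eq_vecI) auto
    finally show ?thesis .
  qed
  have l0: "l \<noteq> 0"
  proof
    assume "l = 0"
    hence "\<rho> x *\<^sub>v u = 0\<^sub>v n" using u(1,3) by (intro eq_vecI) auto
    from unit[OF xt(1) u(1) this] u(2) show False by simp
  qed
  define v where "v i = \<rho> (t [^] (i::nat)) *\<^sub>v u" for i
  have v: "v i \<in> carrier_vec n" "v i \<noteq> 0\<^sub>v n" for i
    using rc[of "t [^] i"] u unit[of "t [^] i" u] xt by (auto simp: v_def)
  have vS: "v (Suc i) = \<rho> t *\<^sub>v v i" for i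
  proof -
    have "t [^] Suc i = t \<otimes> t [^] i" using nat_pow_Suc2 xt(2) by simp
    hence "v (Suc i) = (\<rho> t * \<rho> (t [^] i)) *\<^sub>v u" using rm[of t "t [^] i"] xt(2) by (simp add: v_def)
    thus ?thesis using assoc_mult_mat_vec[OF rc rc u(1), of t "t [^] i"] xt(2) by (simp add: v_def)
  qed
  have xt': "\<rho> x * \<rho> t = \<zeta> \<cdot>\<^sub>m (\<rho> t * \<rho> x)"
  proof -
    have "\<rho> x * \<rho> t = (\<rho> t * \<rho> x) * \<rho> z" using xt rm by (metis m_closed)
    also have "\<dots> = \<zeta> \<cdot>\<^sub>m (\<rho> t * \<rho> x)"
      unfolding z using mult_smult_distrib[OF mult_carrier_mat[OF rc rc] one_carrier_mat, of t x \<zeta>] xt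
        right_mult_one_mat[OF mult_carrier_mat[OF rc rc], of t x] by simp
    finally show ?thesis .
  qed
  have ev: "\<rho> x *\<^sub>v v i = (l * \<zeta> ^ i) \<cdot>\<^sub>v v i" for i
  proof (induction i)
    case 0
    have "v 0 = u" using u is_repD(2)[OF rep] by (simp add: v_def)
    thus ?case using u by simp
  next
    case (Suc i)
    have "\<rho> x *\<^sub>v v (Suc i) = (\<rho> x * \<rho> t) *\<^sub>v v i"
      unfolding vS using assoc_mult_mat_vec[OF rc rc v(1)] xt by simp
    also have "\<dots> = \<zeta> \<cdot>\<^sub>v ((\<rho> t * \<rho> x) *\<^sub>v v i)"
      unfolding xt'
      using smult_mat_mult_vec[OF mult_carrier_mat[OF rc[OF xt(2)] rc[OF xt(1)]] v(1)] by simp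
    also have "(\<rho> t * \<rho> x) *\<^sub>v v i = \<rho> t *\<^sub>v ((l * \<zeta> ^ i) \<cdot>\<^sub>v v i)"
      using assoc_mult_mat_vec[OF rc rc v(1), of t x] xt Suc by simp
    also have "\<dots> = (l * \<zeta> ^ i) \<cdot>\<^sub>v v (Suc i)"
      unfolding vS by (rule mult_mat_vec[OF rc[OF xt(2)] v(1)])
    finally show ?case by (simp add: smult_smult_assoc ac_simps)
  qed
  show ?thesis
  proof (rule commutant_of_distinct_eigenvalues[OF rc[OF xt(1)] rc[OF cd(1)] rc[OF cd(2)] v ev])
    show "inj_on (\<lambda>i. l * \<zeta> ^ i) {..<n}" using inj l0 by (auto simp: inj_on_def)
    show "\<rho> c * \<rho> x = \<rho> x * \<rho> c" "\<rho> d * \<rho> x = \<rho> x * \<rho> d"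
      using cd xt rm by metis+
  qed
qed

section \<open>Restriction to subspaces and prescribed central scalars\<close>

text \<open>The restriction of \<open>\<rho>\<close> to \<open>W\<close>, written in a basis of
  \<open>W\<close>. The clause for \<open>k = n\<close> supports descent on the degree: a proper
  \<open>W\<close> gives a strictly smaller representation in which \<open>z\<close> still acts as
  \<open>\<zeta>\<close>.\<close>

lemma (in group) subrepresentation:
  assumes rep: "is_rep G n \<rho>" and W: "invariant_subspace G n \<rho> W" "W \<noteq> {0\<^sub>v n}"
    and z: "z \<in> carrier G" "\<And>v. v \<in> W \<Longrightarrow> \<rho> z *\<^sub>v v = \<zeta> \<cdot>\<^sub>v v"
  shows "\<exists>k \<sigma>. is_rep G k \<sigma> \<and> 0 < k \<and> k \<le> n \<and> \<sigma> z = \<zeta> \<cdot>\<^sub>m 1\<^sub>m k \<and> (k = n \<longrightarrow> W = carrier_vec n)"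
proof -
  note rc = is_repD(1)[OF rep] and rm = is_repD(3)[OF rep]
  have sub: "is_subspace n W" and inv: "\<And>g v. g \<in> carrier G \<Longrightarrow> v \<in> W \<Longrightarrow> \<rho> g *\<^sub>v v \<in> W"
    using W by (auto simp: invariant_subspace_def)
  from subspace_frame[OF sub] obtain k B where B: "B \<in> carrier_mat n k" and kn: "k \<le> n"
    and inj: "\<And>v. v \<in> carrier_vec k \<Longrightarrow> B *\<^sub>v v = 0\<^sub>v n \<Longrightarrow> v = 0\<^sub>v k"
    and WB: "W = (\<lambda>v. B *\<^sub>v v) ` carrier_vec k" by metis
  \<comment> \<open>The matrices \<open>\<sigma> g\<close> are characterized by
    \<open>B * \<sigma> g = \<rho> g * B\<close>. As \<open>B\<close> is injective it can be
    cancelled on the left, which is how every identity for \<open>\<sigma>\<close> is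
    obtained.\<close>
  have cancel: "X = Y" if XY: "X \<in> carrier_mat k m" "Y \<in> carrier_mat k m" and eq: "B * X = B * Y" for X Y m
  proof (rule mat_eq_by_action[OF XY])
    fix v :: "complex vec" assume v: "v \<in> carrier_vec m"
    have c: "X *\<^sub>v v \<in> carrier_vec k" "Y *\<^sub>v v \<in> carrier_vec k" using XY v by auto
    have "B *\<^sub>v (X *\<^sub>v v) = B *\<^sub>v (Y *\<^sub>v v)"
      using assoc_mult_mat_vec[OF B XY(1) v] assoc_mult_mat_vec[OF B XY(2) v] eq by simp
    hence "B *\<^sub>v (X *\<^sub>v v - Y *\<^sub>v v) = 0\<^sub>v n"
      using mult_minus_distrib_mat_vec[OF B c] minus_cancel_vec[OF mult_mat_vec_carrier[OF B c(2)]] by simp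
    hence 0: "X *\<^sub>v v - Y *\<^sub>v v = 0\<^sub>v k" using c by (intro inj) auto
    show "X *\<^sub>v v = Y *\<^sub>v v"
    proof (rule eq_vecI)
      fix i assume "i < dim_vec (Y *\<^sub>v v)"
      hence "i < k" using carrier_vecD[OF c(2)] by simp
      thus "(X *\<^sub>v v) $ i = (Y *\<^sub>v v) $ i" using arg_cong[OF 0, of "\<lambda>w. w $ i"] c XY by auto
    qed (use XY in auto)
  qed
  have "\<exists>X \<in> carrier_mat k k. B * X = \<rho> g * B" if g: "g \<in> carrier G" for g
  proof -
    have "\<exists>w \<in> carrier_vec k. B *\<^sub>v w = \<rho> g *\<^sub>v col B j" if "j < k" for j
    proof -
      have "col B j = B *\<^sub>v unit_vec k j" using B that by (intro eq_vecI) (auto simp: row_def)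
      hence "col B j \<in> W" unfolding WB by (intro image_eqI[of _ _ "unit_vec k j"]) auto
      from inv[OF g this] show ?thesis unfolding WB by auto
    qed
    then obtain w where w: "\<And>j. j < k \<Longrightarrow> w j \<in> carrier_vec k"
      "\<And>j. j < k \<Longrightarrow> B *\<^sub>v w j = \<rho> g *\<^sub>v col B j" by metis
    define X where "X = mat k k (\<lambda>(i,j). w j $ i)"
    have X: "X \<in> carrier_mat k k" by (simp add: X_def)
    have "col X j = w j" if "j < k" for j using w(1)[OF that] that by (intro eq_vecI) (auto simp: X_def)
    hence "col (B * X) j = col (\<rho> g * B) j" if "j < k" for j
      using col_mult2[OF B X that] col_mult2[OF rc[OF g] B that] w(2)[OF that] that by simp
    hence "B * X = \<rho> g * B" using B X rc[OF g] by (intro mat_col_eqI) auto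
    with X show ?thesis by blast
  qed
  then obtain \<sigma> where \<sigma>: "\<And>g. g \<in> carrier G \<Longrightarrow> \<sigma> g \<in> carrier_mat k k"
    "\<And>g. g \<in> carrier G \<Longrightarrow> B * \<sigma> g = \<rho> g * B" by metis
  have rep': "is_rep G k \<sigma>"
    unfolding is_rep_def
  proof (intro conjI ballI)
    show "\<sigma> \<one> = 1\<^sub>m k"
      by (rule cancel) (use \<sigma>[of \<one>] is_repD(2)[OF rep] B in \<open>auto simp: right_mult_one_mat[OF B] left_mult_one_mat[OF B]\<close>)
    fix g h assume gh: "g \<in> carrier G" "h \<in> carrier G"
    show "\<sigma> (g \<otimes> h) = \<sigma> g * \<sigma> h"
    proof (rule cancel)
      have "B * \<sigma> (g \<otimes> h) = \<rho> g * \<rho> h * B" using gh \<sigma> rm by simp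
      also have "\<dots> = \<rho> g * (\<rho> h * B)" by (rule assoc_mult_mat[OF rc rc B]) (use gh in auto)
      also have "\<dots> = \<rho> g * (B * \<sigma> h)" using \<sigma> gh by simp
      also have "\<dots> = \<rho> g * B * \<sigma> h" by (rule assoc_mult_mat[OF rc B \<sigma>(1), symmetric]) (use gh in auto)
      also have "\<dots> = B * \<sigma> g * \<sigma> h" using \<sigma> gh by simp
      also have "\<dots> = B * (\<sigma> g * \<sigma> h)" by (rule assoc_mult_mat[OF B \<sigma>(1) \<sigma>(1)]) (use gh in auto)
      finally show "B * \<sigma> (g \<otimes> h) = B * (\<sigma> g * \<sigma> h)" .
    qed (use gh \<sigma>(1) in \<open>auto intro!: mult_carrier_mat[of _ k k]\<close>)
  qed (use \<sigma> in auto)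
  have "\<sigma> z = \<zeta> \<cdot>\<^sub>m 1\<^sub>m k"
  proof (rule cancel)
    have "\<rho> z * B = \<zeta> \<cdot>\<^sub>m B"
    proof (rule mat_eq_by_action)
      fix v :: "complex vec" assume v: "v \<in> carrier_vec k"
      have "\<rho> z * B *\<^sub>v v = \<rho> z *\<^sub>v (B *\<^sub>v v)" by (rule assoc_mult_mat_vec[OF rc[OF z(1)] B v])
      also have "\<dots> = \<zeta> \<cdot>\<^sub>v (B *\<^sub>v v)" by (rule z(2)) (use v WB in auto)
      also have "\<dots> = \<zeta> \<cdot>\<^sub>m B *\<^sub>v v" using B v by (intro eq_vecI) auto
      finally show "\<rho> z * B *\<^sub>v v = \<zeta> \<cdot>\<^sub>m B *\<^sub>v v" .
    qed (use B rc[OF z(1)] in auto)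
    also have "\<dots> = B * (\<zeta> \<cdot>\<^sub>m 1\<^sub>m k)"
      using mult_smult_distrib[OF B one_carrier_mat] right_mult_one_mat[OF B] by simp
    finally show "B * \<sigma> z = B * (\<zeta> \<cdot>\<^sub>m 1\<^sub>m k)" using \<sigma> z by simp
  qed (use \<sigma> z in auto)
  moreover have "0 < k"
  proof (rule ccontr)
    assume "\<not> 0 < k"
    hence "B *\<^sub>v v = 0\<^sub>v n" if "v \<in> carrier_vec k" for v
      using that B by (intro eq_vecI) (auto simp: scalar_prod_def)
    hence "W \<subseteq> {0\<^sub>v n}" unfolding WB by auto
    thus False using W(2) sub by (auto simp: is_subspace_def)
  qed
  moreover have "W = carrier_vec n" if "k = n"
  proof -
    have Bn: "B \<in> carrier_mat n n" using B that by simp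
    obtain C where C: "C \<in> carrier_mat n n" "B * C = 1\<^sub>m n"
    proof (rule injective_square_mat_inverse[OF Bn])
      show "v = 0\<^sub>v n" if "v \<in> carrier_vec n" "B *\<^sub>v v = 0\<^sub>v n" for v
        using inj[of v] that \<open>k = n\<close> by simp
    qed
    have "w \<in> W" if "w \<in> carrier_vec n" for w
    proof -
      have "w = B *\<^sub>v (C *\<^sub>v w)" using assoc_mult_mat_vec[OF Bn C(1) that] C(2) that by simp
      thus ?thesis unfolding WB using C that \<open>k = n\<close> by (intro image_eqI[of _ _ "C *\<^sub>v w"]) auto
    qed
    thus ?thesis using sub by (auto simp: is_subspace_def)
  qed
  ultimately show ?thesis using rep' kn by blast
qed

text \<open>Among the representations of positive degree in which \<open>z\<close> is this scalar,
  one of least degree is irreducible, since a proper nonzero invariant subspace would carry a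
  smaller one.\<close>

lemma (in group) irreducible_with_central_scalar:
  assumes "is_rep G n \<rho>" "n > 0" "z \<in> carrier G" "\<rho> z = \<zeta> \<cdot>\<^sub>m 1\<^sub>m n"
  shows "\<exists>n \<rho>. irreducible_rep G n \<rho> \<and> \<rho> z = \<zeta> \<cdot>\<^sub>m 1\<^sub>m n"
proof -
  let ?P = "\<lambda>n. n > 0 \<and> (\<exists>\<rho>. is_rep G n \<rho> \<and> \<rho> z = \<zeta> \<cdot>\<^sub>m 1\<^sub>m n)"
  define m where "m = (LEAST n. ?P n)"
  have "?P m" unfolding m_def by (rule LeastI[of ?P n]) (use assms in auto)
  then obtain \<sigma> where \<sigma>: "is_rep G m \<sigma>" "\<sigma> z = \<zeta> \<cdot>\<^sub>m 1\<^sub>m m" and m: "m > 0" by blast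
  have min: "m \<le> k" if "?P k" for k unfolding m_def by (rule Least_le[of ?P, OF that])
  have "irreducible_rep G m \<sigma>"
    unfolding irreducible_rep_def
  proof (intro conjI allI impI \<sigma>(1) m)
    fix W assume W: "invariant_subspace G m \<sigma> W"
    have "\<sigma> z *\<^sub>v v = \<zeta> \<cdot>\<^sub>v v" if "v \<in> W" for v
    proof -
      have "v \<in> carrier_vec m" using W that by (auto simp: invariant_subspace_def is_subspace_def)
      thus ?thesis unfolding \<sigma>(2) by (intro eq_vecI) auto
    qed
    note act = this
    show "W = {0\<^sub>v m} \<or> W = carrier_vec m"
    proof (rule disjCI)
      assume W0: "W \<noteq> carrier_vec m"
      show "W = {0\<^sub>v m}"
      proof (rule ccontr)
        assume "W \<noteq> {0\<^sub>v m}"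
        have "\<exists>k \<tau>. is_rep G k \<tau> \<and> 0 < k \<and> k \<le> m \<and> \<tau> z = \<zeta> \<cdot>\<^sub>m 1\<^sub>m k \<and> (k = m \<longrightarrow> W = carrier_vec m)"
          by (rule subrepresentation[OF \<sigma>(1) W \<open>W \<noteq> {0\<^sub>v m}\<close> assms(3)]) (rule act)
        then obtain k \<tau> where k: "is_rep G k \<tau>" "0 < k" "k \<le> m"
          "\<tau> z = \<zeta> \<cdot>\<^sub>m 1\<^sub>m k" "k = m \<longrightarrow> W = carrier_vec m" by (elim exE conjE)
        from k have "m \<le> k" by (intro min) blast
        with k W0 show False by simp
      qed
    qed
  qed
  with \<sigma> show ?thesis by blast
qed

lemma (in group) nat_pow_eq_one_iff_less_ord:
  assumes "finite (carrier G)" "z \<in> carrier G" "m < ord z" "z [^] m = \<one>"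
  shows "m = 0"
  using assms pow_eq_id[of z m] by (metis dvd_imp_le not_gr0 not_less)

text \<open>The regular representation contains the vector \<open>\<Sum>m. \<zeta>^(-m) e(z^m)\<close>, on which \<open>z\<close> acts as \<open>\<zeta>\<close>.\<close>

lemma (in group) irreducible_rep_of_central:
  assumes fin: "finite (carrier G)" and z: "z \<in> group_center G" and \<zeta>: "\<zeta> ^ ord z = 1"
  shows "\<exists>n \<rho>. irreducible_rep G n \<rho> \<and> \<rho> z = \<zeta> \<cdot>\<^sub>m 1\<^sub>m n"
proof -
  have zc: "z \<in> carrier G" and zcomm: "\<And>g. g \<in> carrier G \<Longrightarrow> g \<otimes> z = z \<otimes> g"
    using z by (auto simp: group_center_def)
  define N where "N = card (carrier G)"
  obtain e where e: "bij_betw e {0..<N} (carrier G)"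
    using ex_bij_betw_nat_finite[OF fin] by (auto simp: N_def)
  have ec: "e i \<in> carrier G" if "i < N" for i using e that by (auto simp: bij_betw_def)
  have eq: "e i = e j \<longleftrightarrow> i = j" if "i < N" "j < N" for i j
    using e that by (auto simp: bij_betw_def inj_on_def)
  have surj: "\<exists>i<N. e i = g" if "g \<in> carrier G" for g using e that by (force simp: bij_betw_def)
  define R where "R g = mat N N (\<lambda>(i,j). if e i = g \<otimes> e j then 1 else 0 :: complex)" for g
  have Rc: "R g \<in> carrier_mat N N" for g by (simp add: R_def)
  have pick: "(\<Sum>l<N. if e l = h then f l else (0 :: complex)) = f j" if "j < N" "e j = h" for h f j
  proof -
    have "(\<Sum>l<N. if e l = h then f l else 0) = (\<Sum>l<N. if l = j then f l else 0)"
      using that eq by (intro sum.cong) auto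
    thus ?thesis using that by simp
  qed
  have rep: "is_rep G N R"
    unfolding is_rep_def
  proof (intro conjI ballI Rc)
    show "R \<one> = 1\<^sub>m N" by (rule eq_matI) (auto simp: R_def eq ec)
    fix g h assume gh: "g \<in> carrier G" "h \<in> carrier G"
    show "R (g \<otimes> h) = R g * R h"
    proof (rule eq_matI)
      fix i j assume "i < dim_row (R g * R h)" "j < dim_col (R g * R h)"
      hence ij: "i < N" "j < N" by (simp_all add: R_def)
      obtain l where l: "l < N" "e l = h \<otimes> e j" using surj[of "h \<otimes> e j"] gh ec ij by auto
      have "(R g * R h) $$ (i, j) = (\<Sum>l<N. if e l = h \<otimes> e j then (if e i = g \<otimes> e l then 1 else 0) else 0)"
        unfolding mat_mult_entry[OF Rc Rc ij] using ij by (intro sum.cong) (auto simp: R_def)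
      also have "\<dots> = (if e i = g \<otimes> e l then 1 else 0)" by (rule pick[OF l])
      also have "\<dots> = R (g \<otimes> h) $$ (i, j)" using ij l gh ec by (simp add: R_def m_assoc)
      finally show "R (g \<otimes> h) $$ (i, j) = (R g * R h) $$ (i, j)" by simp
    qed (auto simp: R_def)
  qed
  define W where "W = {v \<in> carrier_vec N. R z *\<^sub>v v = \<zeta> \<cdot>\<^sub>v v}"
  have W: "invariant_subspace G N R W"
    unfolding invariant_subspace_def is_subspace_def
  proof (intro conjI ballI allI)
    show "W \<subseteq> carrier_vec N" by (auto simp: W_def)
    show "0\<^sub>v N \<in> W" unfolding W_def using Rc[of z] by (auto intro!: eq_vecI)
  next
    fix v w assume "v \<in> W" "w \<in> W"
    thus "v + w \<in> W" using mult_add_distrib_mat_vec[OF Rc[of z], of v w] by (auto simp: W_def smult_add_distrib_vec)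
  next
    fix a v assume "v \<in> W"
    thus "a \<cdot>\<^sub>v v \<in> W" using mult_mat_vec[OF Rc[of z], of v a] by (auto simp: W_def smult_smult_assoc mult.commute)
  next
    fix g v assume g: "g \<in> carrier G" and v: "v \<in> W"
    have vc: "v \<in> carrier_vec N" and ev: "R z *\<^sub>v v = \<zeta> \<cdot>\<^sub>v v" using v by (auto simp: W_def)
    have "R z * R g = R g * R z" using zcomm[OF g] is_repD(3)[OF rep] zc g by metis
    hence "R z *\<^sub>v (R g *\<^sub>v v) = R g *\<^sub>v (R z *\<^sub>v v)"
      using assoc_mult_mat_vec[OF Rc Rc vc] by metis
    also have "\<dots> = \<zeta> \<cdot>\<^sub>v (R g *\<^sub>v v)" unfolding ev by (rule mult_mat_vec[OF Rc vc])
    finally show "R g *\<^sub>v v \<in> W" using mult_mat_vec_carrier[OF Rc vc] by (simp add: W_def)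
  qed
  define q where "q = ord z"
  have q: "q > 0" using ord_ge_1[OF fin zc] by (simp add: q_def)
  have zq: "z [^] q = \<one>" using zc by (simp add: q_def pow_ord_eq_1)
  have \<zeta>0: "\<zeta> \<noteq> 0" using \<zeta> q by (auto simp: q_def power_0_left split: if_splits)
  define \<omega> where "\<omega> = inverse \<zeta>"
  have \<omega>: "\<zeta> * \<omega> = 1" "\<omega> ^ q = 1" using \<zeta>0 \<zeta> by (simp_all add: \<omega>_def q_def power_inverse)
  define F where "F g = (\<Sum>m<q. if g = z [^] m then \<omega> ^ m else 0)" for g
  have Fz: "F g = \<zeta> * F (z \<otimes> g)" if g: "g \<in> carrier G" for g
  proof -
    let ?f = "\<lambda>m. if z \<otimes> g = z [^] m then \<omega> ^ m else 0"
    have "\<zeta> * ?f (Suc m) = (if g = z [^] m then \<omega> ^ m else 0)" for m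
    proof -
      have "z \<otimes> g = z [^] Suc m \<longleftrightarrow> g = z [^] m"
        using g zc nat_pow_Suc2[OF zc, of m] by simp
      thus ?thesis using \<omega>(1) by (simp add: mult.assoc[symmetric])
    qed
    hence "F g = \<zeta> * (\<Sum>m<q. ?f (Suc m))" unfolding F_def sum_distrib_left by (intro sum.cong) auto
    \<comment> \<open>Cyclic shift: the terms for \<open>q\<close> and \<open>0\<close> agree, as
      both \<open>z\<close> and \<open>\<omega>\<close> have trivial \<open>q\<close>-th
      power.\<close>
    also have "(\<Sum>m<q. ?f (Suc m)) = (\<Sum>m<q. ?f m)"
    proof -
      have "(\<Sum>m<q. ?f (Suc m)) + ?f 0 = (\<Sum>m<Suc q. ?f m)" by (subst sum.lessThan_Suc_shift) simp
      moreover have "?f 0 = ?f q" using zq \<omega> by simp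
      ultimately show ?thesis by simp
    qed
    finally show ?thesis by (simp add: F_def)
  qed
  define v where "v = vec N (\<lambda>i. F (e i))"
  have "v \<in> W"
  proof -
    have "R z *\<^sub>v v = \<zeta> \<cdot>\<^sub>v v"
    proof (rule eq_vecI)
      fix i assume "i < dim_vec (\<zeta> \<cdot>\<^sub>v v)"
      hence i: "i < N" by (simp add: v_def)
      obtain j where j: "j < N" "e j = inv z \<otimes> e i" using surj[of "inv z \<otimes> e i"] zc ec i by auto
      have ij: "e i = z \<otimes> e l \<longleftrightarrow> e l = inv z \<otimes> e i" if "l < N" for l
        using zc ec[OF i] ec[OF that] by (metis inv_solve_left inv_closed inv_inv)
      have "(R z *\<^sub>v v) $ i = (\<Sum>l<N. if e l = inv z \<otimes> e i then F (e l) else 0)"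
        using i ij by (auto simp: R_def v_def scalar_prod_def lessThan_atLeast0 intro!: sum.cong)
      also have "\<dots> = F (e j)" by (rule pick[OF j])
      also have "\<dots> = \<zeta> * F (e i)"
        using Fz[OF ec[OF j(1)]] j(2) zc ec[OF i] by (simp add: m_assoc[symmetric])
      finally show "(R z *\<^sub>v v) $ i = (\<zeta> \<cdot>\<^sub>v v) $ i" using i by (simp add: v_def)
    qed (simp_all add: R_def v_def)
    thus ?thesis by (simp add: W_def v_def)
  qed
  moreover have "v \<noteq> 0\<^sub>v N"
  proof -
    obtain j where j: "j < N" "e j = \<one>" using surj by auto
    \<comment> \<open>The coordinate at the identity shows that \<open>v\<close> is nonzero: below
      the order of \<open>z\<close> only the exponent 0 gives the identity.\<close>
    have "F \<one> = (\<Sum>m<q. if m = 0 then 1 else 0)"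
      unfolding F_def
    proof (rule sum.cong[OF refl])
      fix m assume m: "m \<in> {..<q}"
      have "\<one> = z [^] m \<longleftrightarrow> m = 0"
        using nat_pow_eq_one_iff_less_ord[OF fin zc, of m] m by (auto simp: q_def)
      thus "(if \<one> = z [^] m then \<omega> ^ m else 0) = (if m = 0 then 1 else 0)" by auto
    qed
    hence "F \<one> = 1" using q by simp
    hence "v $ j = 1" using j by (simp add: v_def)
    thus ?thesis using j by auto
  qed
  ultimately have "W \<noteq> {0\<^sub>v N}" by auto
  moreover have "R z *\<^sub>v v = \<zeta> \<cdot>\<^sub>v v" if "v \<in> W" for v using that by (simp add: W_def)
  ultimately have "\<exists>k \<sigma>. is_rep G k \<sigma> \<and> 0 < k \<and> k \<le> N \<and> \<sigma> z = \<zeta> \<cdot>\<^sub>m 1\<^sub>m k \<and> (k = N \<longrightarrow> W = carrier_vec N)"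
    by (rule subrepresentation[OF rep W _ zc])
  then obtain k \<sigma> where "is_rep G k \<sigma>" "0 < k" "\<sigma> z = \<zeta> \<cdot>\<^sub>m 1\<^sub>m k" by (elim exE conjE)
  from irreducible_with_central_scalar[OF this(1,2) zc this(3)] show ?thesis .
qed

section \<open>Codegrees\<close>

text \<open>\<open>char_kernel\<close> is defined by character values;
  \<open>trace_eq_degree_iff\<close> identifies it with the kernel of the representation, which is
  trivial here.\<close>

lemma (in group) faithful_codegree:
  assumes irr: "irreducible_rep G n \<rho>" and fin: "finite (carrier G)"
    and faithful: "\<And>g. g \<in> carrier G \<Longrightarrow> \<rho> g = 1\<^sub>m n \<Longrightarrow> g = \<one>"
  shows "of_nat (card (carrier G)) / of_nat n \<in> codegrees G"
proof -
  from irr have rep: "is_rep G n \<rho>" by (simp add: irreducible_rep_def)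
  define \<chi> where "\<chi> = (\<lambda>g. if g \<in> carrier G then mat_trace (\<rho> g) else 0)"
  have \<chi>: "\<chi> \<in> irr_chars G" using irr by (auto simp: irr_chars_def \<chi>_def)
  have \<chi>1: "\<chi> \<one> = of_nat n" using is_repD(2)[OF rep] by (simp add: \<chi>_def mat_trace_def)
  have "char_kernel G \<chi> = {\<one>}"
  proof
    show "char_kernel G \<chi> \<subseteq> {\<one>}"
    proof
      fix g assume "g \<in> char_kernel G \<chi>"
      hence g: "g \<in> carrier G" "mat_trace (\<rho> g) = of_nat n"
        using \<chi>1 by (auto simp: char_kernel_def \<chi>_def)
      hence "\<rho> g = 1\<^sub>m n" using trace_eq_degree_iff[OF rep fin] by blast
      thus "g \<in> {\<one>}" using faithful g by blast
    qed
  qed (simp add: char_kernel_def)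
  hence "codegree G \<chi> = of_nat (card (carrier G)) / of_nat n" by (simp add: codegree_def \<chi>1)
  with \<chi> show ?thesis unfolding codegrees_def by (metis image_eqI)
qed

lemma (in normal) card_preimage_FactGroup:
  assumes fin: "finite (carrier G)" and A: "A \<subseteq> carrier (G Mod H)"
  shows "card {g \<in> carrier G. H #> g \<in> A} = card A * card H"
proof -
  have "{g \<in> carrier G. H #> g \<in> A} = \<Union>A"
  proof
    show "{g \<in> carrier G. H #> g \<in> A} \<subseteq> \<Union>A" using rcos_self[OF _ is_subgroup] by blast
    show "\<Union>A \<subseteq> {g \<in> carrier G. H #> g \<in> A}"
    proof
      fix g assume "g \<in> \<Union>A"
      then obtain K where K: "K \<in> A" "g \<in> K" by blast
      then obtain x where x: "x \<in> carrier G" "K = H #> x" using A by (auto simp: carrier_FactGroup)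
      have "H #> g = K" using repr_independence[OF _ x(1) is_subgroup, of g] K x by simp
      moreover have "g \<in> carrier G" using K x r_coset_subset_G[OF subset x(1)] by blast
      ultimately show "g \<in> {g \<in> carrier G. H #> g \<in> A}" using K by simp
    qed
  qed
  moreover have "card H * card A = card (\<Union>A)"
  proof (rule card_partition)
    have sub: "A \<subseteq> rcosets H" using A by (auto simp: FactGroup_def)
    show "finite A" using fin finite_subset[OF sub] cosets_finite rcosets_part_G[OF is_subgroup]
      by (metis FactGroup_def carrier_FactGroup finite_imageI partial_object.select_convs(1))
    show "finite (\<Union>A)" using fin finite_subset[of "\<Union>A"] sub rcosets_part_G[OF is_subgroup] by blast
    show "card c = card H" if "c \<in> A" for c
      using card_cosets_equal[OF _ subset] that sub by (metis bij_betw_same_card subsetD)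
    show "c1 \<inter> c2 = {}" if "c1 \<in> A" "c2 \<in> A" "c1 \<noteq> c2" for c1 c2
      using rcos_disjoint[OF is_subgroup] that sub unfolding pairwise_def disjnt_def by blast
  qed
  ultimately show ?thesis by (simp add: mult.commute)
qed

lemma (in normal) card_FactGroup:
  assumes fin: "finite (carrier G)"
  shows "card (carrier (G Mod H)) * card H = card (carrier G)"
proof -
  have "{g \<in> carrier G. H #> g \<in> carrier (G Mod H)} = carrier G" by (auto simp: carrier_FactGroup)
  with card_preimage_FactGroup[OF fin subset_refl] show ?thesis by simp
qed

lemma (in normal) finite_FactGroup:
  assumes "finite (carrier G)" shows "finite (carrier (G Mod H))"
  using assms by (simp add: carrier_FactGroup)

text \<open>Inflation to \<open>G\<close> multiplies the order of the group and of the kernel by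
  \<open>card H\<close> and keeps the degree, so the codegree is unchanged. This is why the
  hypothesis on codegrees survives in every quotient.\<close>

lemma (in normal) codegrees_FactGroup:
  assumes fin: "finite (carrier G)"
  shows "codegrees (G Mod H) \<subseteq> codegrees G"
proof
  interpret Q: group "G Mod H" by (rule factorgroup_is_group)
  fix c assume "c \<in> codegrees (G Mod H)"
  then obtain n \<rho> where irr: "irreducible_rep (G Mod H) n \<rho>"
    and c: "c = codegree (G Mod H) (\<lambda>g. if g \<in> carrier (G Mod H) then mat_trace (\<rho> g) else 0)"
    by (auto simp: codegrees_def irr_chars_def)
  define \<sigma> where "\<sigma> g = \<rho> (H #> g)" for g
  define \<chi> where "\<chi> = (\<lambda>g. if g \<in> carrier G then mat_trace (\<sigma> g) else 0)"
  define \<chi>' where "\<chi>' = (\<lambda>g. if g \<in> carrier (G Mod H) then mat_trace (\<rho> g) else 0)"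
  have img: "carrier (G Mod H) = (\<lambda>g. H #> g) ` carrier G" by (simp add: carrier_FactGroup)
  have H1: "H #> \<one> = H" using coset_mult_one subset by blast
  have "is_rep (G Mod H) n \<rho>" using irr by (simp add: irreducible_rep_def)
  note rep = this[unfolded is_rep_def img, simplified]
  have "is_rep G n \<sigma>"
    unfolding is_rep_def \<sigma>_def using rep by (simp add: H1 rcos_sum)
  moreover have "invariant_subspace (G Mod H) n \<rho> W = invariant_subspace G n \<sigma> W" for W
    unfolding invariant_subspace_def img \<sigma>_def by simp
  ultimately have "irreducible_rep G n \<sigma>"
    using irr unfolding irreducible_rep_def by blast
  hence \<chi>: "\<chi> \<in> irr_chars G" unfolding irr_chars_def \<chi>_def by blast
  have \<chi>\<chi>: "\<chi> g = \<chi>' (H #> g)" if "g \<in> carrier G" for g using that by (simp add: \<chi>_def \<chi>'_def \<sigma>_def img)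
  have "char_kernel G \<chi> = {g \<in> carrier G. H #> g \<in> char_kernel (G Mod H) \<chi>'}"
    using \<chi>\<chi> H1 by (auto simp: char_kernel_def img)
  hence k: "card (char_kernel G \<chi>) = card (char_kernel (G Mod H) \<chi>') * card H"
    using card_preimage_FactGroup[OF fin, of "char_kernel (G Mod H) \<chi>'"] by (auto simp: char_kernel_def)
  have H0: "card H \<noteq> 0" using fin finite_subset[OF subset] subgroup.one_closed[OF is_subgroup] by (metis card_0_eq empty_iff)
  have "codegree G \<chi> = codegree (G Mod H) \<chi>'"
    unfolding codegree_def k card_FactGroup[OF fin, symmetric]
    using H0 \<chi>\<chi>[of \<one>] H1 by (simp add: divide_simps)
  hence "c = codegree G \<chi>" using c by (simp add: \<chi>'_def)
  with \<chi> show "c \<in> codegrees G" unfolding codegrees_def by blast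
qed

section \<open>Roots of unity and faithful representations of monolithic groups\<close>

lemma primitive_root_of_unity:
  obtains \<zeta> :: complex where "\<zeta> ^ p = 1" "p > 1 \<Longrightarrow> \<zeta> \<noteq> 1"
proof (cases "p > 1")
  case True
  have "\<exists>z::complex. z ^ p = 1 \<and> z \<noteq> 1"
  proof (rule ccontr)
    assume "\<not> ?thesis"
    hence "{z::complex. z ^ p = 1} \<subseteq> {1}" by blast
    hence "card {z::complex. z ^ p = 1} \<le> 1" using card_mono[of "{1::complex}"] by fastforce
    thus False using card_roots_unity_eq[of p] True by simp
  qed
  thus thesis using that by blast
qed (use that[of 1] in auto)

lemma root_of_unity_powers_inj:
  fixes \<zeta> :: complex
  assumes p: "prime p" and \<zeta>: "\<zeta> ^ p = 1" "\<zeta> \<noteq> 1"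
  shows "inj_on (\<lambda>i. \<zeta> ^ i) {..<p}"
proof -
  have \<zeta>0: "\<zeta> \<noteq> 0" using \<zeta> p by (auto simp: power_0_left prime_gt_0_nat)
  have key: "i = j" if "i \<le> j" "j < p" "\<zeta> ^ i = \<zeta> ^ j" for i j
  proof (rule ccontr)
    assume "i \<noteq> j"
    hence d: "0 < j - i" "j - i < p" using that by auto
    have 1: "\<zeta> ^ (j - i) = 1" using that \<zeta>0 by (simp add: power_diff)
    have "coprime (j - i) p" using p d by (simp add: prime_imp_coprime_nat coprime_commute nat_dvd_not_less)
    \<comment> \<open>Bezout expresses \<open>\<zeta>\<close> itself as a power of
      \<open>\<zeta> ^ (j - i) = 1\<close>.\<close>
    from bezout_nat[of "j - i" p] obtain x y where "(j - i) * x = p * y + 1"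
      using d \<open>coprime (j - i) p\<close> by (metis bezout_nat coprime_imp_gcd_eq_1 neq0_conv)
    hence "(\<zeta> ^ (j - i)) ^ x = (\<zeta> ^ p) ^ y * \<zeta>" by (metis power_mult power_add power_one_right)
    with 1 \<zeta> show False by simp
  qed
  show ?thesis
  proof (rule inj_onI)
    fix i j assume ij: "i \<in> {..<p}" "j \<in> {..<p}" "\<zeta> ^ i = \<zeta> ^ j"
    show "i = j"
    proof (cases "i \<le> j")
      case True with key[of i j] ij show ?thesis by simp
    next
      case False with key[of j i] ij show ?thesis by simp
    qed
  qed
qed

text \<open>The monolith is an explicit parameter because in each application it is a known term of
  the lower central series.\<close>

definition monolithic :: "('g, 'b) monoid_scheme \<Rightarrow> 'g set \<Rightarrow> bool" where
  "monolithic G M \<longleftrightarrow> M \<lhd> G \<and> M \<noteq> {\<one>\<^bsub>G\<^esub>} \<and> (\<forall>K. K \<lhd> G \<longrightarrow> K \<noteq> {\<one>\<^bsub>G\<^esub>} \<longrightarrow> M \<subseteq> K)"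

lemma (in group) rep_kernel_normal:
  assumes rep: "is_rep G n \<rho>"
  shows "{g \<in> carrier G. \<rho> g = 1\<^sub>m n} \<lhd> G"
proof (rule normal_invI)
  note rm = is_repD(3)[OF rep]
  show "subgroup {g \<in> carrier G. \<rho> g = 1\<^sub>m n} G"
  proof (rule subgroupI)
    show "{g \<in> carrier G. \<rho> g = 1\<^sub>m n} \<noteq> {}" using is_repD(2)[OF rep] by blast
    fix a assume a: "a \<in> {g \<in> carrier G. \<rho> g = 1\<^sub>m n}"
    have "\<rho> (inv a) = 1\<^sub>m n"
      using rep_inverse(1)[OF rep, of a] a left_mult_one_mat[OF is_repD(1)[OF rep, of "inv a"]] by simp
    thus "inv a \<in> {g \<in> carrier G. \<rho> g = 1\<^sub>m n}" using a by simp
  qed (auto simp: rm)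
  fix x h assume xh: "x \<in> carrier G" "h \<in> {g \<in> carrier G. \<rho> g = 1\<^sub>m n}"
  have "\<rho> (x \<otimes> h \<otimes> inv x) = \<rho> x * \<rho> h * \<rho> (inv x)" using xh by (simp add: rm)
  also have "\<dots> = \<rho> x * \<rho> (inv x)" using xh right_mult_one_mat[OF is_repD(1)[OF rep, of x]] by simp
  also have "\<dots> = 1\<^sub>m n" using rep_inverse[OF rep] xh by simp
  finally show "x \<otimes> h \<otimes> inv x \<in> {g \<in> carrier G. \<rho> g = 1\<^sub>m n}" using xh by simp
qed

text \<open>A representation that is nontrivial on \<open>M\<close> is faithful, because its kernel does not contain \<open>M\<close>.\<close>

lemma (in group) monolithic_faithful_rep:
  assumes fin: "finite (carrier G)" and M: "monolithic G M" "M \<subseteq> group_center G"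
  shows "\<exists>n \<rho>. irreducible_rep G n \<rho> \<and> (\<forall>g\<in>carrier G. \<rho> g = 1\<^sub>m n \<longrightarrow> g = \<one>)"
proof -
  have "\<one> \<in> M" using M by (auto simp: monolithic_def dest: normal_imp_subgroup subgroup.one_closed)
  then obtain z where z: "z \<in> M" "z \<noteq> \<one>" using M by (auto simp: monolithic_def)
  have zc: "z \<in> group_center G" "z \<in> carrier G" using z M by (auto simp: group_center_def)
  have "ord z > 1"
    using z(2) ord_ge_1[OF fin zc(2)] ord_eq_1[OF zc(2)] by linarith
  obtain \<zeta> :: complex where \<zeta>: "\<zeta> ^ ord z = 1" "\<zeta> \<noteq> 1"
    using primitive_root_of_unity[of "ord z"] \<open>ord z > 1\<close> by metis
  from irreducible_rep_of_central[OF fin zc(1) \<zeta>(1)] obtain n \<rho>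
    where irr: "irreducible_rep G n \<rho>" and \<rho>z: "\<rho> z = \<zeta> \<cdot>\<^sub>m 1\<^sub>m n" by blast
  from irr have rep: "is_rep G n \<rho>" and n: "n > 0" by (auto simp: irreducible_rep_def)
  have "\<rho> z \<noteq> 1\<^sub>m n"
  proof
    assume "\<rho> z = 1\<^sub>m n"
    hence "(\<zeta> \<cdot>\<^sub>m 1\<^sub>m n) $$ (0, 0) = (1\<^sub>m n :: complex mat) $$ (0, 0)" using \<rho>z by simp
    thus False using n \<zeta> by simp
  qed
  hence "{g \<in> carrier G. \<rho> g = 1\<^sub>m n} = {\<one>}"
    using rep_kernel_normal[OF rep] M(1) z unfolding monolithic_def by blast
  thus ?thesis using irr by blast
qed

section \<open>Commutators and the lower central series\<close>

definition commutator :: "('g, 'b) monoid_scheme \<Rightarrow> 'g \<Rightarrow> 'g \<Rightarrow> 'g" where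
  "commutator G x y = x \<otimes>\<^bsub>G\<^esub> y \<otimes>\<^bsub>G\<^esub> inv\<^bsub>G\<^esub> x \<otimes>\<^bsub>G\<^esub> inv\<^bsub>G\<^esub> y"

lemma (in group) commutator_closed [simp]:
  "x \<in> carrier G \<Longrightarrow> y \<in> carrier G \<Longrightarrow> commutator G x y \<in> carrier G"
  by (simp add: commutator_def)

lemma (in group) commutator_swap:
  assumes "x \<in> carrier G" "y \<in> carrier G"
  shows "x \<otimes> y = commutator G x y \<otimes> (y \<otimes> x)"
proof -
  have "inv y \<otimes> (y \<otimes> x) = x" using assms by (simp add: m_assoc[symmetric])
  thus ?thesis using assms by (simp add: commutator_def m_assoc)
qed

lemma (in group) commutator_inv:
  assumes "x \<in> carrier G" "y \<in> carrier G"
  shows "inv (commutator G x y) = commutator G y x"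
  using assms by (simp add: commutator_def inv_mult_group m_assoc)

lemma (in group) commutator_eq_one_iff:
  assumes "x \<in> carrier G" "y \<in> carrier G"
  shows "commutator G x y = \<one> \<longleftrightarrow> x \<otimes> y = y \<otimes> x"
proof
  assume "commutator G x y = \<one>"
  thus "x \<otimes> y = y \<otimes> x" using commutator_swap[OF assms] assms by simp
next
  assume *: "x \<otimes> y = y \<otimes> x"
  have "commutator G x y = x \<otimes> y \<otimes> inv (y \<otimes> x)"
    using assms by (simp add: commutator_def inv_mult_group m_assoc)
  thus "commutator G x y = \<one>" using * assms by simp
qed

text \<open>The fibres of \<open>\<lambda>g. commutator G g x\<close> are thus the left cosets of
  the centralizer of \<open>x\<close>, the basis of all later counting of commutators.\<close>

lemma (in group) commutator_eq_iff:
  assumes "x \<in> carrier G" "g \<in> carrier G" "h \<in> carrier G"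
  shows "commutator G g x = commutator G h x \<longleftrightarrow> (inv h \<otimes> g) \<otimes> x = x \<otimes> (inv h \<otimes> g)"
proof -
  have "commutator G g x = commutator G h x \<longleftrightarrow> g \<otimes> x \<otimes> inv g = h \<otimes> x \<otimes> inv h"
    using assms by (simp add: commutator_def)
  also have "\<dots> \<longleftrightarrow> g \<otimes> x = h \<otimes> x \<otimes> inv h \<otimes> g"
    using assms by (metis inv_closed inv_solve_right m_closed)
  also have "\<dots> \<longleftrightarrow> inv h \<otimes> (g \<otimes> x) = x \<otimes> inv h \<otimes> g"
    using assms by (simp add: m_assoc inv_solve_left')
  also have "\<dots> \<longleftrightarrow> (inv h \<otimes> g) \<otimes> x = x \<otimes> (inv h \<otimes> g)"
    using assms by (simp add: m_assoc)
  finally show ?thesis .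
qed

lemma (in group) lower_central_Suc:
  "lower_central G (Suc i) = generate G {commutator G x y |x y. x \<in> lower_central G i \<and> y \<in> carrier G}"
  by (simp add: commutator_def) (rule arg_cong[of _ _ "generate G"], blast)

declare lower_central.simps(2) [simp del]

lemma (in group) conj_commutator:
  assumes "x \<in> carrier G" "y \<in> carrier G" "g \<in> carrier G"
  shows "g \<otimes> commutator G x y \<otimes> inv g = commutator G (g \<otimes> x \<otimes> inv g) (g \<otimes> y \<otimes> inv g)"
proof -
  have c: "inv g \<otimes> (g \<otimes> u) = u" if "u \<in> carrier G" for u
    using that assms by (simp add: m_assoc[symmetric])
  show ?thesis using assms by (simp add: commutator_def m_assoc inv_mult_group c)
qed

lemma (in group) lower_central_normal: "lower_central G i \<lhd> G"
proof (induction i)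
  case 0 show ?case by (simp add: normal_self)
next
  case (Suc i)
  then interpret N: normal "lower_central G i" G .
  show ?case
    unfolding lower_central_Suc
  proof (rule normal_generateI)
    show "{commutator G x y |x y. x \<in> lower_central G i \<and> y \<in> carrier G} \<subseteq> carrier G"
      using N.subset by auto
    fix h g assume h: "h \<in> {commutator G x y |x y. x \<in> lower_central G i \<and> y \<in> carrier G}"
      and g: "g \<in> carrier G"
    then obtain x y where xy: "h = commutator G x y" "x \<in> lower_central G i" "y \<in> carrier G" by blast
    have "x \<in> carrier G" using xy N.subset by blast
    from conj_commutator[OF this xy(3) g] N.inv_op_closed2[OF g xy(2)] g xy
    show "g \<otimes> h \<otimes> inv g \<in> {commutator G x y |x y. x \<in> lower_central G i \<and> y \<in> carrier G}"
      by (metis (mono_tags, lifting) inv_closed m_closed mem_Collect_eq)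
  qed
qed

lemma (in group) lower_central_subset: "lower_central G i \<subseteq> carrier G"
  using lower_central_normal normal_imp_subgroup subgroup.subset by metis

lemma (in group) lower_central_commutator:
  assumes "x \<in> lower_central G i" "y \<in> carrier G"
  shows "commutator G x y \<in> lower_central G (Suc i)"
  unfolding lower_central_Suc by (rule generate.incl) (use assms in blast)

lemma (in group) lower_central_Suc_le:
  assumes "subgroup K G" "\<And>x y. x \<in> lower_central G i \<Longrightarrow> y \<in> carrier G \<Longrightarrow> commutator G x y \<in> K"
  shows "lower_central G (Suc i) \<subseteq> K"
  unfolding lower_central_Suc by (rule generate_subgroup_incl) (use assms in auto)

lemma (in group) lower_central_Suc_subset: "lower_central G (Suc i) \<subseteq> lower_central G i"
proof (rule lower_central_Suc_le)
  interpret N: normal "lower_central G i" G by (rule lower_central_normal)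
  show "subgroup (lower_central G i) G" by (rule N.is_subgroup)
  fix x y assume xy: "x \<in> lower_central G i" "y \<in> carrier G"
  have x: "x \<in> carrier G" using xy N.subset by blast
  have "x \<otimes> (y \<otimes> inv x \<otimes> inv y) \<in> lower_central G i"
    using xy N.inv_op_closed2[OF xy(2), of "inv x"] by simp
  thus "commutator G x y \<in> lower_central G i" using x xy by (simp add: commutator_def m_assoc)
qed

lemma (in group) lower_central_antimono: "i \<le> j \<Longrightarrow> lower_central G j \<subseteq> lower_central G i"
  using lower_central_Suc_subset by (rule lift_Suc_antimono_le)

lemma (in group) lower_central_Suc_trivial_iff:
  "lower_central G (Suc i) = {\<one>} \<longleftrightarrow> lower_central G i \<subseteq> group_center G"
proof
  assume *: "lower_central G (Suc i) = {\<one>}"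
  show "lower_central G i \<subseteq> group_center G"
  proof
    fix x assume x: "x \<in> lower_central G i"
    hence xc: "x \<in> carrier G" using lower_central_subset by blast
    show "x \<in> group_center G"
      unfolding group_center_def using lower_central_commutator[OF x] * commutator_eq_one_iff[OF xc] xc
      by fastforce
  qed
next
  assume *: "lower_central G i \<subseteq> group_center G"
  have "lower_central G (Suc i) \<subseteq> {\<one>}"
  proof (rule lower_central_Suc_le)
    show "subgroup {\<one>} G" by (rule triv_subgroup)
    fix x y assume xy: "x \<in> lower_central G i" "y \<in> carrier G"
    hence "x \<in> carrier G" "x \<otimes> y = y \<otimes> x" using * by (auto simp: group_center_def)
    thus "commutator G x y \<in> {\<one>}" using commutator_eq_one_iff xy by simp
  qed
  thus "lower_central G (Suc i) = {\<one>}"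
    using subgroup.one_closed[OF normal_imp_subgroup[OF lower_central_normal]] by auto
qed

lemma (in group_hom) lower_central_img:
  assumes surj: "h ` carrier G = carrier H"
  shows "lower_central H i = h ` lower_central G i"
proof (induction i)
  case (Suc i)
  have hc: "h (commutator G x y) = commutator H (h x) (h y)" if "x \<in> carrier G" "y \<in> carrier G" for x y
    using that by (simp add: commutator_def)
  have eq: "{commutator H x y |x y. x \<in> lower_central H i \<and> y \<in> carrier H}
    = h ` {commutator G x y |x y. x \<in> lower_central G i \<and> y \<in> carrier G}"
    (is "?L = ?R")
  proof
    show "?L \<subseteq> ?R"
    proof
      fix u assume "u \<in> ?L"
      then obtain x y where "u = commutator H (h x) (h y)" "x \<in> lower_central G i" "y \<in> carrier G"
        unfolding Suc surj[symmetric] by blast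
      moreover from this have "x \<in> carrier G" using G.lower_central_subset by blast
      ultimately have "u = h (commutator G x y)" "x \<in> lower_central G i" "y \<in> carrier G" using hc[of x y] by auto
      thus "u \<in> ?R" by blast
    qed
    show "?R \<subseteq> ?L"
    proof
      fix u assume "u \<in> ?R"
      then obtain x y where "u = h (commutator G x y)" "x \<in> lower_central G i" "y \<in> carrier G" by blast
      moreover from this have "x \<in> carrier G" using G.lower_central_subset by blast
      ultimately have "u = commutator H (h x) (h y)" "x \<in> lower_central G i" "y \<in> carrier G" using hc[of x y] by auto
      thus "u \<in> ?L" unfolding Suc surj[symmetric] by blast
    qed
  qed
  have sub: "{commutator G x y |x y. x \<in> lower_central G i \<and> y \<in> carrier G} \<subseteq> carrier G"
    by (auto dest!: subsetD[OF G.lower_central_subset])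
  show ?case unfolding H.lower_central_Suc G.lower_central_Suc eq by (rule generate_img[OF sub])
qed (simp add: surj)

lemma (in normal) lower_central_FactGroup:
  "lower_central (G Mod H) i = (\<lambda>x. H #> x) ` lower_central G i"
proof -
  interpret group_hom G "G Mod H" "\<lambda>x. H #> x"
    by (intro group_hom.intro group_hom_axioms.intro is_group factorgroup_is_group r_coset_hom_Mod)
  show ?thesis by (rule lower_central_img) (simp add: carrier_FactGroup)
qed

lemma (in normal) rcos_eq_iff: "x \<in> carrier G \<Longrightarrow> H #> x = H \<longleftrightarrow> x \<in> H"
  using coset_join1[OF _ _ is_subgroup] coset_join2[OF _ is_subgroup] by blast

lemma (in normal) lower_central_FactGroup_trivial_iff:
  "lower_central (G Mod H) i = {\<one>\<^bsub>G Mod H\<^esub>} \<longleftrightarrow> lower_central G i \<subseteq> H"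
proof -
  have "\<one> \<in> lower_central G i" using subgroup.one_closed[OF normal_imp_subgroup[OF lower_central_normal]] .
  thus ?thesis unfolding lower_central_FactGroup
    using rcos_eq_iff lower_central_subset by (auto simp: subset_eq image_iff) blast+
qed

section \<open>Counting in finite \<open>p\<close>-groups\<close>

lemma card_eq_fibers:
  assumes "finite A" "\<And>a. a \<in> A \<Longrightarrow> card {x \<in> A. f x = f a} = k"
  shows "card A = card (f ` A) * k"
proof -
  have "card A = (\<Sum>b\<in>f ` A. card {x \<in> A. f x = b})"
    using sum.image_gen[OF assms(1), of "\<lambda>_. 1 :: nat" f] by simp
  also have "\<dots> = (\<Sum>b\<in>f ` A. k)" by (rule sum.cong) (use assms(2) in auto)
  finally show ?thesis by simp
qed

lemma card_le_fibers:
  assumes "finite A" "\<And>a. a \<in> A \<Longrightarrow> card {x \<in> A. f x = f a} \<le> k"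
  shows "card A \<le> card (f ` A) * k"
proof -
  have "card A = (\<Sum>b\<in>f ` A. card {x \<in> A. f x = b})"
    using sum.image_gen[OF assms(1), of "\<lambda>_. 1 :: nat" f] by simp
  also have "\<dots> \<le> (\<Sum>b\<in>f ` A. k)" by (rule sum_mono) (use assms(2) in auto)
  finally show ?thesis by simp
qed

lemma (in group) group_center_subgroup: "subgroup (group_center G) G"
proof (rule subgroupI)
  show "group_center G \<noteq> {}" unfolding group_center_def using one_closed by force
  fix a assume a: "a \<in> group_center G"
  show "inv a \<in> group_center G"
    unfolding group_center_def
  proof (intro CollectI conjI ballI)
    fix g assume g: "g \<in> carrier G"
    have "a \<otimes> inv g = inv g \<otimes> a" "a \<in> carrier G" using a g by (auto simp: group_center_def)
    hence "inv (a \<otimes> inv g) = inv (inv g \<otimes> a)" by simp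
    thus "g \<otimes> inv a = inv a \<otimes> g" using g \<open>a \<in> carrier G\<close> by (simp add: inv_mult_group)
  qed (use a in \<open>auto simp: group_center_def\<close>)
  fix b assume b: "b \<in> group_center G"
  show "a \<otimes> b \<in> group_center G"
    unfolding group_center_def
  proof (intro CollectI conjI ballI)
    have ab: "a \<in> carrier G" "b \<in> carrier G" using a b by (auto simp: group_center_def)
    thus "a \<otimes> b \<in> carrier G" by simp
    fix g assume g: "g \<in> carrier G"
    have "g \<otimes> (a \<otimes> b) = a \<otimes> g \<otimes> b" using a g ab by (simp add: group_center_def m_assoc[symmetric])
    also have "\<dots> = a \<otimes> b \<otimes> g" using b g ab by (simp add: group_center_def m_assoc)
    finally show "g \<otimes> (a \<otimes> b) = a \<otimes> b \<otimes> g" .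
  qed
qed (auto simp: group_center_def)

lemma (in group) central_subgroup_normal:
  assumes "subgroup K G" "K \<subseteq> group_center G"
  shows "K \<lhd> G"
proof (rule normal_invI[OF assms(1)])
  fix x h assume xh: "x \<in> carrier G" "h \<in> K"
  have "h \<in> carrier G" "x \<otimes> h = h \<otimes> x" using assms(2) xh by (auto simp: group_center_def)
  thus "x \<otimes> h \<otimes> inv x \<in> K" using xh by (simp add: m_assoc)
qed

lemma (in group) subgroup_card_prime_power:
  assumes "prime p" "card (carrier G) = p ^ n" "subgroup H G"
  shows "\<exists>k\<le>n. card H = p ^ k"
proof -
  have "card (rcosets H) * card H = p ^ n" using lagrange[OF assms(3)] assms(2) by (simp add: Coset.order_def)
  hence "card H dvd p ^ n" by (metis dvd_triv_right)
  thus ?thesis using divides_primepow_nat[OF assms(1)] by blast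
qed

text \<open>Both orders are powers of \<open>p\<close>, so a strict inclusion costs a full factor
  \<open>p\<close>. Index arguments below are phrased through this inequality.\<close>

lemma (in group) proper_subgroup_card:
  assumes p: "prime p" "card (carrier G) = p ^ n" and H: "subgroup H G" "subgroup K G" "H \<subset> K"
  shows "p * card H \<le> card K"
proof -
  obtain i j where ij: "card H = p ^ i" "card K = p ^ j"
    using subgroup_card_prime_power[OF p] H by metis
  have "finite (carrier G)" using p by (metis card.infinite power_eq_0_iff not_prime_0)
  hence "card H < card K" using H(3) subgroup.subset[OF H(2)] by (metis finite_subset psubset_card_mono)
  hence "i < j" using ij p(1) prime_gt_1_nat by (metis power_strict_increasing_iff)
  hence "p ^ Suc i \<le> p ^ j" using prime_gt_0_nat[OF p(1)] by (intro power_increasing) auto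
  thus ?thesis using ij by simp
qed

definition centralizer :: "('g, 'b) monoid_scheme \<Rightarrow> 'g \<Rightarrow> 'g set" where
  "centralizer G x = {g \<in> carrier G. g \<otimes>\<^bsub>G\<^esub> x = x \<otimes>\<^bsub>G\<^esub> g}"

lemma (in group) centralizer_subgroup:
  assumes x: "x \<in> carrier G"
  shows "subgroup (centralizer G x) G"
proof (rule subgroupI)
  show "centralizer G x \<noteq> {}" using x by (auto simp: centralizer_def)
  fix a assume a: "a \<in> centralizer G x"
  hence ac: "a \<in> carrier G" and ax: "a \<otimes> x = x \<otimes> a" by (auto simp: centralizer_def)
  have "inv a \<otimes> x = inv a \<otimes> (x \<otimes> a) \<otimes> inv a" using ac x by (simp add: m_assoc)
  also have "\<dots> = x \<otimes> inv a" using ac x by (simp add: ax[symmetric] m_assoc[symmetric])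
  finally show "inv a \<in> centralizer G x" using ac by (simp add: centralizer_def)
  fix b assume b: "b \<in> centralizer G x"
  hence bc: "b \<in> carrier G" and bx: "b \<otimes> x = x \<otimes> b" by (auto simp: centralizer_def)
  have "a \<otimes> b \<otimes> x = a \<otimes> x \<otimes> b" using ac bc x bx by (simp add: m_assoc)
  also have "\<dots> = x \<otimes> (a \<otimes> b)" using ac bc x ax by (simp add: m_assoc)
  finally show "a \<otimes> b \<in> centralizer G x" using ac bc by (simp add: centralizer_def)
qed (auto simp: centralizer_def)

text \<open>Orbit-stabilizer in commutator form: the image is the conjugacy class of
  \<open>x\<close> translated by \<open>inv x\<close>.\<close>

lemma (in group) card_commutators_centralizer:
  assumes fin: "finite (carrier G)" and x: "x \<in> carrier G"
  shows "card (carrier G) = card ((\<lambda>g. commutator G g x) ` carrier G) * card (centralizer G x)"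
proof (rule card_eq_fibers[OF fin])
  fix a assume a: "a \<in> carrier G"
  have "{g \<in> carrier G. commutator G g x = commutator G a x} = (\<lambda>c. a \<otimes> c) ` centralizer G x"
  proof
    show "{g \<in> carrier G. commutator G g x = commutator G a x} \<subseteq> (\<lambda>c. a \<otimes> c) ` centralizer G x"
    proof
      fix g assume "g \<in> {g \<in> carrier G. commutator G g x = commutator G a x}"
      hence g: "g \<in> carrier G" "commutator G g x = commutator G a x" by auto
      hence "inv a \<otimes> g \<in> centralizer G x"
        using commutator_eq_iff[OF x g(1) a] a by (simp add: centralizer_def)
      moreover have "g = a \<otimes> (inv a \<otimes> g)" using a g by (simp add: m_assoc[symmetric])
      ultimately show "g \<in> (\<lambda>c. a \<otimes> c) ` centralizer G x" by blast
    qed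
    show "(\<lambda>c. a \<otimes> c) ` centralizer G x \<subseteq> {g \<in> carrier G. commutator G g x = commutator G a x}"
    proof clarify
      fix c assume c: "c \<in> centralizer G x"
      hence cc: "c \<in> carrier G" "c \<otimes> x = x \<otimes> c" by (auto simp: centralizer_def)
      have "inv a \<otimes> (a \<otimes> c) = c" using a cc by (simp add: m_assoc[symmetric])
      thus "a \<otimes> c \<in> carrier G \<and> commutator G (a \<otimes> c) x = commutator G a x"
        using commutator_eq_iff[OF x, of "a \<otimes> c" a] a cc by simp
    qed
  qed
  moreover have "inj_on (\<lambda>c. a \<otimes> c) (centralizer G x)"
    using a by (auto simp: inj_on_def centralizer_def)
  ultimately show "card {g \<in> carrier G. commutator G g x = commutator G a x} = card (centralizer G x)"
    by (simp add: card_image)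
qed

text \<open>Counting fixed points of the conjugation action on \<open>N\<close>: the conjugacy classes of
  noncentral elements have size divisible by \<open>p\<close>.\<close>

lemma (in group) pgroup_normal_meets_center:
  assumes p: "prime p" "card (carrier G) = p ^ n" and N: "N \<lhd> G" "N \<noteq> {\<one>}"
  shows "N \<inter> group_center G \<noteq> {\<one>}"
proof -
  interpret N: normal N G by (rule N)
  have fin: "finite (carrier G)" using p by (metis card.infinite power_eq_0_iff not_prime_0)
  have finN: "finite N" using fin N.subset finite_subset by blast
  define A where "A = N - group_center G"
  define orb where "orb x = (\<lambda>g. g \<otimes> x \<otimes> inv g) ` carrier G" for x
  have orb_sym: "orb y = orb x" if x: "x \<in> carrier G" and y: "y \<in> orb x" for x y
  proof -
    obtain h where h: "h \<in> carrier G" "y = h \<otimes> x \<otimes> inv h" using y by (auto simp: orb_def)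
    have 1: "g \<otimes> y \<otimes> inv g = (g \<otimes> h) \<otimes> x \<otimes> inv (g \<otimes> h)" if "g \<in> carrier G" for g
      using that h x by (simp add: inv_mult_group m_assoc)
    have 2: "g \<otimes> x \<otimes> inv g = (g \<otimes> inv h) \<otimes> y \<otimes> inv (g \<otimes> inv h)" if "g \<in> carrier G" for g
    proof -
      have "inv h \<otimes> (h \<otimes> u) = u" if "u \<in> carrier G" for u
        using that h by (simp add: m_assoc[symmetric])
      thus ?thesis using that h x by (simp add: inv_mult_group m_assoc)
    qed
    show ?thesis
    proof
      show "orb y \<subseteq> orb x" unfolding orb_def using 1 h by auto
      show "orb x \<subseteq> orb y"
      proof
        fix w assume "w \<in> orb x"
        then obtain g where "g \<in> carrier G" "w = g \<otimes> x \<otimes> inv g" by (auto simp: orb_def)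
        with 2[of g] h show "w \<in> orb y" unfolding orb_def by (intro image_eqI[of _ _ "g \<otimes> inv h"]) auto
      qed
    qed
  qed
  have self: "x \<in> orb x" if "x \<in> carrier G" for x
    unfolding orb_def using that by (intro image_eqI[of _ _ \<one>]) auto
  have fiber: "{y \<in> A. orb y = orb x} = orb x" if x: "x \<in> A" for x
  proof
    have xc: "x \<in> carrier G" "x \<in> N" "x \<notin> group_center G" using x N.subset by (auto simp: A_def)
    show "{y \<in> A. orb y = orb x} \<subseteq> orb x" using self N.subset by (auto simp: A_def)
    show "orb x \<subseteq> {y \<in> A. orb y = orb x}"
    proof
      fix y assume y: "y \<in> orb x"
      have "y \<in> N" using y xc N.inv_op_closed2 by (auto simp: orb_def)
      moreover have "y \<notin> group_center G"
      proof
        assume "y \<in> group_center G"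
        hence "orb y \<subseteq> {y}" by (auto simp: orb_def group_center_def m_assoc)
        hence "x = y" using self[OF xc(1)] orb_sym[OF xc(1) y] by auto
        thus False using \<open>y \<in> group_center G\<close> xc by simp
      qed
      ultimately show "y \<in> {y \<in> A. orb y = orb x}" using orb_sym[OF xc(1) y] by (simp add: A_def)
    qed
  qed
  have pdvd: "p dvd card (orb x)" if x: "x \<in> A" for x
  proof -
    have xc: "x \<in> carrier G" "x \<notin> group_center G" using x N.subset by (auto simp: A_def)
    \<comment> \<open>The class of \<open>x\<close> is a translate of a set of commutators, so its
      size times the order of the centralizer is \<open>p ^ n\<close>.\<close>
    have "orb x = (\<lambda>c. c \<otimes> x) ` (\<lambda>g. commutator G g x) ` carrier G"
      unfolding orb_def image_image using xc by (intro image_cong refl) (simp add: commutator_def m_assoc)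
    moreover have "inj_on (\<lambda>c. c \<otimes> x) ((\<lambda>g. commutator G g x) ` carrier G)"
      using xc by (intro inj_onI) auto
    ultimately have "card (orb x) = card ((\<lambda>g. commutator G g x) ` carrier G)" by (simp add: card_image)
    hence eq: "p ^ n = card (orb x) * card (centralizer G x)"
      using card_commutators_centralizer[OF fin xc(1)] p by simp
    then obtain k where k: "card (orb x) = p ^ k" using divides_primepow_nat[OF p(1)] by (metis dvd_triv_left)
    have "k \<noteq> 0"
    proof
      assume "k = 0"
      hence "card (centralizer G x) = card (carrier G)" using eq k p by simp
      moreover have "centralizer G x \<subseteq> carrier G" by (auto simp: centralizer_def)
      ultimately have "centralizer G x = carrier G" using fin by (metis card_subset_eq)
      hence "\<forall>g\<in>carrier G. g \<otimes> x = x \<otimes> g" unfolding centralizer_def by blast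
      thus False using xc by (simp add: group_center_def)
    qed
    thus ?thesis using k by (simp add: dvd_power)
  qed
  have "card A = (\<Sum>b\<in>orb ` A. card {y \<in> A. orb y = b})"
    using sum.image_gen[of A "\<lambda>_. 1 :: nat" orb] finN by (simp add: A_def)
  also have "p dvd \<dots>" by (rule dvd_sum) (use pdvd fiber in auto)
  finally have "p dvd card A" .
  obtain k where k: "card N = p ^ k" using subgroup_card_prime_power[OF p N.is_subgroup] by blast
  have "k \<noteq> 0"
  proof
    assume "k = 0"
    hence "card N = 1" using k by simp
    then obtain u where "N = {u}" using card_1_singletonE by blast
    thus False using subgroup.one_closed[OF N.is_subgroup] N(2) by auto
  qed
  hence "p dvd card N" using k by (simp add: dvd_power)
  moreover have "card N = card (N \<inter> group_center G) + card A"
    unfolding A_def using finN by (metis card_Int_Diff)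
  ultimately have "p dvd card (N \<inter> group_center G)" using \<open>p dvd card A\<close> by (metis dvd_add_left_iff)
  thus ?thesis using p(1) by (auto dest: prime_gt_1_nat)
qed

section \<open>Centres of quotients and strict descent of the lower central series\<close>

lemma (in normal) center_FactGroup_iff:
  assumes g: "g \<in> carrier G"
  shows "H #> g \<in> group_center (G Mod H) \<longleftrightarrow> (\<forall>h\<in>carrier G. commutator G g h \<in> H)"
proof -
  have "H #> (h \<otimes> g) = H #> (g \<otimes> h) \<longleftrightarrow> commutator G g h \<in> H" if h: "h \<in> carrier G" for h
  proof
    assume "H #> (h \<otimes> g) = H #> (g \<otimes> h)"
    hence "g \<otimes> h \<in> H #> (h \<otimes> g)" using rcos_self[OF _ is_subgroup, of "g \<otimes> h"] g h by simp
    hence "(g \<otimes> h) \<otimes> inv (h \<otimes> g) \<in> H" using rcos_module_imp[OF is_group] g h by simp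
    thus "commutator G g h \<in> H" using g h by (simp add: commutator_def inv_mult_group m_assoc)
  next
    assume *: "commutator G g h \<in> H"
    have "g \<otimes> h \<in> H #> (h \<otimes> g)"
      unfolding r_coset_def using * commutator_swap[OF g h] by blast
    thus "H #> (h \<otimes> g) = H #> (g \<otimes> h)" using repr_independence[OF _ _ is_subgroup] g h by simp
  qed
  thus ?thesis using g by (auto simp: group_center_def carrier_FactGroup rcos_sum)
qed

lemma (in normal) normal_preimage:
  assumes K: "K \<lhd> (G Mod H)"
  shows "{g \<in> carrier G. H #> g \<in> K} \<lhd> G" and "H \<subseteq> {g \<in> carrier G. H #> g \<in> K}"
proof -
  interpret K: normal K "G Mod H" by (rule K)
  have H1: "H \<in> K" using subgroup.one_closed[OF K.is_subgroup] by simp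
  have inv: "H #> inv g = inv\<^bsub>G Mod H\<^esub> (H #> g)" if "g \<in> carrier G" for g
  proof -
    have "H #> g \<in> carrier (G Mod H)" unfolding carrier_FactGroup using that by (rule imageI)
    from inv_FactGroup[OF this] rcos_inv[OF that] show ?thesis by simp
  qed
  show "{g \<in> carrier G. H #> g \<in> K} \<lhd> G"
  proof (rule normal_invI)
    show "subgroup {g \<in> carrier G. H #> g \<in> K} G"
    proof (rule subgroupI)
      have "\<one> \<in> {g \<in> carrier G. H #> g \<in> K}" using H1 rcos_eq_iff[of \<one>] one_closed by simp
      thus "{g \<in> carrier G. H #> g \<in> K} \<noteq> {}" by blast
      fix a assume a: "a \<in> {g \<in> carrier G. H #> g \<in> K}"
      thus "inv a \<in> {g \<in> carrier G. H #> g \<in> K}" using inv K.m_inv_closed by simp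
      fix b assume b: "b \<in> {g \<in> carrier G. H #> g \<in> K}"
      show "a \<otimes> b \<in> {g \<in> carrier G. H #> g \<in> K}"
        using a b subgroup.m_closed[OF K.is_subgroup, of "H #> a" "H #> b"] rcos_sum[of a b] by simp
    qed auto
    fix x h assume xh: "x \<in> carrier G" "h \<in> {g \<in> carrier G. H #> g \<in> K}"
    have "(H #> x) <#> (H #> h) <#> (H #> inv x) \<in> K"
      using K.inv_op_closed2[of "H #> x" "H #> h"] xh inv[of x] by (simp add: carrier_FactGroup)
    thus "x \<otimes> h \<otimes> inv x \<in> {g \<in> carrier G. H #> g \<in> K}" using xh by (simp add: rcos_sum)
  qed
  show "H \<subseteq> {g \<in> carrier G. H #> g \<in> K}"
  proof
    fix x assume "x \<in> H"
    hence "x \<in> carrier G" "H #> x = H" using rcos_eq_iff subset by blast+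
    thus "x \<in> {g \<in> carrier G. H #> g \<in> K}" using H1 by simp
  qed
qed

text \<open>Let \<open>K\<close> be maximal among the normal subgroups of \<open>G\<close> properly
  inside \<open>N\<close>. The image of \<open>N\<close> in the quotient by \<open>K\<close> meets
  the centre, and maximality makes that image central altogether, so all commutators of
  \<open>N\<close> with \<open>G\<close> fall into \<open>K\<close>.\<close>

lemma (in group) lower_central_strict:
  assumes p: "prime p" "card (carrier G) = p ^ n" and i: "lower_central G i \<noteq> {\<one>}"
  shows "lower_central G (Suc i) \<subset> lower_central G i"
proof -
  have fin: "finite (carrier G)" using p by (metis card.infinite power_eq_0_iff not_prime_0)
  define N where "N = lower_central G i"
  have N: "N \<lhd> G" unfolding N_def by (rule lower_central_normal)
  interpret N: normal N G by (rule N)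
  define S where "S = {K. K \<lhd> G \<and> K \<subset> N}"
  have "{\<one>} \<in> S" using i one_is_normal subgroup.one_closed[OF N.is_subgroup] by (auto simp: S_def N_def)
  moreover have "finite S"
    using finite_subset[of S "Pow N"] fin N.subset by (auto simp: S_def intro: finite_subset)
  ultimately obtain K where K: "K \<in> S" "\<And>K'. K' \<in> S \<Longrightarrow> K \<subseteq> K' \<Longrightarrow> K = K'"
    using finite_has_maximal[of S] by blast
  interpret K: normal K G using K by (simp add: S_def)
  interpret Q: group "G Mod K" by (rule K.factorgroup_is_group)
  have KN: "K \<subset> N" using K by (simp add: S_def)
  obtain m where m: "card (carrier (G Mod K)) = p ^ m"
    using K.card_FactGroup[OF fin] p divides_primepow_nat[OF p(1)] by (metis dvd_triv_left)
  define NK where "NK = (\<lambda>x. K #> x) ` N"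
  have NK: "NK \<lhd> (G Mod K)"
    unfolding NK_def N_def K.lower_central_FactGroup[symmetric] by (rule Q.lower_central_normal)
  have "NK \<noteq> {\<one>\<^bsub>G Mod K\<^esub>}"
  proof
    assume "NK = {\<one>\<^bsub>G Mod K\<^esub>}"
    moreover obtain y where y: "y \<in> N" "y \<notin> K" using KN by blast
    ultimately have "K #> y = K" by (auto simp: NK_def)
    moreover have "y \<in> carrier G" using y N.subset by blast
    ultimately show False using K.rcos_eq_iff y by simp
  qed
  from Q.pgroup_normal_meets_center[OF p(1) m NK this]
  have ne: "NK \<inter> group_center (G Mod K) \<noteq> {K}" by simp
  have "K \<in> NK \<inter> group_center (G Mod K)"
    using subgroup.one_closed[OF normal_imp_subgroup[OF NK]] subgroup.one_closed[OF Q.group_center_subgroup] by simp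
  with ne obtain u where u: "u \<in> NK" "u \<in> group_center (G Mod K)" "u \<noteq> K" by blast
  then obtain x where x: "x \<in> N" "u = K #> x" by (auto simp: NK_def)
  \<comment> \<open>The part of \<open>N\<close> that is central modulo \<open>K\<close>. It is
    normal and strictly larger than \<open>K\<close>, hence equal to \<open>N\<close>.\<close>
  define P where "P = {g \<in> carrier G. K #> g \<in> group_center (G Mod K)} \<inter> N"
  have "group_center (G Mod K) \<lhd> G Mod K"
    by (rule Q.central_subgroup_normal[OF Q.group_center_subgroup subset_refl])
  hence "P \<lhd> G" unfolding P_def
    by (intro normal_subgroup_intersect N K.normal_preimage(1))
  moreover have "K \<subseteq> P" unfolding P_def
    using K.normal_preimage(2)[OF \<open>group_center (G Mod K) \<lhd> G Mod K\<close>] KN by blast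
  moreover have "x \<in> P" using x u subsetD[OF N.subset x(1)] by (simp add: P_def)
  moreover have "x \<notin> K"
  proof
    assume "x \<in> K"
    hence "K #> x = K" using K.rcos_eq_iff[of x] K.subset by blast
    thus False using u x by simp
  qed
  moreover have "P \<subseteq> N" by (auto simp: P_def)
  ultimately have "P = N" using K(2)[of P] by (auto simp: S_def)
  have "lower_central G (Suc i) \<subseteq> K"
  proof (rule lower_central_Suc_le[OF K.is_subgroup])
    fix x y assume xy: "x \<in> lower_central G i" "y \<in> carrier G"
    hence "x \<in> P" using \<open>P = N\<close> by (simp add: N_def)
    thus "commutator G x y \<in> K" using K.center_FactGroup_iff[of x] xy by (auto simp: P_def)
  qed
  thus ?thesis using KN by (auto simp: N_def)
qed

lemma (in group) lower_central_card_le: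
  assumes p: "prime p" "card (carrier G) = p ^ n" and i: "lower_central G i \<noteq> {\<one>}"
  shows "p * card (lower_central G (Suc i)) \<le> card (lower_central G i)"
  by (rule proper_subgroup_card[OF p])
    (use lower_central_strict[OF assms] lower_central_normal normal_imp_subgroup in auto)

section \<open>Monolithic quotients\<close>

lemma (in group) exists_monolithic_quotient:
  assumes fin: "finite (carrier G)" and i: "lower_central G i \<noteq> {\<one>}"
  shows "\<exists>N. N \<lhd> G \<and> monolithic (G Mod N) (lower_central (G Mod N) i)"
proof -
  let ?L = "lower_central G i"
  define S where "S = {N. N \<lhd> G \<and> \<not> ?L \<subseteq> N}"
  have "\<one> \<in> ?L" using subgroup.one_closed[OF normal_imp_subgroup[OF lower_central_normal]] .
  hence "{\<one>} \<in> S" using i one_is_normal by (auto simp: S_def)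
  moreover have "finite S"
  proof (rule finite_subset)
    show "S \<subseteq> Pow (carrier G)" by (auto simp: S_def dest!: normal_imp_subgroup subgroup.subset)
  qed (use fin in simp)
  ultimately obtain N where N: "N \<in> S" "\<And>N'. N' \<in> S \<Longrightarrow> N \<subseteq> N' \<Longrightarrow> N = N'"
    using finite_has_maximal[of S] by blast
  interpret N: normal N G using N by (simp add: S_def)
  interpret Q: group "G Mod N" by (rule N.factorgroup_is_group)
  have "monolithic (G Mod N) (lower_central (G Mod N) i)"
    unfolding monolithic_def
  proof (intro conjI allI impI)
    show "lower_central (G Mod N) i \<lhd> G Mod N" by (rule Q.lower_central_normal)
    show "lower_central (G Mod N) i \<noteq> {\<one>\<^bsub>G Mod N\<^esub>}"
      using N.lower_central_FactGroup_trivial_iff N(1) by (simp add: S_def)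
    fix K assume K: "K \<lhd> G Mod N" "K \<noteq> {\<one>\<^bsub>G Mod N\<^esub>}"
    define P where "P = {g \<in> carrier G. N #> g \<in> K}"
    have P: "P \<lhd> G" "N \<subseteq> P" unfolding P_def using N.normal_preimage[OF K(1)] by auto
    have "N \<in> K" using subgroup.one_closed[OF normal_imp_subgroup[OF K(1)]] by simp
    then obtain u where u: "u \<in> K" "u \<noteq> N" using K(2) by auto
    then obtain x where x: "x \<in> carrier G" "u = N #> x"
      using subgroup.subset[OF normal_imp_subgroup[OF K(1)]] by (auto simp: carrier_FactGroup)
    have "x \<in> P" "x \<notin> N" using x u N.rcos_eq_iff[of x] by (auto simp: P_def)
    \<comment> \<open>The preimage \<open>P\<close> of \<open>K\<close> is strictly larger than the
      maximal member \<open>N\<close> of \<open>S\<close>.\<close>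
    hence "P \<notin> S" using N(2)[of P] P(2) by blast
    hence "?L \<subseteq> P" using P(1) by (simp add: S_def)
    thus "lower_central (G Mod N) i \<subseteq> K" unfolding N.lower_central_FactGroup P_def by blast
  qed
  thus ?thesis using N.normal_axioms by blast
qed

section \<open>Monoliths in the centre and their \<open>p\<close>-th roots\<close>

lemma (in group) central_generate_normal:
  assumes "y \<in> group_center G"
  shows "generate G {y} \<lhd> G" "generate G {y} \<subseteq> group_center G"
proof -
  have y: "y \<in> carrier G" using assms by (simp add: group_center_def)
  show "generate G {y} \<subseteq> group_center G"
    by (rule generate_subgroup_incl[OF _ group_center_subgroup]) (use assms in simp)
  thus "generate G {y} \<lhd> G" by (intro central_subgroup_normal generate_is_subgroup) (use y in auto)
qed

lemma (in group) subgroup_nat_pow_closed: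
  assumes "subgroup H G" "h \<in> H"
  shows "h [^] (k :: nat) \<in> H"
  using assms by (induction k) (auto simp: subgroup.one_closed subgroup.m_closed)

text \<open>A central element of order \<open>p\<close> inside \<open>M\<close> generates a normal
  subgroup, which must contain the monolith.\<close>

lemma (in group) monolith_card:
  assumes p: "prime p" "card (carrier G) = p ^ n"
    and M: "monolithic G M" "M \<subseteq> group_center G"
  shows "card M = p"
proof -
  have fin: "finite (carrier G)" using p by (metis card.infinite power_eq_0_iff not_prime_0)
  have Mn: "M \<lhd> G" "M \<noteq> {\<one>}" using M by (auto simp: monolithic_def)
  have M1: "\<one> \<in> M" using subgroup.one_closed[OF normal_imp_subgroup[OF Mn(1)]] .
  then obtain x where x: "x \<in> M" "x \<noteq> \<one>" using Mn by blast
  have xc: "x \<in> carrier G" "x \<in> group_center G" using x M by (auto simp: group_center_def)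
  have "ord x dvd p ^ n" using ord_dvd_group_order[OF xc(1)] p by (simp add: Coset.order_def)
  then obtain j where j: "ord x = p ^ j" using divides_primepow_nat[OF p(1)] by blast
  have "j \<noteq> 0" using j x ord_eq_1[OF xc(1)] by (metis power_0)
  then obtain i where i: "j = Suc i" by (cases j) auto
  \<comment> \<open>Since \<open>x\<close> has order \<open>p ^ Suc i\<close>, this power of it has
    order \<open>p\<close>.\<close>
  define y where "y = x [^] (p ^ i)"
  have yp: "y [^] p = \<one>" using xc j i pow_ord_eq_1[OF xc(1)] by (simp add: y_def nat_pow_pow mult.commute)
  have y1: "y \<noteq> \<one>"
  proof
    assume "y = \<one>"
    hence "p ^ j dvd p ^ i" using pow_eq_id[OF xc(1)] j by (simp add: y_def)
    thus False using i p(1) prime_gt_1_nat[OF p(1)] by (simp add: power_dvd_imp_le)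
  qed
  have yc: "y \<in> carrier G" using xc by (simp add: y_def)
  have yM: "y \<in> M" unfolding y_def by (rule subgroup_nat_pow_closed[OF normal_imp_subgroup[OF Mn(1)] x(1)])
  have yZ: "y \<in> group_center G" using yM M by blast
  have "M \<subseteq> generate G {y}"
    using M(1) central_generate_normal(1)[OF yZ] y1 generate.incl[of y "{y}" G] unfolding monolithic_def by blast
  moreover have "card (generate G {y}) = ord y" using generate_pow_card[OF yc] by simp
  moreover have "ord y \<le> p" using ord_dvd_group_order yp pow_eq_id[OF yc, of p] p(1)
    by (auto intro: dvd_imp_le prime_gt_0_nat)
  moreover have "finite (generate G {y})"
    using fin finite_subset generate_incl yc by (metis bot_least insert_subset)
  ultimately have "card M \<le> p" by (metis card_mono le_trans)
  moreover have "p * card {\<one>} \<le> card M"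
    using proper_subgroup_card[OF p triv_subgroup normal_imp_subgroup[OF Mn(1)]] M1 Mn(2) by blast
  ultimately show ?thesis by simp
qed

text \<open>A nontrivial next term would contain the monolith, against strict descent. So a
  monolithic term of the series is its last nontrivial one, hence central of order
  \<open>p\<close>.\<close>

lemma (in group) monolithic_lower_central:
  assumes p: "prime p" "card (carrier G) = p ^ n"
    and M: "monolithic G (lower_central G i)"
  shows "lower_central G (Suc i) = {\<one>}" "lower_central G i \<subseteq> group_center G" "card (lower_central G i) = p"
proof -
  have ne: "lower_central G i \<noteq> {\<one>}" using M by (simp add: monolithic_def)
  show *: "lower_central G (Suc i) = {\<one>}"
  proof (rule ccontr)
    assume "lower_central G (Suc i) \<noteq> {\<one>}"
    hence "lower_central G i \<subseteq> lower_central G (Suc i)"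
      using M lower_central_normal unfolding monolithic_def by blast
    thus False using lower_central_strict[OF p ne] by blast
  qed
  thus "lower_central G i \<subseteq> group_center G" by (simp add: lower_central_Suc_trivial_iff)
  from monolith_card[OF p M this] show "card (lower_central G i) = p" .
qed

lemma (in group) pow_card_subgroup:
  assumes K: "subgroup K G" "k \<in> K"
  shows "k [^] card K = \<one>"
proof -
  interpret K: group "G\<lparr>carrier := K\<rparr>" by (rule subgroup_imp_group[OF K(1)])
  have "k [^]\<^bsub>G\<lparr>carrier := K\<rparr>\<^esub> card K = \<one>"
    using K.pow_order_eq_1[of k] K(2) by (simp add: Coset.order_def)
  thus ?thesis by (simp add: nat_pow_consistent[symmetric])
qed

lemma (in normal) card_image_FactGroup:
  assumes fin: "finite (carrier G)" and K: "subgroup K G" "H \<subseteq> K"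
  shows "card ((\<lambda>x. H #> x) ` K) * card H = card K"
proof -
  have "{g \<in> carrier G. H #> g \<in> (\<lambda>x. H #> x) ` K} = K"
  proof
    show "{g \<in> carrier G. H #> g \<in> (\<lambda>x. H #> x) ` K} \<subseteq> K"
    proof
      fix g assume "g \<in> {g \<in> carrier G. H #> g \<in> (\<lambda>x. H #> x) ` K}"
      then obtain x where x: "g \<in> carrier G" "x \<in> K" "H #> g = H #> x" by blast
      hence "g \<in> H #> x" using rcos_self[OF x(1) is_subgroup] by simp
      then obtain h where "h \<in> H" "g = h \<otimes> x" by (auto simp: r_coset_def)
      thus "g \<in> K" using K x by (auto intro: subgroup.m_closed)
    qed
    show "K \<subseteq> {g \<in> carrier G. H #> g \<in> (\<lambda>x. H #> x) ` K}" using subgroup.subset[OF K(1)] by blast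
  qed
  moreover have "(\<lambda>x. H #> x) ` K \<subseteq> carrier (G Mod H)"
    using subgroup.subset[OF K(1)] by (auto simp: carrier_FactGroup)
  ultimately show ?thesis using card_preimage_FactGroup[OF fin] by metis
qed

lemma (in normal) card_image_FactGroup_ge:
  assumes fin: "finite (carrier G)" and K: "K \<subseteq> carrier G"
  shows "card K \<le> card ((\<lambda>x. H #> x) ` K) * card H"
proof -
  have sub: "(\<lambda>x. H #> x) ` K \<subseteq> carrier (G Mod H)" using K by (auto simp: carrier_FactGroup)
  have "card K \<le> card {g \<in> carrier G. H #> g \<in> (\<lambda>x. H #> x) ` K}"
    by (rule card_mono) (use fin K in auto)
  thus ?thesis using card_preimage_FactGroup[OF fin sub] by simp
qed

lemma (in normal) pow_index_in_normal:
  assumes fin: "finite (carrier G)" and K: "subgroup K G" "H \<subseteq> K" "card K = p * card H" and k: "k \<in> K"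
  shows "k [^] p \<in> H"
proof -
  have kc: "k \<in> carrier G" using subgroup.subset[OF K(1)] k by blast
  have hom: "group_hom G (G Mod H) (\<lambda>x. H #> x)"
    by (intro group_hom.intro group_hom_axioms.intro is_group factorgroup_is_group r_coset_hom_Mod)
  interpret Q: group "G Mod H" by (rule factorgroup_is_group)
  have "card H \<noteq> 0" using fin finite_subset[OF subset] subgroup.one_closed[OF is_subgroup] by (metis card_0_eq empty_iff)
  hence "card ((\<lambda>x. H #> x) ` K) = p" using card_image_FactGroup[OF fin K(1,2)] K(3) by simp
  moreover have "subgroup ((\<lambda>x. H #> x) ` K) (G Mod H)"
    by (rule group_hom.subgroup_img_is_subgroup[OF hom K(1)])
  ultimately have "(H #> k) [^]\<^bsub>G Mod H\<^esub> p = H"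
    using Q.pow_card_subgroup[of "(\<lambda>x. H #> x) ` K" "H #> k"] k by simp
  hence "H #> (k [^] p) = H" using FactGroup_pow[OF kc] by simp
  thus ?thesis using rcos_eq_iff kc by simp
qed

lemma (in group) pow_commute_scalar:
  assumes c: "c \<in> group_center G" and wg: "w \<in> carrier G" "g \<in> carrier G" "w \<otimes> g = c \<otimes> (g \<otimes> w)"
  shows "w [^] (i::nat) \<otimes> g = c [^] i \<otimes> (g \<otimes> w [^] i)"
proof (induction i)
  case (Suc i)
  have cc: "c \<in> carrier G" using c by (simp add: group_center_def)
  have ci: "c [^] i \<in> carrier G" using cc by simp
  have comm: "u \<otimes> c = c \<otimes> u" if "u \<in> carrier G" for u using c that by (simp add: group_center_def)
  have "w [^] Suc i \<otimes> g = w [^] i \<otimes> (c \<otimes> (g \<otimes> w))" using wg by (simp add: m_assoc)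
  also have "\<dots> = c \<otimes> (w [^] i \<otimes> g) \<otimes> w" using wg cc comm[of "w [^] i"] by (simp add: m_assoc[symmetric])
  also have "\<dots> = (c \<otimes> c [^] i) \<otimes> (g \<otimes> (w [^] i \<otimes> w))" unfolding Suc using wg cc ci by (simp add: m_assoc)
  also have "c \<otimes> c [^] i = c [^] Suc i" using comm[OF ci] by simp
  finally show ?case by simp
qed (use wg in simp)

text \<open>A central \<open>y\<close> outside \<open>M\<close> cannot satisfy
  \<open>y [^] p = \<one>\<close>: it would generate a normal subgroup of order at most
  \<open>p\<close> containing \<open>M\<close>, hence \<open>M\<close> itself. So the subgroup
  generated by \<open>y [^] p\<close> contains \<open>M\<close>, and each of its elements is a
  \<open>p\<close>-th power of a power of \<open>y\<close>.\<close>

lemma (in group) monolith_root: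
  assumes p: "prime p" "card (carrier G) = p ^ n"
    and M: "monolithic G M" "M \<subseteq> group_center G" and Z: "p < card (group_center G)" and s: "s \<in> M"
  shows "\<exists>w \<in> group_center G. w [^] p = s"
proof -
  have fin: "finite (carrier G)" using p by (metis card.infinite power_eq_0_iff not_prime_0)
  have Mn: "M \<lhd> G" using M by (auto simp: monolithic_def)
  have M1: "\<one> \<in> M" using subgroup.one_closed[OF normal_imp_subgroup[OF Mn]] .
  have Mp: "card M = p" by (rule monolith_card[OF p M])
  have "\<not> group_center G \<subseteq> M"
    using Mp Z card_mono[of M "group_center G"] finite_subset[OF subgroup.subset[OF normal_imp_subgroup[OF Mn]] fin]
    by linarith
  then obtain y where y: "y \<in> group_center G" "y \<notin> M" by blast
  have yc: "y \<in> carrier G" using y by (simp add: group_center_def)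
  have finK: "finite (generate G {u})" if "u \<in> carrier G" for u
    using fin finite_subset generate_incl that by (metis bot_least insert_subset)
  have "y [^] p \<noteq> \<one>"
  proof
    assume yp: "y [^] p = \<one>"
    have "generate G {y} \<noteq> {\<one>}" using y M1 generate.incl[of y "{y}" G] by auto
    hence "M \<subseteq> generate G {y}" using M(1) central_generate_normal(1)[OF y(1)] unfolding monolithic_def by blast
    moreover have "card (generate G {y}) \<le> p"
      using generate_pow_card[OF yc] yp pow_eq_id[OF yc, of p] p(1) by (auto intro: dvd_imp_le prime_gt_0_nat)
    ultimately have "M = generate G {y}" using Mp finK[OF yc] by (metis card_seteq)
    thus False using y generate.incl[of y "{y}" G] by blast
  qed
  moreover have ypZ: "y [^] p \<in> group_center G"
    by (rule subgroup_nat_pow_closed[OF group_center_subgroup y(1)])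
  ultimately have "M \<subseteq> generate G {y [^] p}"
    using M(1) central_generate_normal(1)[OF ypZ] generate.incl[of "y [^] p" "{y [^] p}" G]
    unfolding monolithic_def by blast
  hence "s \<in> generate G {y [^] p}" using s by blast
  then obtain j :: nat where "s = (y [^] p) [^] j"
    using generate_pow_on_finite_carrier[OF fin, of "y [^] p"] yc by auto
  hence "(y [^] j) [^] p = s" using yc by (simp add: nat_pow_pow mult.commute)
  moreover have "y [^] j \<in> group_center G"
    by (rule subgroup_nat_pow_closed[OF group_center_subgroup y(1)])
  ultimately show ?thesis by blast
qed

text \<open>If \<open>w\<close> is a central \<open>p\<close>-th root of \<open>s\<close> modulo \<open>N\<close>, then \<open>[w, g] \<in> N\<close> is central of exponent \<open>p\<close>
  modulo \<open>N'\<close>, so \<open>w^p\<close>, and with it \<open>s\<close>, is central modulo \<open>N'\<close>.\<close>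

lemma (in group) large_center_monolith_central:
  assumes p: "prime p" "card (carrier G) = p ^ n" and N: "N \<lhd> G" and N': "N' \<lhd> G"
    and comm: "\<And>k g. k \<in> N \<Longrightarrow> g \<in> carrier G \<Longrightarrow> commutator G k g \<in> N'"
    and pow: "\<And>k. k \<in> N \<Longrightarrow> k [^] p \<in> N'"
    and M: "monolithic (G Mod N) M" "M \<subseteq> group_center (G Mod N)"
    and Z: "p < card (group_center (G Mod N))"
    and s: "s \<in> carrier G" "N #> s \<in> M" and g: "g \<in> carrier G"
  shows "commutator G s g \<in> N'"
proof -
  have fin: "finite (carrier G)" using p by (metis card.infinite power_eq_0_iff not_prime_0)
  interpret N: normal N G by (rule N)
  interpret N': normal N' G by (rule N')
  interpret Q: group "G Mod N" by (rule N.factorgroup_is_group)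
  interpret R: group "G Mod N'" by (rule N'.factorgroup_is_group)
  obtain m where m: "card (carrier (G Mod N)) = p ^ m"
    using N.card_FactGroup[OF fin] p divides_primepow_nat[OF p(1)] by (metis dvd_triv_left)
  obtain W where W: "W \<in> group_center (G Mod N)" "W [^]\<^bsub>G Mod N\<^esub> p = N #> s"
    using Q.monolith_root[OF p(1) m M Z s(2)] by blast
  then obtain w where w: "w \<in> carrier G" "W = N #> w" by (auto simp: group_center_def carrier_FactGroup)
  have wN: "commutator G w h \<in> N" if "h \<in> carrier G" for h
    using N.center_FactGroup_iff[OF w(1)] W(1) w(2) that by simp
  have "N #> (w [^] p) = N #> s" using W(2) w N.FactGroup_pow[OF w(1), of p] by simp
  hence "s \<in> N #> (w [^] p)" using rcos_self[OF s(1) N.is_subgroup] by simp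
  \<comment> \<open>It suffices to treat the factors separately: \<open>k\<close> is central modulo
    \<open>N'\<close> by hypothesis, and \<open>w [^] p\<close> is the subject of the main
    computation.\<close>
  then obtain k where k: "k \<in> N" "s = k \<otimes> w [^] p" by (auto simp: r_coset_def)
  have kc: "k \<in> carrier G" using k N.subset by blast
  have Nc: "N' #> k \<in> group_center (G Mod N')" if "k \<in> N" for k
  proof -
    have "k \<in> carrier G" using that N.subset by blast
    thus ?thesis using N'.center_FactGroup_iff[of k] comm[OF that] by simp
  qed
  have "N' #> (w [^] p) \<in> group_center (G Mod N')"
    unfolding N'.center_FactGroup_iff[OF nat_pow_closed[OF w(1)]]
  proof
    fix h assume h: "h \<in> carrier G"
    define c where "c = commutator G w h"
    have cN: "c \<in> N" and cc: "c \<in> carrier G" using wN[OF h] w h by (auto simp: c_def)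
    let ?q = "\<lambda>x. N' #> x"
    have q: "?q x \<in> carrier (G Mod N')" if "x \<in> carrier G" for x using that by (auto simp: carrier_FactGroup)
    have mult: "?q (x \<otimes> y) = ?q x \<otimes>\<^bsub>G Mod N'\<^esub> ?q y" if "x \<in> carrier G" "y \<in> carrier G" for x y
      using N'.rcos_sum[OF that] by simp
    have "?q w \<otimes>\<^bsub>G Mod N'\<^esub> ?q h = ?q c \<otimes>\<^bsub>G Mod N'\<^esub> (?q h \<otimes>\<^bsub>G Mod N'\<^esub> ?q w)"
      using commutator_swap[OF w(1) h] w h cc by (simp only: mult[symmetric] m_closed c_def)
    from R.pow_commute_scalar[OF Nc[OF cN] q[OF w(1)] q[OF h] this, of p]
    have "?q (w [^] p) \<otimes>\<^bsub>G Mod N'\<^esub> ?q h = ?q (c [^] p) \<otimes>\<^bsub>G Mod N'\<^esub> (?q h \<otimes>\<^bsub>G Mod N'\<^esub> ?q (w [^] p))"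
      by (simp only: N'.FactGroup_pow[OF w(1)] N'.FactGroup_pow[OF cc])
    moreover have "?q (c [^] p) = \<one>\<^bsub>G Mod N'\<^esub>" using pow[OF cN] N'.rcos_eq_iff[of "c [^] p"] cc by simp
    ultimately have "commutator (G Mod N') (?q (w [^] p)) (?q h) = \<one>\<^bsub>G Mod N'\<^esub>"
      using R.commutator_eq_one_iff[OF q[OF nat_pow_closed[OF w(1)]] q[OF h]] q w h by (metis R.l_one R.m_closed nat_pow_closed)
    moreover have hom: "group_hom G (G Mod N') (\<lambda>x. N' #> x)"
      by (intro group_hom.intro group_hom_axioms.intro is_group N'.factorgroup_is_group N'.r_coset_hom_Mod)
    moreover have "?q (commutator G (w [^] p) h) = commutator (G Mod N') (?q (w [^] p)) (?q h)"
      unfolding commutator_def using w h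
      by (simp add: group_hom.hom_mult[OF hom] group_hom.hom_inv[OF hom] del: mult_FactGroup)
    ultimately have "N' #> (commutator G (w [^] p) h) = N'" by simp
    thus "commutator G (w [^] p) h \<in> N'" using N'.rcos_eq_iff w h by simp
  qed
  hence "(N' #> k) \<otimes>\<^bsub>G Mod N'\<^esub> (N' #> (w [^] p)) \<in> group_center (G Mod N')"
    using Nc[OF k(1)] by (rule subgroup.m_closed[OF R.group_center_subgroup, rotated])
  hence "N' #> s \<in> group_center (G Mod N')" using k(2) N'.rcos_sum[OF kc nat_pow_closed[OF w(1)]] by simp
  thus ?thesis using N'.center_FactGroup_iff[OF s(1)] g by simp
qed

section \<open>Faithful characters of degree p\<close>

lemma (in group) group_center_subset_centralizer:
  "x \<in> carrier G \<Longrightarrow> group_center G \<subseteq> centralizer G x"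
  by (auto simp: group_center_def centralizer_def)

text \<open>Fix \<open>t\<close> outside the centralizer \<open>C\<close> of \<open>x\<close>.
  Elements of \<open>C\<close> commuting with \<open>t\<close> are central, so on \<open>C\<close>
  the fibres of \<open>\<lambda>c. commutator G c t\<close> lie in cosets of the centre, and the
  values lie in the derived subgroup.\<close>

lemma (in group) card_le_of_abelian_centralizer:
  assumes p: "prime p" "card (carrier G) = p ^ n"
    and x: "x \<in> carrier G" "x \<notin> group_center G"
    and index: "card (carrier G) \<le> p * card (centralizer G x)"
    and abelian: "\<And>c d. c \<in> centralizer G x \<Longrightarrow> d \<in> centralizer G x \<Longrightarrow> c \<otimes> d = d \<otimes> c"
  shows "card (carrier G) \<le> p * (card (lower_central G 1) * card (group_center G))"
proof -
  have fin: "finite (carrier G)" using p by (metis card.infinite power_eq_0_iff not_prime_0)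
  define C where "C = centralizer G x"
  have C: "subgroup C G" unfolding C_def by (rule centralizer_subgroup[OF x(1)])
  have Cc: "C \<subseteq> carrier G" by (rule subgroup.subset[OF C])
  obtain t where t: "t \<in> carrier G" "t \<notin> C"
    using x by (auto simp: C_def centralizer_def group_center_def)
  have central: "z \<in> group_center G" if z: "z \<in> C" "z \<otimes> t = t \<otimes> z" for z
  proof -
    have zc: "z \<in> carrier G" using z Cc by blast
    \<comment> \<open>The centralizer of \<open>z\<close> contains the abelian group
      \<open>C\<close> and also \<open>t\<close>. As \<open>C\<close> has index at most
      \<open>p\<close>, nothing remains between it and the whole group.\<close>
    have "C \<subset> centralizer G z"
      using abelian z t Cc by (auto simp: centralizer_def C_def)
    from proper_subgroup_card[OF p C centralizer_subgroup[OF zc] this] index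
    have "card (carrier G) \<le> card (centralizer G z)" by (simp add: C_def)
    hence "centralizer G z = carrier G"
      using fin subgroup.subset[OF centralizer_subgroup[OF zc]] by (metis card_seteq)
    thus ?thesis using zc by (auto simp: centralizer_def group_center_def)
  qed
  have finC: "finite C" using Cc fin finite_subset by blast
  have "card C \<le> card ((\<lambda>c. commutator G c t) ` C) * card (group_center G)"
  proof (rule card_le_fibers[OF finC])
    fix a assume a: "a \<in> C"
    have "{c \<in> C. commutator G c t = commutator G a t} \<subseteq> (\<lambda>z. a \<otimes> z) ` group_center G"
    proof
      fix c assume "c \<in> {c \<in> C. commutator G c t = commutator G a t}"
      hence c: "c \<in> C" "commutator G c t = commutator G a t" by auto
      have cc: "a \<in> carrier G" "c \<in> carrier G" using a c Cc by auto
      have "inv a \<otimes> c \<in> C" using C a c by (simp add: subgroup.m_closed subgroup.m_inv_closed)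
      moreover have "(inv a \<otimes> c) \<otimes> t = t \<otimes> (inv a \<otimes> c)" using commutator_eq_iff[OF t(1) cc(2,1)] c(2) by simp
      ultimately have "inv a \<otimes> c \<in> group_center G" by (rule central)
      moreover have "c = a \<otimes> (inv a \<otimes> c)" using cc by (simp add: m_assoc[symmetric])
      ultimately show "c \<in> (\<lambda>z. a \<otimes> z) ` group_center G" by blast
    qed
    moreover have "finite (group_center G)" using fin by (simp add: group_center_def)
    ultimately show "card {c \<in> C. commutator G c t = commutator G a t} \<le> card (group_center G)"
      by (metis card_image_le card_mono finite_imageI le_trans)
  qed
  also have "\<dots> \<le> card (lower_central G 1) * card (group_center G)"
  proof (rule mult_le_mono1, rule card_mono)
    show "finite (lower_central G 1)" using finite_subset[OF lower_central_subset fin] .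
    have "commutator G c t \<in> lower_central G (Suc 0)" if "c \<in> C" for c
      by (rule lower_central_commutator) (use that Cc t in auto)
    thus "(\<lambda>c. commutator G c t) ` C \<subseteq> lower_central G 1" by auto
  qed
  finally have "card C \<le> card (lower_central G 1) * card (group_center G)" .
  from le_trans[OF index[folded C_def] mult_le_mono2[OF this]] show ?thesis .
qed

text \<open>If \<open>t\<close> does not commute with \<open>x\<close>, then \<open>\<rho> t\<close> multiplies the eigenvalues of \<open>\<rho> x\<close> by a primitive
  \<open>p\<close>-th root of unity. In degree \<open>p\<close> they are therefore distinct, and the centralizer of \<open>x\<close> is abelian.\<close>

lemma (in group) card_le_of_faithful_degree_prime:
  assumes p: "prime p" "card (carrier G) = p ^ n"
    and irr: "irreducible_rep G p \<rho>"
    and faithful: "\<And>g. g \<in> carrier G \<Longrightarrow> \<rho> g = 1\<^sub>m p \<Longrightarrow> g = \<one>"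
    and M: "subgroup M G" "M \<subseteq> group_center G" "card M = p"
    and x: "x \<in> carrier G" "x \<notin> group_center G" "\<And>g. g \<in> carrier G \<Longrightarrow> commutator G g x \<in> M"
  shows "card (carrier G) \<le> p * (card (lower_central G 1) * card (group_center G))"
proof (rule card_le_of_abelian_centralizer[OF p x(1,2)])
  have fin: "finite (carrier G)" using p by (metis card.infinite power_eq_0_iff not_prime_0)
  from irr have rep: "is_rep G p \<rho>" by (simp add: irreducible_rep_def)
  note rc = is_repD(1)[OF rep] and rm = is_repD(3)[OF rep]
  \<comment> \<open>All commutators with \<open>x\<close> lie in \<open>M\<close>, which has order
    \<open>p\<close>; this bounds the index of the centralizer.\<close>
  have "card ((\<lambda>g. commutator G g x) ` carrier G) \<le> p"
    unfolding M(3)[symmetric] by (rule card_mono) (use x fin finite_subset[OF subgroup.subset[OF M(1)]] in auto)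
  thus "card (carrier G) \<le> p * card (centralizer G x)"
    using card_commutators_centralizer[OF fin x(1)] by simp
  obtain t where t: "t \<in> carrier G" "t \<otimes> x \<noteq> x \<otimes> t" using x by (auto simp: group_center_def)
  define z where "z = commutator G x t"
  have zM: "z \<in> M"
    using subgroup.m_inv_closed[OF M(1) x(3)[OF t(1)]] commutator_inv[OF t(1) x(1)] by (simp add: z_def)
  have zc: "z \<in> carrier G" and zZ: "z \<in> group_center G" using zM M by (auto simp: group_center_def)
  have z1: "z \<noteq> \<one>" using commutator_eq_one_iff[OF x(1) t(1)] t by (simp add: z_def)
  have xt: "x \<otimes> t = t \<otimes> x \<otimes> z"
  proof -
    have "x \<otimes> t = z \<otimes> (t \<otimes> x)" unfolding z_def by (rule commutator_swap[OF x(1) t(1)])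
    also have "\<dots> = t \<otimes> x \<otimes> z" using zZ t x by (simp add: group_center_def)
    finally show ?thesis .
  qed
  have zcomm: "\<rho> g * \<rho> z = \<rho> z * \<rho> g" if "g \<in> carrier G" for g
  proof -
    have "g \<otimes> z = z \<otimes> g" using zZ that by (simp add: group_center_def)
    thus ?thesis using rm[OF that zc] rm[OF zc that] by simp
  qed
  obtain \<zeta> where \<zeta>: "\<rho> z = \<zeta> \<cdot>\<^sub>m 1\<^sub>m p" by (rule schur_scalar[OF irr rc[OF zc] zcomm])
  have p0: "0 < p" using p(1) by (rule prime_gt_0_nat)
  have one: "1 \<cdot>\<^sub>m 1\<^sub>m p = (1\<^sub>m p :: complex mat)" by (rule eq_matI) auto
  have pow: "(\<zeta> \<cdot>\<^sub>m 1\<^sub>m p) ^\<^sub>m k = (\<zeta> ^ k) \<cdot>\<^sub>m (1\<^sub>m p :: complex mat)" for k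
  proof (induction k)
    case (Suc k)
    have "(\<zeta> \<cdot>\<^sub>m 1\<^sub>m p) ^\<^sub>m Suc k = (\<zeta> ^ k \<cdot>\<^sub>m 1\<^sub>m p) * (\<zeta> \<cdot>\<^sub>m (1\<^sub>m p :: complex mat))" using Suc by simp
    also have "\<dots> = \<zeta> ^ Suc k \<cdot>\<^sub>m 1\<^sub>m p" by (rule eq_matI) auto
    finally show ?case .
  qed (simp add: one)
  \<comment> \<open>The order of \<open>M\<close> gives \<open>\<zeta> ^ p = 1\<close>, and
    faithfulness gives \<open>\<zeta> \<noteq> 1\<close> because \<open>z\<close> is not the
    identity.\<close>
  have "\<rho> (z [^] p) = 1\<^sub>m p" using pow_card_subgroup[OF M(1) zM] is_repD(2)[OF rep] M(3) by simp
  hence "(\<zeta> ^ p) \<cdot>\<^sub>m (1\<^sub>m p :: complex mat) = 1\<^sub>m p" using rep_pow[OF rep zc, of p] \<zeta> pow by simp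
  from arg_cong[OF this, of "\<lambda>A. A $$ (0, 0)"] have "\<zeta> ^ p = 1" using p0 by simp
  moreover have "\<zeta> \<noteq> 1"
  proof
    assume "\<zeta> = 1"
    hence "\<rho> z = 1\<^sub>m p" using \<zeta> by (simp add: one)
    thus False using faithful[OF zc] z1 by blast
  qed
  ultimately have inj: "inj_on (\<lambda>i. \<zeta> ^ i) {..<p}" by (rule root_of_unity_powers_inj[OF p(1)])
  fix c d assume "c \<in> centralizer G x" "d \<in> centralizer G x"
  hence cd: "c \<in> carrier G" "d \<in> carrier G" "c \<otimes> x = x \<otimes> c" "d \<otimes> x = x \<otimes> d"
    by (auto simp: centralizer_def)
  have "\<rho> c * \<rho> d = \<rho> d * \<rho> c" by (rule rep_commute_of_root[OF rep p0 x(1) t(1) zc xt \<zeta> inj cd])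
  hence eq: "\<rho> (c \<otimes> d) = \<rho> (d \<otimes> c)" using rm[OF cd(1,2)] rm[OF cd(2,1)] by simp
  have "\<rho> (inv (d \<otimes> c) \<otimes> (c \<otimes> d)) = \<rho> (inv (d \<otimes> c)) * \<rho> (d \<otimes> c)"
    using rm[of "inv (d \<otimes> c)" "c \<otimes> d"] cd eq by simp
  also have "\<dots> = 1\<^sub>m p" by (rule rep_inverse[OF rep]) (use cd in simp)
  finally have "inv (d \<otimes> c) \<otimes> (c \<otimes> d) = \<one>" by (rule faithful[rotated]) (use cd in simp)
  hence "c \<otimes> d = d \<otimes> c \<otimes> \<one>" using cd by (metis inv_closed inv_solve_left m_closed one_closed)
  thus "c \<otimes> d = d \<otimes> c" using cd by simp
qed

text \<open>Everything needed from one faithful irreducible character: \<open>p^v\<close> is its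
  codegree and \<open>p^e\<close> its degree. The inequality \<open>2 * e + 1 \<le> m\<close> is
  \<open>degree_square_le\<close> with a centre of order at least \<open>p\<close>. The clause for
  \<open>e = 1\<close> belongs to the same statement since it speaks of the same character.\<close>

lemma (in group) monolithic_codegree:
  assumes p: "prime p" "card (carrier G) = p ^ m"
    and M: "monolithic G M" "M \<subseteq> group_center G"
    and cod: "codegrees G \<subseteq> {1, of_nat p, of_nat p ^ b, of_nat p ^ a}"
    and nonabelian: "group_center G \<noteq> carrier G"
  shows "\<exists>v e. v \<in> {0, 1, b, a} \<and> m = v + e \<and> 2 * e + 1 \<le> m \<and> 1 \<le> e \<and>
    (e = 1 \<longrightarrow> (\<forall>x\<in>carrier G. x \<notin> group_center G \<longrightarrow> (\<forall>g\<in>carrier G. commutator G g x \<in> M) \<longrightarrow>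
      p ^ m \<le> p * (card (lower_central G 1) * card (group_center G))))"
proof -
  have fin: "finite (carrier G)" using p by (metis card.infinite power_eq_0_iff not_prime_0)
  have p1: "1 < p" using p(1) by (rule prime_gt_1_nat)
  have Mp: "card M = p" by (rule monolith_card[OF p M])
  have Ms: "subgroup M G" using M by (auto simp: monolithic_def dest: normal_imp_subgroup)
  obtain n \<rho> where irr: "irreducible_rep G n \<rho>"
    and faithful: "\<And>g. g \<in> carrier G \<Longrightarrow> \<rho> g = 1\<^sub>m n \<Longrightarrow> g = \<one>"
    using monolithic_faithful_rep[OF fin M] by blast
  from irr have rep: "is_rep G n \<rho>" and n: "n > 0" by (auto simp: irreducible_rep_def)
  note rc = is_repD(1)[OF rep] and rm = is_repD(3)[OF rep]
  have "of_nat (p ^ m) / of_nat n \<in> {1, of_nat p, of_nat p ^ b, of_nat p ^ a :: complex}"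
    using faithful_codegree[OF irr fin faithful] cod p(2) by auto
  hence "\<exists>v \<in> {0, 1, b, a}. of_nat (p ^ m) / of_nat n = (of_nat (p ^ v) :: complex)"
    by auto
  then obtain v where v: "v \<in> {0, 1, b, a}" "of_nat (p ^ m) / of_nat n = (of_nat (p ^ v) :: complex)" by blast
  have "(of_nat (p ^ m) :: complex) = of_nat (p ^ v * n)" using v(2) n by (simp add: field_simps)
  hence pm: "p ^ m = p ^ v * n" by (rule of_nat_eq_iff[THEN iffD1])
  then obtain e where e: "n = p ^ e" using divides_primepow_nat[OF p(1), of n m] by (metis dvd_triv_right)
  have m: "m = v + e"
    using pm p1 unfolding e power_add[symmetric] by (metis power_inject_exp)
  have "p \<le> card (group_center G)"
    unfolding Mp[symmetric] using M(2) fin by (intro card_mono) (auto simp: group_center_def)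
  hence "n\<^sup>2 * p \<le> p ^ m" using degree_square_le[OF irr fin] p(2) by (metis le_trans mult_le_mono2)
  moreover have "n\<^sup>2 * p = p ^ (2 * e + 1)" by (simp add: e power_mult[symmetric] mult.commute)
  ultimately have e2: "2 * e + 1 \<le> m" using p1 by (metis power_le_imp_le_exp)
  have "e \<noteq> 0"
  proof
    assume "e = 0"
    hence n1: "n = 1" using e by simp
    \<comment> \<open>Matrices of size 1 commute, so a faithful character of degree 1 would make the
      group abelian.\<close>
    have "g \<otimes> h = h \<otimes> g" if gh: "g \<in> carrier G" "h \<in> carrier G" for g h
    proof -
      have "\<rho> g * \<rho> h = \<rho> h * \<rho> g"
        using rc[OF gh(1)] rc[OF gh(2)] n1 by (intro eq_matI) (auto simp: scalar_prod_def)
      hence eq: "\<rho> (g \<otimes> h) = \<rho> (h \<otimes> g)" using rm[OF gh] rm[OF gh(2,1)] by simp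
      have "\<rho> (inv (h \<otimes> g) \<otimes> (g \<otimes> h)) = \<rho> (inv (h \<otimes> g)) * \<rho> (h \<otimes> g)"
        using rm[of "inv (h \<otimes> g)" "g \<otimes> h"] gh eq by simp
      also have "\<dots> = 1\<^sub>m n" by (rule rep_inverse[OF rep]) (use gh in simp)
      finally have "inv (h \<otimes> g) \<otimes> (g \<otimes> h) = \<one>" by (rule faithful[rotated]) (use gh in simp)
      hence "g \<otimes> h = h \<otimes> g \<otimes> \<one>" using gh by (metis inv_closed inv_solve_left m_closed one_closed)
      thus ?thesis using gh by simp
    qed
    thus False using nonabelian by (auto simp: group_center_def)
  qed
  moreover have "p ^ m \<le> p * (card (lower_central G 1) * card (group_center G))"
    if e1: "e = 1" and x: "x \<in> carrier G" "x \<notin> group_center G" "\<forall>g\<in>carrier G. commutator G g x \<in> M" for x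
  proof -
    have np: "n = p" using e e1 by simp
    show ?thesis
      unfolding p(2)[symmetric]
      by (rule card_le_of_faithful_degree_prime[OF p irr[unfolded np] _ Ms M(2) Mp x(1,2)])
        (use faithful np x(3) in auto)
  qed
  ultimately show ?thesis using v(1) m e2 by (intro exI[of _ v] exI[of _ e]) auto
qed

section \<open>Groups of class two and small abelianizations\<close>

lemma (in group) commutator_mult_left:
  assumes "a \<in> carrier G" "b \<in> carrier G" "h \<in> carrier G" "commutator G b h \<in> group_center G"
  shows "commutator G (a \<otimes> b) h = commutator G a h \<otimes> commutator G b h"
proof -
  have bh: "b \<otimes> h = h \<otimes> (b \<otimes> commutator G b h)"
  proof -
    have "b \<otimes> h = commutator G b h \<otimes> (h \<otimes> b)" by (rule commutator_swap[OF assms(2,3)])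
    also have "\<dots> = (h \<otimes> b) \<otimes> commutator G b h" using assms by (simp add: group_center_def)
    finally show ?thesis using assms by (simp add: m_assoc)
  qed
  define c where "c = commutator G b h"
  have c: "c \<in> carrier G" "\<And>g. g \<in> carrier G \<Longrightarrow> g \<otimes> c = c \<otimes> g"
    using assms by (auto simp: c_def group_center_def)
  have "a \<otimes> b \<otimes> h = a \<otimes> (h \<otimes> (b \<otimes> c))"
    unfolding c_def bh[symmetric] using assms(1-3) by (rule m_assoc)
  also have "\<dots> = a \<otimes> h \<otimes> b \<otimes> c" using assms(1-3) c(1) by (simp add: m_assoc)
  also have "\<dots> = c \<otimes> (a \<otimes> h \<otimes> b)" using assms c(2)[of "a \<otimes> h \<otimes> b"] by simp
  finally have "commutator G (a \<otimes> b) h = c \<otimes> (a \<otimes> h \<otimes> b) \<otimes> inv (a \<otimes> b) \<otimes> inv h"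
    unfolding commutator_def by simp
  also have "\<dots> = c \<otimes> commutator G a h"
  proof -
    have "b \<otimes> (inv b \<otimes> u) = u" if "u \<in> carrier G" for u using that assms by (simp add: m_assoc[symmetric])
    thus ?thesis using assms c by (simp add: commutator_def inv_mult_group m_assoc)
  qed
  also have "\<dots> = commutator G a h \<otimes> c" using c(2)[of "commutator G a h"] assms by simp
  finally show ?thesis by (simp add: c_def)
qed

text \<open>For a noncentral \<open>x\<close>, the subgroup \<open>B = [G, x]\<close> has order at most \<open>p\<close>, and
  \<open>G/B\<close> is abelian because its centre has index at most \<open>p\<close>.\<close>

lemma (in group) card_derived_le_prime:
  assumes p: "prime p" "card (carrier G) = p ^ n"
    and class2: "lower_central G 1 \<subseteq> group_center G"
    and index: "card (carrier G) \<le> p\<^sup>2 * card (group_center G)"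
  shows "card (lower_central G 1) \<le> p"
proof (cases "group_center G = carrier G")
  case True
  hence "lower_central G 0 \<subseteq> group_center G" by simp
  hence "lower_central G 1 = {\<one>}" using lower_central_Suc_trivial_iff[of 0] by simp
  thus ?thesis using prime_gt_0_nat[OF p(1)] by simp
next
  case False
  have fin: "finite (carrier G)" using p by (metis card.infinite power_eq_0_iff not_prime_0)
  have cZ: "commutator G g h \<in> group_center G" if "g \<in> carrier G" "h \<in> carrier G" for g h
    using lower_central_commutator[of g 0 h] that class2 by auto
  have bil: "commutator G (a \<otimes> b) h = commutator G a h \<otimes> commutator G b h"
    if "a \<in> carrier G" "b \<in> carrier G" "h \<in> carrier G" for a b h
    by (rule commutator_mult_left) (use that cZ in auto)
  have comm1: "commutator G \<one> h = \<one>" if "h \<in> carrier G" for h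
    using commutator_eq_one_iff[OF one_closed that] that by simp
  have comm_inv: "commutator G (inv a) h = inv (commutator G a h)" if "a \<in> carrier G" "h \<in> carrier G" for a h
  proof -
    have "commutator G (inv a) h \<otimes> commutator G a h = \<one>" using bil[of "inv a" a h] that comm1 by simp
    thus ?thesis using that by (metis commutator_closed inv_closed inv_equality)
  qed
  obtain x where x: "x \<in> carrier G" "x \<notin> group_center G" using False by (auto simp: group_center_def)
  \<comment> \<open>In class 2 the map \<open>\<lambda>g. commutator G g x\<close> is a
    homomorphism, so its image is a subgroup.\<close>
  define B where "B = (\<lambda>g. commutator G g x) ` carrier G"
  have B: "subgroup B G"
  proof (rule subgroupI)
    fix a assume "a \<in> B"
    then obtain g where g: "g \<in> carrier G" "a = commutator G g x" by (auto simp: B_def)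
    show "inv a \<in> B" unfolding B_def using g x comm_inv[of g x] by (intro image_eqI[of _ _ "inv g"]) auto
    fix b assume "b \<in> B"
    then obtain h where h: "h \<in> carrier G" "b = commutator G h x" by (auto simp: B_def)
    show "a \<otimes> b \<in> B" unfolding B_def using g h x bil[of g h x] by (intro image_eqI[of _ _ "g \<otimes> h"]) auto
  qed (use x in \<open>auto simp: B_def\<close>)
  have Z0: "card (group_center G) > 0"
    using fin subgroup.one_closed[OF group_center_subgroup] by (auto simp: card_gt_0_iff group_center_def)
  \<comment> \<open>The centralizer contains the centre and \<open>x\<close>, so its index, which is
    \<open>card B\<close>, is at most \<open>p\<close>.\<close>
  have "group_center G \<subset> centralizer G x"
    using group_center_subset_centralizer[OF x(1)] x by (auto simp: centralizer_def)
  from proper_subgroup_card[OF p group_center_subgroup centralizer_subgroup[OF x(1)] this]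
  have "card B * (p * card (group_center G)) \<le> card (carrier G)"
    unfolding card_commutators_centralizer[OF fin x(1)] B_def by simp
  also have "\<dots> \<le> p * (p * card (group_center G))"
    using index by (simp add: power2_eq_square mult.assoc)
  finally have Bp: "card B \<le> p" using Z0 prime_gt_0_nat[OF p(1)] by (metis mult_le_cancel2 nat_0_less_mult_iff)
  \<comment> \<open>The intersection \<open>E\<close> of all \<open>D y\<close> is the preimage of
    the centre of the quotient by \<open>B\<close>. It contains the centre of \<open>G\<close> and
    \<open>x\<close>, hence has index at most \<open>p\<close>.\<close>
  define D where "D y = {g \<in> carrier G. commutator G g y \<in> B}" for y
  have D: "subgroup (D y) G" if y: "y \<in> carrier G" for y
  proof (rule subgroupI)
    show "D y \<noteq> {}" using comm1[OF y] subgroup.one_closed[OF B] by (auto simp: D_def)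
    fix a assume a: "a \<in> D y"
    thus "inv a \<in> D y" using comm_inv[of a y] y subgroup.m_inv_closed[OF B] by (auto simp: D_def)
    fix b assume b: "b \<in> D y"
    show "a \<otimes> b \<in> D y" using a b bil[of a b y] y subgroup.m_closed[OF B] by (auto simp: D_def)
  qed (auto simp: D_def)
  define E where "E = (\<Inter>y\<in>carrier G. D y)"
  have E: "subgroup E G" unfolding E_def by (rule subgroups_Inter) (use D one_closed in auto)
  have "group_center G \<subset> E"
  proof
    show "group_center G \<subseteq> E"
    proof
      fix z assume z: "z \<in> group_center G"
      hence "z \<in> carrier G" "commutator G z y = \<one>" if "y \<in> carrier G" for y
        using commutator_eq_one_iff[of z y] that by (auto simp: group_center_def)
      thus "z \<in> E" using subgroup.one_closed[OF B] by (auto simp: E_def D_def)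
    qed
    have "x \<in> E"
    proof -
      have "commutator G x y \<in> B" if "y \<in> carrier G" for y
        using commutator_inv[OF that x(1)] subgroup.m_inv_closed[OF B, of "commutator G y x"] that by (auto simp: B_def)
      thus ?thesis using x by (auto simp: E_def D_def)
    qed
    thus "group_center G \<noteq> E" using x by blast
  qed
  from proper_subgroup_card[OF p group_center_subgroup E this]
  have pE: "card (carrier G) \<le> p * card E" using index prime_gt_0_nat[OF p(1)]
    by (metis (no_types, opaque_lifting) le_trans mult.assoc mult_le_mono2 power2_eq_square)
  have EG: "y \<in> E" if y: "y \<in> carrier G" for y
  proof (rule ccontr)
    assume yE: "y \<notin> E"
    \<comment> \<open>\<open>D y\<close> contains \<open>E\<close> and \<open>y\<close>, so the
      index bound makes it the whole group; this puts \<open>y\<close> back into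
      \<open>E\<close>.\<close>
    have "E \<subset> D y"
    proof
      show "E \<subseteq> D y" using y by (auto simp: E_def)
      have "commutator G y y = \<one>" using commutator_eq_one_iff[OF y y] by simp
      hence "y \<in> D y" using y subgroup.one_closed[OF B] by (simp add: D_def)
      thus "E \<noteq> D y" using yE by blast
    qed
    from proper_subgroup_card[OF p E D[OF y] this] pE have "card (carrier G) \<le> card (D y)" by simp
    hence Dy: "D y = carrier G" using fin subgroup.subset[OF D[OF y]] by (metis card_seteq)
    have "commutator G y h \<in> B" if h: "h \<in> carrier G" for h
    proof -
      have "commutator G h y \<in> B" using Dy h by (auto simp: D_def)
      thus ?thesis using commutator_inv[OF h y] subgroup.m_inv_closed[OF B] by metis
    qed
    hence "y \<in> E" using y by (auto simp: E_def D_def)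
    thus False using yE by simp
  qed
  have "lower_central G (Suc 0) \<subseteq> B"
    by (rule lower_central_Suc_le[OF B]) (use EG in \<open>auto simp: E_def D_def\<close>)
  moreover have "finite B" using fin by (simp add: B_def)
  ultimately show ?thesis using Bp card_mono[of B "lower_central G 1"] by simp
qed

text \<open>Modulo \<gamma>_3 the derived subgroup is central, so the centre has index at most
  \<open>p^2\<close> and \<open>card_derived_le_prime\<close> bounds |\<gamma>_2/\<gamma>_3| by
  \<open>p\<close>.\<close>

lemma (in group) index_lower_central_two:
  assumes p: "prime p" "card (carrier G) = p ^ n"
    and index: "card (carrier G) \<le> p\<^sup>2 * card (lower_central G 1)"
  shows "card (carrier G) \<le> p ^ 3 * card (lower_central G 2)"
proof -
  have fin: "finite (carrier G)" using p by (metis card.infinite power_eq_0_iff not_prime_0)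
  define N where "N = lower_central G 2"
  interpret N: normal N G unfolding N_def by (rule lower_central_normal)
  interpret Q: group "G Mod N" by (rule N.factorgroup_is_group)
  have N0: "card N > 0" using fin finite_subset[OF N.subset] subgroup.one_closed[OF N.is_subgroup]
    by (metis card_gt_0_iff empty_iff)
  obtain m where m: "card (carrier (G Mod N)) = p ^ m"
    using N.card_FactGroup[OF fin] p divides_primepow_nat[OF p(1)] by (metis dvd_triv_left)
  have cL: "card (lower_central (G Mod N) 1) * card N = card (lower_central G 1)"
    unfolding N.lower_central_FactGroup
    by (rule N.card_image_FactGroup[OF fin])
      (use lower_central_normal normal_imp_subgroup lower_central_antimono[of 1 2] in \<open>auto simp: N_def\<close>)
  have "card (carrier (G Mod N)) * card N \<le> (p\<^sup>2 * card (lower_central (G Mod N) 1)) * card N"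
    using index unfolding N.card_FactGroup[OF fin] mult.assoc cL .
  hence i1: "card (carrier (G Mod N)) \<le> p\<^sup>2 * card (lower_central (G Mod N) 1)" using N0 by simp
  have "lower_central (G Mod N) (Suc 1) = {\<one>\<^bsub>G Mod N\<^esub>}"
    using N.lower_central_FactGroup_trivial_iff[of 2] by (simp add: N_def numeral_2_eq_2)
  hence c2: "lower_central (G Mod N) 1 \<subseteq> group_center (G Mod N)"
    using Q.lower_central_Suc_trivial_iff by blast
  hence "card (lower_central (G Mod N) 1) \<le> card (group_center (G Mod N))"
    using N.finite_FactGroup[OF fin] by (intro card_mono) (auto simp: group_center_def)
  hence "card (carrier (G Mod N)) \<le> p\<^sup>2 * card (group_center (G Mod N))" using i1 by (metis le_trans mult_le_mono2)
  from Q.card_derived_le_prime[OF p(1) m c2 this]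
  have "p\<^sup>2 * card (lower_central (G Mod N) 1) \<le> p\<^sup>2 * p" by (rule mult_le_mono2)
  from le_trans[OF i1 this] have "card (carrier (G Mod N)) \<le> p ^ 3"
    by (simp add: power3_eq_cube power2_eq_square)
  hence "card (carrier (G Mod N)) * card N \<le> p ^ 3 * card N" by (rule mult_le_mono1)
  thus ?thesis unfolding N.card_FactGroup[OF fin] unfolding N_def .
qed

section \<open>The class bound\<close>

text \<open>Here \<open>m, g, k\<close> are the logarithms of the orders of the quotients of class \<open>d + 1\<close>, \<open>3\<close> and \<open>2\<close>,
  \<open>e, e3, e2\<close> those of the degrees of their faithful characters, \<open>v, v3, v2\<close> those of the
  codegrees, and \<open>f1, \<dots>, f4\<close> those of the orders of \<open>\<gamma>_2, \<dots>, \<gamma>_5\<close>.\<close>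

lemma codegree_exponents_contradiction:
  fixes m d f1 f2 f3 f4 e v g e3 v3 k e2 v2 a b :: nat
  assumes "4 \<le> d" "m \<le> d + 4" "d \<le> f4 + 3" "f4 < f3" "f3 < f2" "f2 < f1" "f1 < m"
    and "v \<in> {0, 1, b, a}" "m = v + e" "2 * e + 1 \<le> m"
    and "v3 \<in> {0, 1, b, a}" "g = v3 + e3" "2 * e3 + 1 \<le> g" "1 \<le> e3" "g + f2 \<le> m + 1"
    and "v2 \<in> {0, 1, b, a}" "k = v2 + e2" "2 * e2 + 1 \<le> k" "1 \<le> e2" "k + 1 \<le> g"
    and "2 \<le> b" "b < a"
    and W2: "\<not> (k + 1 = g \<and> 4 \<le> k \<and> e2 = 1)"
    and W3: "\<not> (e3 = 1 \<and> f3 = f4 + 1 \<and> f1 + 3 \<le> m \<and> g + f3 = m)"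
    and D: "m \<le> f1 + 2 \<Longrightarrow> m \<le> f2 + 3"
  shows False
proof -
  \<comment> \<open>From \<open>g + f2 \<le> m + 1\<close>, \<open>m \<le> d + 4\<close> and
    \<open>d \<le> f2 + 1\<close>.\<close>
  have g6: "g \<le> 6" and k5: "k \<le> 5" using assms by linarith+
  \<comment> \<open>\<open>k \<ge> 3\<close> gives \<open>g \<ge> 4\<close>, and
    \<open>f2 \<ge> 3\<close>, so \<open>m \<ge> 6\<close>; the degree is then too small for
    \<open>v \<le> 3\<close>.\<close>
  have v4: "4 \<le> v" and v3_2: "2 \<le> v3" and v2_2: "2 \<le> v2" using assms by linarith+
  \<comment> \<open>With \<open>k \<le> 5\<close>, a larger value needs \<open>k = 5\<close> and
    \<open>e2 = 1\<close>, so \<open>g = 6\<close>, which \<open>W2\<close> forbids.\<close>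
  have v2_3: "v2 \<le> 3" using assms(17-20) W2 g6 k5 by linarith
  have "v2 \<in> {a, b}" "v3 \<in> {a, b}" "v \<in> {a, b}" using assms(8,11,16) v4 v3_2 v2_2 by auto
  hence "v3 = v2 \<or> v3 = v" using v2_3 v4 by auto
  \<comment> \<open>Equality would give \<open>e2 < e3\<close>, and the degree bounds leave only
    \<open>v2 = 3\<close>, \<open>e2 = 1\<close>, \<open>e3 = 2\<close>, that is
    \<open>k = 4\<close> and \<open>g = 5\<close>: again excluded by \<open>W2\<close>.\<close>
  moreover have "v3 \<noteq> v2"
  proof
    assume "v3 = v2"
    thus False using assms(12-14,17-20) W2 v2_3 v2_2 by linarith
  qed
  ultimately have vv: "v3 = v" by blast
  \<comment> \<open>\<open>v3 = v\<close> turns \<open>g + f2 \<le> m + 1\<close> into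
    \<open>e3 + f2 \<le> e + 1\<close>; with \<open>m \<le> f2 + 3\<close> this would imply
    \<open>v \<le> 3\<close>.\<close>
  have f1m: "f1 + 3 \<le> m"
  proof (rule ccontr)
    assume "\<not> f1 + 3 \<le> m"
    hence "m \<le> f2 + 3" using D by simp
    thus False using assms vv by linarith
  qed
  \<comment> \<open>The surviving triples \<open>(v, e, d)\<close> are \<open>(4, 3, 4)\<close>,
    \<open>(5, 3, 4)\<close> and \<open>(5, 4, 5)\<close>, with \<open>f2 = e\<close>,
    \<open>f3 = e - 1\<close> and \<open>f4 = e - 2\<close> in each case.\<close>
  have "e3 = 1" "f3 = f4 + 1" "g + f3 = m" using assms vv by linarith+
  with W3 f1m show False by blast
qed

text \<open>The group has class \<open>d + 1 \<ge> 5\<close>, and \<open>m \<le> d + 4\<close> says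
  that its coclass is at most 3. The proof collects the data of
  \<open>codegree_exponents_contradiction\<close>; \<open>W2\<close> and \<open>W3\<close> are the
  two uses of the centre argument.\<close>

lemma (in group) no_large_class:
  assumes p: "prime p" "card (carrier G) = p ^ m" and d: "4 \<le> d" "m \<le> d + 4"
    and mono: "monolithic G (lower_central G d)"
    and cod: "codegrees G \<subseteq> {1, of_nat p, of_nat p ^ b, of_nat p ^ a}" and ab: "2 \<le> b" "b < a"
  shows False
proof -
  have fin: "finite (carrier G)" using p by (metis card.infinite power_eq_0_iff not_prime_0)
  have p1: "1 < p" using p(1) by (rule prime_gt_1_nat)
  have sub: "subgroup (lower_central G i) G" for i using lower_central_normal normal_imp_subgroup by metis
  have ne: "lower_central G i \<noteq> {\<one>}" if "i \<le> d" for i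
  proof
    assume "lower_central G i = {\<one>}"
    hence "lower_central G d \<subseteq> {\<one>}" using lower_central_antimono[OF that] by simp
    moreover have "\<one> \<in> lower_central G d" by (rule subgroup.one_closed[OF sub])
    ultimately show False using mono by (auto simp: monolithic_def)
  qed
  obtain f where f: "\<And>i. card (lower_central G i) = p ^ f i"
    using subgroup_card_prime_power[OF p sub] by metis
  have f_less: "f (Suc i) < f i" if "i \<le> d" for i
  proof -
    have "p ^ Suc (f (Suc i)) \<le> p ^ f i" using lower_central_card_le[OF p ne[OF that]] f by simp
    hence "Suc (f (Suc i)) \<le> f i" by (rule power_le_imp_le_exp[OF p1])
    thus ?thesis by simp
  qed
  have f0: "f 0 = m" using f[of 0] p(2) p1 by (simp add: power_inject_exp)
  \<comment> \<open>Strict descent counted upwards from the last nontrivial term, whose index is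
    \<open>d\<close>.\<close>
  have f_ge: "j + 1 \<le> f (d - j)" if "j \<le> d" for j
    using that
  proof (induction j)
    case 0 show ?case using f_less[of d] by simp
  next
    case (Suc j)
    hence "f (Suc (d - Suc j)) < f (d - Suc j)" by (intro f_less) simp
    moreover have "Suc (d - Suc j) = d - j" using Suc by simp
    ultimately show ?case using Suc by simp
  qed
  have f4: "d \<le> f 4 + 3" using f_ge[of "d - 4"] d by simp
  have f12: "f 4 < f 3" "f 3 < f 2" "f 2 < f 1" "f 1 < m"
    using f_less[of 3] f_less[of 2] f_less[of 1] f_less[of 0] d f0 by (simp_all add: eval_nat_numeral)
  have nonabelian: "group_center H \<noteq> carrier H" if "group H" "lower_central H 1 \<noteq> {\<one>\<^bsub>H\<^esub>}" for H :: "('h, 'i) monoid_scheme"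
    using group.lower_central_Suc_trivial_iff[OF that(1), of 0] that(2) by auto

  have "lower_central G 1 \<noteq> {\<one>}" using ne[of 1] d by simp
  from monolithic_codegree[OF p mono monolithic_lower_central(2)[OF p mono] cod nonabelian[OF is_group this]]
  obtain v e where v: "v \<in> {0, 1, b, a}" "m = v + e" "2 * e + 1 \<le> m" by blast

  obtain N3 where N3: "N3 \<lhd> G" "monolithic (G Mod N3) (lower_central (G Mod N3) 2)"
    using exists_monolithic_quotient[OF fin ne[of 2]] d by auto
  interpret N3: normal N3 G by (rule N3)
  define \<Gamma> where "\<Gamma> = G Mod N3"
  interpret \<Gamma>: group \<Gamma> unfolding \<Gamma>_def by (rule N3.factorgroup_is_group)
  have fin\<Gamma>: "finite (carrier \<Gamma>)" unfolding \<Gamma>_def by (rule N3.finite_FactGroup[OF fin])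
  have c\<Gamma>: "card (carrier \<Gamma>) * card N3 = p ^ m" using N3.card_FactGroup[OF fin] p by (simp add: \<Gamma>_def)
  then obtain g where g: "card (carrier \<Gamma>) = p ^ g" using divides_primepow_nat[OF p(1)] by (metis dvd_triv_left)
  note mono\<Gamma> = N3(2)[folded \<Gamma>_def]
  note L\<Gamma> = \<Gamma>.monolithic_lower_central[OF p(1) g mono\<Gamma>]
  have L\<Gamma>2: "lower_central \<Gamma> 2 \<noteq> {\<one>\<^bsub>\<Gamma>\<^esub>}" using mono\<Gamma> by (simp add: monolithic_def)
  have L\<Gamma>1: "\<not> lower_central \<Gamma> 1 \<subseteq> group_center \<Gamma>"
    using \<Gamma>.lower_central_Suc_trivial_iff[of 1] L\<Gamma>2 by (simp add: numeral_2_eq_2)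
  have L\<Gamma>1': "lower_central \<Gamma> 1 \<noteq> {\<one>\<^bsub>\<Gamma>\<^esub>}"
    using L\<Gamma>1 subgroup.one_closed[OF \<Gamma>.group_center_subgroup] by auto
  have cod\<Gamma>: "codegrees \<Gamma> \<subseteq> {1, of_nat p, of_nat p ^ b, of_nat p ^ a}"
    using N3.codegrees_FactGroup[OF fin] cod unfolding \<Gamma>_def by blast
  obtain x3 where x3: "x3 \<in> lower_central \<Gamma> 1" "x3 \<notin> group_center \<Gamma>" using L\<Gamma>1 by blast
  have x3c: "x3 \<in> carrier \<Gamma>" using x3 \<Gamma>.lower_central_subset by blast
  have x3M: "commutator \<Gamma> h x3 \<in> lower_central \<Gamma> 2" if h: "h \<in> carrier \<Gamma>" for h
  proof -
    have "commutator \<Gamma> x3 h \<in> lower_central \<Gamma> 2"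
      using \<Gamma>.lower_central_commutator[OF x3(1) h] by (simp add: numeral_2_eq_2)
    thus ?thesis using \<Gamma>.commutator_inv[OF x3c h]
      subgroup.m_inv_closed[OF normal_imp_subgroup[OF \<Gamma>.lower_central_normal]] by metis
  qed
  obtain v3 e3 where v3: "v3 \<in> {0, 1, b, a}" "g = v3 + e3" "2 * e3 + 1 \<le> g" "1 \<le> e3"
    and e3: "e3 = 1 \<Longrightarrow> p ^ g \<le> p * (card (lower_central \<Gamma> 1) * card (group_center \<Gamma>))"
    using \<Gamma>.monolithic_codegree[OF p(1) g mono\<Gamma> L\<Gamma>(2) cod\<Gamma> nonabelian[OF \<Gamma>.is_group L\<Gamma>1']] x3c x3(2) x3M
    by blast
  \<comment> \<open>The image of \<gamma>_3 in \<Gamma> is the monolith, of order \<open>p\<close>,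
    so |\<gamma>_3| is at most \<open>p * card N3\<close>.\<close>
  have gf2: "g + f 2 \<le> m + 1"
  proof -
    have "card (lower_central G 2) \<le> card (lower_central \<Gamma> 2) * card N3"
      unfolding \<Gamma>_def N3.lower_central_FactGroup
      by (rule N3.card_image_FactGroup_ge[OF fin lower_central_subset])
    hence "p ^ g * p ^ f 2 \<le> p ^ g * (p * card N3)" using f L\<Gamma>(3) by simp
    also have "\<dots> = p * p ^ m" using c\<Gamma> g by simp
    finally have "p ^ (g + f 2) \<le> p ^ (m + 1)" by (simp add: power_add)
    thus ?thesis by (rule power_le_imp_le_exp[OF p1])
  qed

  obtain N2 where N2: "N2 \<lhd> \<Gamma>" "monolithic (\<Gamma> Mod N2) (lower_central (\<Gamma> Mod N2) 1)"
    using \<Gamma>.exists_monolithic_quotient[OF fin\<Gamma> L\<Gamma>1'] by blast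
  interpret N2: normal N2 \<Gamma> by (rule N2)
  define Q where "Q = \<Gamma> Mod N2"
  interpret Q: group Q unfolding Q_def by (rule N2.factorgroup_is_group)
  have cQ: "card (carrier Q) * card N2 = p ^ g" using N2.card_FactGroup[OF fin\<Gamma>] g by (simp add: Q_def)
  then obtain k where k: "card (carrier Q) = p ^ k" using divides_primepow_nat[OF p(1)] by (metis dvd_triv_left)
  note monoQ = N2(2)[folded Q_def]
  note LQ = Q.monolithic_lower_central[OF p(1) k monoQ]
  have LQ1: "lower_central Q 1 \<noteq> {\<one>\<^bsub>Q\<^esub>}" using monoQ by (simp add: monolithic_def)
  have codQ: "codegrees Q \<subseteq> {1, of_nat p, of_nat p ^ b, of_nat p ^ a}"
    using N2.codegrees_FactGroup[OF fin\<Gamma>] cod\<Gamma> unfolding Q_def by blast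
  obtain x2 where x2: "x2 \<in> carrier Q" "x2 \<notin> group_center Q"
    using nonabelian[OF Q.is_group LQ1] by (auto simp: group_center_def)
  have x2M: "commutator Q h x2 \<in> lower_central Q 1" if h: "h \<in> carrier Q" for h
    using Q.lower_central_commutator[of h 0 x2] h x2 by simp
  obtain v2 e2 where v2: "v2 \<in> {0, 1, b, a}" "k = v2 + e2" "2 * e2 + 1 \<le> k" "1 \<le> e2"
    and e2: "e2 = 1 \<Longrightarrow> p ^ k \<le> p * (card (lower_central Q 1) * card (group_center Q))"
    using Q.monolithic_codegree[OF p(1) k monoQ LQ(2) codQ nonabelian[OF Q.is_group LQ1]] x2 x2M by blast
  \<comment> \<open>\<open>Q\<close> has class 2, so \<open>N2\<close> contains the monolith of
    \<Gamma> and passing to \<open>Q\<close> loses at least a factor \<open>p\<close>.\<close>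
  have "lower_central \<Gamma> 2 \<subseteq> N2"
    using LQ(1) N2.lower_central_FactGroup_trivial_iff[of 2] by (simp add: Q_def numeral_2_eq_2)
  have finN2: "finite N2" using fin\<Gamma> finite_subset[OF N2.subset] by blast
  have "p \<le> card N2" using card_mono[OF finN2 \<open>lower_central \<Gamma> 2 \<subseteq> N2\<close>] L\<Gamma>(3) by simp
  hence "p ^ k * p \<le> p ^ g" using cQ k by (metis mult_le_mono2)
  hence "p ^ (k + 1) \<le> p ^ g" by (simp add: mult.commute)
  hence kg: "k + 1 \<le> g" by (rule power_le_imp_le_exp[OF p1])

  have W2: "\<not> (k + 1 = g \<and> 4 \<le> k \<and> e2 = 1)"
  proof (intro notI, elim conjE)
    assume kg': "k + 1 = g" and k4: "4 \<le> k" and e21: "e2 = 1"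
    \<comment> \<open>\<open>k + 1 = g\<close> means that \<open>N2\<close> has order
      \<open>p\<close>, hence is exactly \<gamma>_3 of \<Gamma>.\<close>
    have "p ^ k * card N2 = p ^ k * p" using cQ k kg' by (simp add: mult.commute flip: kg')
    hence "card N2 = p" using p1 by simp
    hence N2eq: "lower_central \<Gamma> 2 = N2"
      using card_subset_eq[OF finN2 \<open>lower_central \<Gamma> 2 \<subseteq> N2\<close>] L\<Gamma>(3) by simp
    have N2Z: "N2 \<subseteq> group_center \<Gamma>" using L\<Gamma>(2) N2eq by simp
    \<comment> \<open>In degree \<open>p\<close> the order \<open>p^k\<close> of \<open>Q\<close> is
      at most \<open>p * p\<close> times that of its centre, which is therefore at least
      \<open>p^(k-2)\<close>, more than \<open>p\<close> since \<open>k \<ge> 4\<close>.\<close>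
    have "k - 2 + 2 = k" using k4 by simp
    hence "p ^ k = p ^ (k - 2) * (p * p)" by (metis power_add power2_eq_square)
    hence "p ^ (k - 2) * (p * p) \<le> card (group_center Q) * (p * p)" using e2[OF e21] LQ(3) by (simp add: ac_simps)
    hence "p ^ (k - 2) \<le> card (group_center Q)" using p1 by simp
    moreover have "p ^ 1 < p ^ (k - 2)" using k4 p1 by (intro power_strict_increasing) auto
    ultimately have Z: "p < card (group_center (\<Gamma> Mod N2))" by (simp add: Q_def)
    \<comment> \<open>The root argument with \<open>N = N2\<close> and trivial \<open>N'\<close>: it
      would make \<gamma>_2 of \<Gamma> central, although \<Gamma> has class 3.\<close>
    have "commutator \<Gamma> s h \<in> {\<one>\<^bsub>\<Gamma>\<^esub>}" if s: "s \<in> lower_central \<Gamma> 1" and h: "h \<in> carrier \<Gamma>" for s h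
    proof (rule \<Gamma>.large_center_monolith_central[OF p(1) g N2(1) \<Gamma>.one_is_normal _ _ N2(2) _ Z _ _ h])
      show "commutator \<Gamma> k g \<in> {\<one>\<^bsub>\<Gamma>\<^esub>}" if "k \<in> N2" "g \<in> carrier \<Gamma>" for k g
        using that N2Z \<Gamma>.commutator_eq_one_iff[of k g] by (auto simp: group_center_def)
      show "k [^]\<^bsub>\<Gamma>\<^esub> p \<in> {\<one>\<^bsub>\<Gamma>\<^esub>}" if "k \<in> N2" for k
        using \<Gamma>.pow_card_subgroup[OF N2.is_subgroup that] \<open>card N2 = p\<close> by simp
      show "lower_central (\<Gamma> Mod N2) 1 \<subseteq> group_center (\<Gamma> Mod N2)" using LQ(2) by (simp add: Q_def)
      show "s \<in> carrier \<Gamma>" using s \<Gamma>.lower_central_subset by blast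
      show "N2 #>\<^bsub>\<Gamma>\<^esub> s \<in> lower_central (\<Gamma> Mod N2) 1" using s by (simp add: N2.lower_central_FactGroup)
    qed
    hence "lower_central \<Gamma> (Suc 1) \<subseteq> {\<one>\<^bsub>\<Gamma>\<^esub>}" by (intro \<Gamma>.lower_central_Suc_le \<Gamma>.triv_subgroup)
    thus False using L\<Gamma>2 subgroup.one_closed[OF normal_imp_subgroup[OF \<Gamma>.lower_central_normal[of 2]]]
      by (auto simp: numeral_2_eq_2)
  qed

  have W3: "\<not> (e3 = 1 \<and> f 3 = f 4 + 1 \<and> f 1 + 3 \<le> m \<and> g + f 3 = m)"
  proof (intro notI, elim conjE)
    assume e31: "e3 = 1" and f34: "f 3 = f 4 + 1" and f1m: "f 1 + 3 \<le> m" and gf3: "g + f 3 = m"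
    \<comment> \<open>\<Gamma> has class 3, so \<gamma>_4 lies in \<open>N3\<close>;
      \<open>g + f 3 = m\<close> makes the orders equal.\<close>
    have "lower_central G 3 \<subseteq> N3"
      using L\<Gamma>(1) N3.lower_central_FactGroup_trivial_iff[of 3] by (simp add: \<Gamma>_def eval_nat_numeral)
    moreover have finN3: "finite N3" using fin finite_subset[OF N3.subset] by blast
    moreover have "p ^ g * card N3 = p ^ g * p ^ f 3" using c\<Gamma> g gf3 by (simp flip: power_add)
    hence cN3: "card N3 = p ^ f 3" using p1 by simp
    ultimately have N3eq: "N3 = lower_central G 3" using f by (metis card_subset_eq)
    have N3L1: "N3 \<subseteq> lower_central G 1" unfolding N3eq by (rule lower_central_antimono) simp
    have "card (lower_central \<Gamma> 1) * card N3 = card (lower_central G 1)"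
      unfolding \<Gamma>_def N3.lower_central_FactGroup by (rule N3.card_image_FactGroup[OF fin sub N3L1])
    hence L1N3: "card (lower_central \<Gamma> 1) * p ^ f 3 = p ^ f 1" using cN3 f by simp
    have "p ^ m = p ^ g * p ^ f 3" using gf3 by (simp flip: power_add)
    also have "\<dots> \<le> p * (card (lower_central \<Gamma> 1) * card (group_center \<Gamma>)) * p ^ f 3"
      using e3[OF e31] by (rule mult_le_mono1)
    also have "\<dots> = p ^ (f 1 + 1) * card (group_center \<Gamma>)" using L1N3 by (simp add: ac_simps)
    finally have le: "p ^ m \<le> p ^ (f 1 + 1) * card (group_center \<Gamma>)" .
    \<comment> \<open>Cancellation leaves a centre of order at least \<open>p^(m - f 1 - 1)\<close>,
      and \<open>f 1 + 3 \<le> m\<close> raises this to \<open>p^2\<close>.\<close>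
    have "f 1 + 1 + (m - (f 1 + 1)) = m" using f1m by simp
    hence "p ^ m = p ^ (f 1 + 1) * p ^ (m - (f 1 + 1))" by (metis power_add)
    with le have "p ^ (m - (f 1 + 1)) \<le> card (group_center \<Gamma>)"
      using p1 by (metis mult_le_cancel1 not_less_zero power_not_zero neq0_conv)
    moreover have "p ^ 1 < p ^ (m - (f 1 + 1))" using f1m p1 by (intro power_strict_increasing) auto
    ultimately have Z: "p < card (group_center (G Mod N3))" by (simp add: \<Gamma>_def)
    \<comment> \<open>The root argument with \<open>N = \<gamma>_4\<close> and
      \<open>N' = \<gamma>_5\<close>. The condition on \<open>p\<close>-th powers holds because
      \<open>f34\<close> says that |\<gamma>_4/\<gamma>_5| is \<open>p\<close>. The outcome
      \<gamma>_4 \<le> \<gamma>_5 contradicts strict descent.\<close>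
    have L34: "commutator G s h \<in> lower_central G 4" if s: "s \<in> lower_central G 2" and h: "h \<in> carrier G" for s h
    proof (rule large_center_monolith_central[OF p N3(1) lower_central_normal _ _ N3(2) _ Z _ _ h])
      show "commutator G k g \<in> lower_central G 4" if "k \<in> N3" "g \<in> carrier G" for k g
        using lower_central_commutator[of k 3 g] that N3eq by (simp add: eval_nat_numeral)
      interpret L4: normal "lower_central G 4" G by (rule lower_central_normal)
      show "k [^] p \<in> lower_central G 4" if "k \<in> N3" for k
        by (rule L4.pow_index_in_normal[OF fin N3.is_subgroup _ _ that])
          (use f f34 N3eq lower_central_antimono[of 3 4] in auto)
      show "lower_central (G Mod N3) 2 \<subseteq> group_center (G Mod N3)" using L\<Gamma>(2) by (simp add: \<Gamma>_def)
      show "s \<in> carrier G" using s lower_central_subset by blast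
      show "N3 #> s \<in> lower_central (G Mod N3) 2" using s by (simp add: N3.lower_central_FactGroup)
    qed
    have "lower_central G (Suc 2) \<subseteq> lower_central G 4" by (rule lower_central_Suc_le[OF sub L34])
    hence "card (lower_central G 3) \<le> card (lower_central G 4)"
      using finite_subset[OF lower_central_subset fin] by (intro card_mono) (simp_all add: eval_nat_numeral)
    hence "f 3 \<le> f 4" unfolding f by (rule power_le_imp_le_exp[OF p1])
    thus False using f34 by simp
  qed

  \<comment> \<open>Covers the small abelianizations, for which the bound on the centre in
    \<open>W3\<close> is too weak.\<close>
  have D: "m \<le> f 2 + 3" if "m \<le> f 1 + 2"
  proof -
    have "p ^ m \<le> p ^ (f 1 + 2)" using that p1 by (intro power_increasing) auto
    hence "card (carrier G) \<le> p\<^sup>2 * card (lower_central G 1)" unfolding p(2) f power_add by (simp only: mult.commute)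
    from index_lower_central_two[OF p this] have "p ^ m \<le> p ^ (f 2 + 3)"
      unfolding p(2) f power_add by (simp only: mult.commute)
    thus ?thesis by (rule power_le_imp_le_exp[OF p1])
  qed
  show False
    by (rule codegree_exponents_contradiction[OF d f4 f12 v v3 gf2 v2 kg ab W2 W3 D])
qed

theorem theorem1p2:
  fixes G :: "('g, 'b) monoid_scheme" and p n a b :: nat
  assumes "prime p"
    and "group G"
    and "finite (carrier G)"
    and "card (carrier G) = p ^ n"
    and "codegrees G = {1, of_nat p, of_nat p ^ b, of_nat p ^ a}"
    and "2 \<le> b" and "b < a"
    and "n - nil_class G \<le> 3"
  shows "nil_class G \<le> 4 \<and> card (carrier G) \<le> p ^ 7"
proof -
  interpret G: group G by fact
  define c where "c = nil_class G"
  have p1: "1 < p" using assms(1) by (rule prime_gt_1_nat)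
  have c4: "c \<le> 4"
  proof (rule ccontr)
    assume "\<not> c \<le> 4"
    hence c5: "5 \<le> c" by simp
    \<comment> \<open>\<open>nil_class\<close> is a least index, so the term before it, which is
      \<gamma>_c, is still nontrivial.\<close>
    have "lower_central G (c - 1) \<noteq> {\<one>\<^bsub>G\<^esub>}"
      using not_less_Least[of "c - 1" "\<lambda>c. lower_central G c = {\<one>\<^bsub>G\<^esub>}"] c5
      by (auto simp: c_def nil_class_def)
    from G.exists_monolithic_quotient[OF assms(3) this] obtain N
      where N: "N \<lhd> G" "monolithic (G Mod N) (lower_central (G Mod N) (c - 1))" by blast
    interpret N: normal N G by (rule N)
    interpret Q: group "G Mod N" by (rule N.factorgroup_is_group)
    have "card (carrier (G Mod N)) dvd p ^ n"
      using N.card_FactGroup[OF assms(3)] assms(4) by (metis dvd_triv_left)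
    then obtain m where m: "card (carrier (G Mod N)) = p ^ m" "m \<le> n"
      using divides_primepow_nat[OF assms(1)] by blast
    show False
    proof (rule Q.no_large_class[OF assms(1) m(1) _ _ N(2) _ assms(6,7)])
      \<comment> \<open>With \<open>d = c - 1\<close>, the coclass hypothesis
        \<open>n \<le> c + 3\<close> becomes \<open>n \<le> d + 4\<close>; the quotient has class
        \<open>c\<close> and its order is no larger.\<close>
      show "4 \<le> c - 1" "m \<le> c - 1 + 4" using c5 m(2) assms(8) by (auto simp: c_def)
      show "codegrees (G Mod N) \<subseteq> {1, of_nat p, of_nat p ^ b, of_nat p ^ a}"
        using N.codegrees_FactGroup[OF assms(3)] assms(5) by simp
    qed
  qed
  \<comment> \<open>The exponent 7 is the class bound 4 plus the coclass bound 3.\<close>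
  moreover have "p ^ n \<le> p ^ 7" using c4 assms(8) p1 by (intro power_increasing) (auto simp: c_def)
  ultimately show ?thesis using assms(4) by (simp add: c_def)
qed

end
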